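(* Let $k\ge 2$ be a fixed integer and let $p_k(n)$ be the number of partitions of $n$ with no $k$-sequence. Then, as $n\to\infty$, $$p_k(n)\sim\frac{1}{2k}\left(\frac16\left(1-\frac{2}{k(k+1)}\right)\right)^{\frac14}\frac{1}{n^{3/4}}\exp\left(\pi\sqrt{\frac23\left(1-\frac{2}{k(k+1)}\right)n}\right).$$
   Context: A partition has a $k$-sequence if there are $k$ consecutive positive integers $j,j+1,\dots,j+k-1$ each of which occurs as a part (at least once). Parts may otherwise be repeated arbitrarily. *)

theory Defs
  imports Complex_Main "HOL-Library.Multiset" "HOL-Library.Landau_Symbols"
begin

definition partitions :: "nat \<Rightarrow> nat multiset set" where
  "partitions n = {P. (\<forall>i \<in># P. 0 < i) \<and> sum_mset P = n}"

definition has_k_sequence :: "nat \<Rightarrow> nat multiset \<Rightarrow> bool" where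
  "has_k_sequence k P \<longleftrightarrow> (\<exists>j>0. \<forall>i\<in>{j..<j+k}. i \<in># P)"

definition p_no_seq :: "nat \<Rightarrow> nat \<Rightarrow> nat" where
  "p_no_seq k n = card {P \<in> partitions n. \<not> has_k_sequence k P}"

text \<open>Each set of partitions is finite, so the cardinality in \<open>p_no_seq\<close> is a genuine count.\<close>

lemma finite_partitions: "finite (partitions n)"
proof -
  have "partitions n \<subseteq> mset ` {xs. set xs \<subseteq> {..n} \<and> length xs \<le> n}"
  proof
    fix P assume P: "P \<in> partitions n"
    obtain xs where xs: "P = mset xs" by (metis ex_mset)
    have pos: "\<forall>i\<in>set xs. 0 < i" and s: "sum_list xs = n"
      using P unfolding xs partitions_def by (auto simp: sum_mset_sum_list)
    have "\<forall>i\<in>set xs. i \<le> n"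
      using s member_le_sum_list by blast
    moreover have "length xs \<le> sum_list xs"
      using pos by (induction xs) auto
    ultimately show "P \<in> mset ` {xs. set xs \<subseteq> {..n} \<and> length xs \<le> n}"
      using xs s by auto
  qed
  then show ?thesis
    by (rule finite_subset) (intro finite_imageI finite_lists_length_le finite_atMost)
qed

end

theory Submission
  imports Defs "HOL-Complex_Analysis.Complex_Analysis" "HOL-Probability.Probability" "HOL-Real_Asymp.Real_Asymp"
begin

text \<open>
  Let \<open>G(q)\<close> be the generating function of the partitions without \<open>k\<close>-sequence. Splitting partitions
  by the set of their part sizes, \<open>G(q) * (\<Prod>i. 1 - q ^ i)\<close> is the probability that independent events
  of probabilities \<open>q ^ i\<close> contain no run of length \<open>k\<close>. This probability satisfies a linear recursion
  in the first index, whose solution is the series \<open>F\<^sub>k(q) = (\<Sum>n. b\<^sub>n * q ^ (n * (n + 1) div 2))\<close>, where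
  \<open>B(z) = (\<Sum>n. b\<^sub>n * z ^ n)\<close> solves \<open>B(z) * (1 - z ^ (k + 1)) = (1 - z ^ k) * B(q * z)\<close>. For \<open>k = 1\<close>
  only the empty partition remains, so \<open>F\<^sub>1(q) = (\<Prod>i. 1 - q ^ i)\<close> and \<open>G = F\<^sub>k / F\<^sub>1\<close>.

  With \<open>q = exp (- s)\<close>, the quadratic exponent turns \<open>F\<^sub>k\<close> into the integral of
  \<open>exp (w\<^sup>2 / (2 * s)) * B(exp (- w - s / 2))\<close> over the imaginary axis. The logarithm of this integrand has an
  explicit increment over a step of length \<open>s\<close>, so the integrand is \<open>exp (\<Phi> w / s) * (1 + O(s))\<close> in a
  strip, with \<open>\<Phi>\<close> a combination of dilogarithms. Moving the contour to the left, where \<open>\<Phi>\<close> is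
  exponentially close to a constant \<open>c\<close>, along the lines of steepest descent \<open>Im w = pi / k\<close> and
  \<open>Im w = - pi / k\<close>, on which the integrand is nearly real, gives
  \<open>F\<^sub>k(q) * sqrt (2 * pi * s) \<sim> (2 * pi / k) * exp (c / s)\<close>, hence \<open>G(exp (- s)) \<sim> exp (\<lambda> / s) / k\<close>.

  These real asymptotics extend, by Vitali's theorem, to complex arguments at distance \<open>O(s powr (3/2))\<close>
  from \<open>s\<close>. Away from the real axis \<open>G\<close> is small because changing the sizes \<open>{i - 1, i, i + 1}\<close> of a
  partition to \<open>{i}\<close> never creates a run, which leaves enough independent oscillating factors. The
  saddle-point evaluation of the Cauchy integral for the coefficients then gives the theorem.
\<close>

section \<open>Run-free sets and their recursion\<close>

text \<open>The obstacle is cancellation. With P = pi^2 / (6 k (k + 1)), the integrand on the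
  imaginary axis has size about exp (- P / s) near 0, while the integral is only of order exp (- 2 P
  / s). Absolute values on the axis therefore help only at heights y with y^2 / 4 > P. Lower down
  the contour moves left to a vertical side on which the integrand is nearly exp (c / s) with c = -
  2 P; its length 2 y gives the main term. On the horizontal sides the integrand has the same order
  on a stretch of length about ln (1 / s). They are negligible because the series is real: only the
  imaginary part of the integrand counts there. Treating all k >= 1 at once also yields the Euler
  product, as the case k = 1, and sqrt (2 * pi * s) cancels in the quotient. In the last section
  real asymptotics suffice because coefficients are nonnegative: normalised at the saddle point, the
  generating function is a moment generating function, which its values at two real points bound on
  a vertical strip. That is the bound Vitali's theorem needs. The scale s powr (3/2) is the standard
  deviation in question, the second derivative of \<lambda> / s being 2 \<lambda> / s^3.\<close>

definition run_free :: "nat \<Rightarrow> nat set \<Rightarrow> bool" where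
  "run_free k S \<longleftrightarrow> (\<forall>j. \<not> {j..<j+k} \<subseteq> S)"

lemma run_free_mono: "run_free k T \<Longrightarrow> S \<subseteq> T \<Longrightarrow> run_free k S"
  unfolding run_free_def by blast

definition run_free_sets :: "nat \<Rightarrow> nat \<Rightarrow> nat \<Rightarrow> nat set set" where
  "run_free_sets k m M = {S. S \<subseteq> {m<..M} \<and> run_free k S}"

definition run_free_sum :: "nat \<Rightarrow> (nat \<Rightarrow> 'a::comm_semiring_1) \<Rightarrow> nat \<Rightarrow> nat \<Rightarrow> 'a" where
  "run_free_sum k a m M = (\<Sum>S\<in>run_free_sets k m M. \<Prod>i\<in>S. a i)"

lemma finite_run_free_sets [simp]: "finite (run_free_sets k m M)"
  by (rule finite_subset[of _ "Pow {m<..M}"]) (auto simp: run_free_sets_def)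

lemma run_free_sets_finite: "S \<in> run_free_sets k m M \<Longrightarrow> finite S"
  by (auto simp: run_free_sets_def intro: finite_subset)

text \<open>The inserted element is the least one, so a run that uses it must start at it.\<close>

lemma run_free_insert_iff:
  assumes "k \<ge> 1" "S \<subseteq> {Suc m<..M}"
  shows "run_free k (insert (Suc m) S) \<longleftrightarrow> run_free k S \<and> \<not> {Suc m<..m+k} \<subseteq> S"
proof
  assume *: "run_free k (insert (Suc m) S)"
  have "{Suc m..<Suc m + k} \<subseteq> insert (Suc m) {Suc m<..m+k}" by auto
  then have "{Suc m<..m+k} \<subseteq> S \<Longrightarrow> {Suc m..<Suc m + k} \<subseteq> insert (Suc m) S"
    by blast
  with * show "run_free k S \<and> \<not> {Suc m<..m+k} \<subseteq> S"
    using run_free_mono[OF *] unfolding run_free_def by blast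
next
  assume *: "run_free k S \<and> \<not> {Suc m<..m+k} \<subseteq> S"
  show "run_free k (insert (Suc m) S)"
    unfolding run_free_def
  proof (intro allI notI)
    fix j assume j: "{j..<j+k} \<subseteq> insert (Suc m) S"
    have "j \<in> {j..<j+k}" using assms by simp
    then have "j \<in> insert (Suc m) S" using j by blast
    then have "j \<ge> Suc m" using assms by auto
    moreover have "j \<noteq> Suc m"
    proof
      assume "j = Suc m"
      moreover have "{Suc m<..m+k} \<subseteq> {Suc m..<Suc m + k} - {Suc m}" by auto
      ultimately have "{Suc m<..m+k} \<subseteq> S" using j by blast
      with * show False by blast
    qed
    ultimately have "{j..<j+k} \<subseteq> S" using j by (auto simp: subset_iff)
    with * show False unfolding run_free_def by blast
  qed
qed

text \<open>Classification by membership of m + 1. The sets that must not be extended contain m + 2,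
  ..., m + k; being run-free they miss m + k + 1, so beyond that point they are arbitrary run-free
  sets. This decoupling makes the recursion linear.\<close>

lemma run_free_sets_split:
  assumes "k \<ge> 1" "m + k \<le> M"
  shows "run_free_sets k m M = run_free_sets k (Suc m) M \<union>
     insert (Suc m) ` (run_free_sets k (Suc m) M - (\<union>) {Suc m<..m+k} ` run_free_sets k (m+k+1) M)"
    (is "?A = ?B \<union> insert (Suc m) ` (?B - ?C)")
proof -
  have C: "S \<in> ?C \<longleftrightarrow> {Suc m<..m+k} \<subseteq> S" if S: "S \<in> ?B" for S
  proof
    assume L: "{Suc m<..m+k} \<subseteq> S"
    have S': "S \<subseteq> {Suc m<..M}" "run_free k S" using S by (auto simp: run_free_sets_def)
    have "\<not> {m+2..<m+2+k} \<subseteq> S" using S'(2) unfolding run_free_def by blast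
    then have nin: "m+k+1 \<notin> S"
    proof (rule contrapos_nn)
      assume a: "m+k+1 \<in> S"
      show "{m+2..<m+2+k} \<subseteq> S"
      proof
        fix x assume "x \<in> {m+2..<m+2+k}"
        then have "x \<in> {Suc m<..m+k} \<or> x = m+k+1" by auto
        then show "x \<in> S" using L a by blast
      qed
    qed
    have "S = {Suc m<..m+k} \<union> (S \<inter> {m+k+1<..M})"
    proof (rule set_eqI)
      fix x show "x \<in> S \<longleftrightarrow> x \<in> {Suc m<..m+k} \<union> (S \<inter> {m+k+1<..M})"
        using L S' nin by (cases "x = m+k+1") (auto simp: subset_iff)
    qed
    moreover have "S \<inter> {m+k+1<..M} \<in> run_free_sets k (m+k+1) M"
      using run_free_mono[OF S'(2)] by (auto simp: run_free_sets_def)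
    ultimately show "S \<in> ?C" by blast
  qed auto
  show ?thesis
  proof (rule set_eqI)
    fix S
    show "S \<in> ?A \<longleftrightarrow> S \<in> ?B \<union> insert (Suc m) ` (?B - ?C)"
    proof (cases "Suc m \<in> S")
      case False
      then have "S \<in> ?A \<longleftrightarrow> S \<in> ?B"
        by (auto simp: run_free_sets_def subset_iff) (metis Suc_lessI)
      with False show ?thesis by auto
    next
      case True
      define S' where "S' = S - {Suc m}"
      have SS': "S = insert (Suc m) S'" "Suc m \<notin> S'" using True by (auto simp: S'_def)
      have nB: "S \<notin> ?B" using True by (auto simp: run_free_sets_def)
      have "S \<in> ?A \<longleftrightarrow> S' \<in> ?B - ?C"
      proof (cases "S' \<subseteq> {Suc m<..M}")
        case sub: True
        then have "S \<in> ?A \<longleftrightarrow> run_free k S' \<and> \<not> {Suc m<..m+k} \<subseteq> S'"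
          using run_free_insert_iff[OF assms(1) sub] SS' assms
          by (auto simp: run_free_sets_def subset_iff)
        also have "\<dots> \<longleftrightarrow> S' \<in> ?B - ?C"
          using C[of S'] sub by (auto simp: run_free_sets_def)
        finally show ?thesis .
      next
        case False
        then have "S' \<notin> ?B" by (auto simp: run_free_sets_def)
        moreover have "S \<notin> ?A"
        proof
          assume "S \<in> ?A"
          then have "S' \<subseteq> {Suc m<..M}" using SS'
            by (auto simp: run_free_sets_def subset_iff) (metis Suc_lessI)
          with False show False by blast
        qed
        ultimately show ?thesis by blast
      qed
      also have "S' \<in> ?B - ?C \<longleftrightarrow> S \<in> insert (Suc m) ` (?B - ?C)"
      proof
        assume "S \<in> insert (Suc m) ` (?B - ?C)"
        then obtain U where U: "U \<in> ?B - ?C" "S = insert (Suc m) U" by blast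
        then have "Suc m \<notin> U" by (auto simp: run_free_sets_def)
        then have "U = S'" using U(2) SS' by (metis insert_ident)
        with U show "S' \<in> ?B - ?C" by simp
      qed (use SS' in blast)
      finally show ?thesis using nB by blast
    qed
  qed
qed

text \<open>The factor \<open>1 + a (Suc m)\<close> takes every run-free set above m + 1 with and
  without m + 1; the subtracted term removes the extensions that complete the block m + 1, ..., m +
  k.\<close>

lemma run_free_sum_rec:
  fixes a :: "nat \<Rightarrow> 'a::comm_ring_1"
  assumes "k \<ge> 1" "m + k \<le> M"
  shows "run_free_sum k a m M = (1 + a (Suc m)) * run_free_sum k a (Suc m) M
          - (\<Prod>i\<in>{m<..m+k}. a i) * run_free_sum k a (m+k+1) M"
proof -
  let ?B = "run_free_sets k (Suc m) M" and ?D = "run_free_sets k (m+k+1) M"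
  let ?C = "(\<union>) {Suc m<..m+k} ` ?D"
  let ?p = "\<lambda>S. \<Prod>i\<in>S. a i"
  have nB: "Suc m \<notin> S" "finite S" if "S \<in> ?B" for S
    using that run_free_sets_finite[OF that] by (auto simp: run_free_sets_def)
  have CB: "?C \<subseteq> ?B"
  proof
    fix S assume "S \<in> ?C"
    then obtain U where U: "U \<in> ?D" "S = {Suc m<..m+k} \<union> U" by blast
    have US: "U \<subseteq> {m+k+1<..M}" "run_free k U" using U by (auto simp: run_free_sets_def)
    have "run_free k S" unfolding run_free_def
    proof (intro allI notI)
      fix j assume j: "{j..<j+k} \<subseteq> S"
      have "m+k+1 \<notin> S" using U US by auto
      then have "m+k+1 \<notin> {j..<j+k}" using j by blast
      then have "j > m+k+1 \<or> j + k \<le> m+k+1" by auto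
      then show False
      proof
        assume "j > m+k+1"
        then have "{j..<j+k} \<subseteq> U" using j U(2) by (auto simp: subset_iff)
        then show False using US unfolding run_free_def by blast
      next
        assume "j + k \<le> m+k+1"
        then have "j \<le> m+1" "j \<in> {j..<j+k}" using assms by auto
        then have "j \<in> S" using j by blast
        then show False using U US \<open>j \<le> m+1\<close> by auto
      qed
    qed
    then show "S \<in> ?B" using U US assms by (auto simp: run_free_sets_def)
  qed
  have inj1: "inj_on (insert (Suc m)) (?B - ?C)"
    using nB by (intro inj_onI) (metis DiffD1 insert_ident)
  have inj2: "inj_on ((\<union>) {Suc m<..m+k}) ?D"
  proof (rule inj_onI)
    fix U V assume "U \<in> ?D" "V \<in> ?D" and eq: "{Suc m<..m+k} \<union> U = {Suc m<..m+k} \<union> V"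
    then have "U \<inter> {Suc m<..m+k} = {}" "V \<inter> {Suc m<..m+k} = {}"
      by (auto simp: run_free_sets_def subset_iff)
    with eq show "U = V" by blast
  qed
  have sC: "sum ?p ?C = (\<Prod>i\<in>{Suc m<..m+k}. a i) * sum ?p ?D"
  proof -
    have "sum ?p ?C = (\<Sum>U\<in>?D. ?p ({Suc m<..m+k} \<union> U))"
      using sum.reindex[OF inj2, of ?p] by simp
    also have "\<dots> = (\<Sum>U\<in>?D. (\<Prod>i\<in>{Suc m<..m+k}. a i) * ?p U)"
    proof (rule sum.cong[OF refl])
      fix U assume "U \<in> ?D"
      then show "?p ({Suc m<..m+k} \<union> U) = (\<Prod>i\<in>{Suc m<..m+k}. a i) * ?p U"
        using run_free_sets_finite by (intro prod.union_disjoint) (auto simp: run_free_sets_def subset_iff)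
    qed
    finally show ?thesis by (simp add: sum_distrib_left)
  qed
  have "run_free_sum k a m M = sum ?p ?B + sum ?p (insert (Suc m) ` (?B - ?C))"
    unfolding run_free_sum_def run_free_sets_split[OF assms]
    by (rule sum.union_disjoint) (use nB in auto)
  also have "sum ?p (insert (Suc m) ` (?B - ?C)) = (\<Sum>S\<in>?B - ?C. ?p (insert (Suc m) S))"
    using sum.reindex[OF inj1, of ?p] by simp
  also have "\<dots> = (\<Sum>S\<in>?B - ?C. a (Suc m) * ?p S)"
    using nB by (intro sum.cong refl) (auto simp: prod.insert)
  also have "\<dots> = a (Suc m) * (sum ?p ?B - sum ?p ?C)"
    using CB by (simp add: sum_diff sum_distrib_left[symmetric])
  also have "{m<..m+k} = insert (Suc m) {Suc m<..m+k}" using assms by auto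
  then have "(\<Prod>i\<in>{m<..m+k}. a i) = a (Suc m) * (\<Prod>i\<in>{Suc m<..m+k}. a i)" by simp
  then show ?thesis using sC calculation
    unfolding run_free_sum_def by (simp add: algebra_simps)
qed

section \<open>Coefficients of the gap series\<close>

text \<open>The guard \<open>0 < k\<close> only serves termination.\<close>
fun gap_coeff :: "nat \<Rightarrow> real \<Rightarrow> nat \<Rightarrow> real" where
  "gap_coeff k q n = (if n = 0 then 1 else
     ((if k < n then gap_coeff k q (n - Suc k) else 0)
      - (if 0 < k \<and> k \<le> n then q ^ (n - k) * gap_coeff k q (n - k) else 0)) / (1 - q ^ n))"

declare gap_coeff.simps [simp del]

lemma gap_coeff_0 [simp]: "gap_coeff k q 0 = 1"
  by (simp add: gap_coeff.simps)

text \<open>The coefficient of z^n in B(z) (1 - z^(k+1)) = (1 - z^k) B(q z).\<close>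

lemma gap_coeff_rec:
  assumes "0 < q" "q < 1" "k \<ge> 1" "n > 0"
  shows "gap_coeff k q n * (1 - q ^ n) =
    (if k < n then gap_coeff k q (n - Suc k) else 0) - (if k \<le> n then q ^ (n - k) * gap_coeff k q (n - k) else 0)"
proof -
  have "q ^ n < 1" using assms by (simp add: power_less_one_iff)
  then show ?thesis using assms by (subst gap_coeff.simps) auto
qed

text \<open>One step of the recursion multiplies the running bound by at most (1 + q^n / q^k) / (1 -
  q^n), and the product of these factors converges. The bound blows up as q tends to 1, which is
  harmless: it serves only convergence for fixed q.\<close>

lemma gap_coeff_bounded:
  assumes q: "0 < q" "q < 1" and k: "k \<ge> 1"
  shows "\<exists>C. \<forall>n. \<bar>gap_coeff k q n\<bar> \<le> C"
proof -
  \<comment> \<open>The first summand absorbs \<open>q ^ (n - k) = q ^ n / q ^ k\<close>, the second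
    comes from 1 / (1 - q^n) <= exp (q^n / (1 - q)).\<close>
  define K where "K = 1 / q ^ k + 1 / (1 - q)"
  have K0: "K > 0" using q by (auto simp: K_def intro!: add_pos_pos)
  define R where "R = (\<lambda>n. exp (K * (\<Sum>j\<in>{1..n}. q ^ j)))"
  have R_mono: "R m \<le> R n" if "m \<le> n" for m n
    unfolding R_def using that K0 q by (auto intro!: mult_left_mono sum_mono2)
  have main: "\<bar>gap_coeff k q n\<bar> \<le> R n" for n
  proof (induction n rule: less_induct)
    case (less n)
    show ?case
    proof (cases "n = 0")
      case False
      have qn: "q ^ n < 1" "0 < q ^ n" "q ^ n \<le> q"
        using q False power_decreasing[of 1 n q] by (auto simp: power_less_one_iff)
      have R1: "\<bar>gap_coeff k q (n - Suc j)\<bar> \<le> R (n-1)" if "j < n" for j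
        using less.IH[of "n - Suc j"] R_mono[of "n - Suc j" "n-1"] that by (auto intro: order_trans)
      have 1: "\<bar>if k < n then gap_coeff k q (n - Suc k) else 0\<bar> \<le> R (n-1)"
        using R1[of k] by (auto simp: R_def)
      have 2: "\<bar>if k \<le> n then q ^ (n - k) * gap_coeff k q (n - k) else 0\<bar> \<le> (q ^ n / q ^ k) * R (n-1)"
      proof (cases "k \<le> n")
        case True
        have "q ^ (n-k) = q ^ n / q ^ k" using True q by (simp add: power_diff)
        moreover have "\<bar>gap_coeff k q (n - k)\<bar> \<le> R (n-1)" using R1[of "k-1"] k True False by simp
        ultimately show ?thesis using True q by (auto simp: abs_mult intro!: mult_left_mono divide_right_mono)
      qed (use q in \<open>auto simp: R_def\<close>)
      have "\<bar>gap_coeff k q n\<bar> * (1 - q ^ n) = \<bar>gap_coeff k q n * (1 - q ^ n)\<bar>"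
        using qn by (simp add: abs_mult)
      also have "\<dots> \<le> R (n-1) + (q ^ n / q ^ k) * R (n-1)"
        unfolding gap_coeff_rec[OF q k, of n, OF False[unfolded neq0_conv]] using 1 2 by linarith
      also have "\<dots> = R (n-1) * (1 + q ^ n * (1 / q ^ k))" by (simp add: algebra_simps)
      also have "\<dots> \<le> R (n-1) * exp (q ^ n * (1 / q ^ k))"
        by (intro mult_left_mono exp_ge_add_one_self) (simp add: R_def)
      finally have "\<bar>gap_coeff k q n\<bar> \<le> R (n-1) * exp (q ^ n * (1 / q ^ k)) * (1 / (1 - q ^ n))"
        using qn by (simp add: field_simps)
      also have "1 / (1 - q ^ n) = 1 + q ^ n / (1 - q ^ n)" using qn by (simp add: field_simps)
      also have "\<dots> \<le> exp (q ^ n / (1 - q ^ n))" by (rule exp_ge_add_one_self)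
      also have "\<dots> \<le> exp (q ^ n * (1 / (1 - q)))"
        using qn q by (auto intro!: divide_left_mono mult_pos_pos)
      also have "R (n-1) * exp (q ^ n * (1 / q ^ k)) * exp (q ^ n * (1 / (1 - q))) = R (n-1) * exp (K * q ^ n)"
        by (simp add: K_def exp_add[symmetric] algebra_simps)
      also have "\<dots> = R n"
      proof -
        obtain n' where "n = Suc n'" using False by (cases n) auto
        then show ?thesis by (simp add: R_def exp_add[symmetric] algebra_simps)
      qed
      finally show ?thesis by (simp add: R_def mult_left_mono)
    qed (simp add: R_def)
  qed
  have "R n \<le> exp (K * (1 / (1 - q)))" for n
  proof -
    have "(\<Sum>j\<in>{1..n}. q ^ j) \<le> (\<Sum>j. q ^ j)"
      by (rule sum_le_suminf) (use q in auto)
    also have "\<dots> = 1 / (1 - q)" using q by (simp add: suminf_geometric)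
    finally have "K * (\<Sum>j\<in>{1..n}. q ^ j) \<le> K * (1 / (1 - q))" using K0 by (intro mult_left_mono) auto
    then show ?thesis unfolding R_def by simp
  qed
  with main show ?thesis by (meson order_trans)
qed

definition tri :: "nat \<Rightarrow> nat" where "tri n = n * (n + 1) div 2"

lemma tri_add: "tri (a + b) = tri a + tri b + a * b"
proof -
  have e: "2 * tri n = n * (n+1)" for n by (simp add: tri_def)
  have "2 * tri (a+b) = 2 * (tri a + tri b + a * b)"
    using e[of a] e[of b] e[of "a+b"] by (simp add: algebra_simps)
  then show ?thesis by simp
qed

text \<open>The index \<open>m\<close> matches the lower index of the run-free sums and acts as the
  dilation of z by q^m. At m = 0 this is the series F of the overview.\<close>

definition gap_series :: "nat \<Rightarrow> real \<Rightarrow> nat \<Rightarrow> real" where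
  "gap_series k q m = (\<Sum>n. gap_coeff k q n * q ^ (tri n + m * n))"

lemma tri_ge: "n \<le> tri n"
  unfolding tri_def by (induction n) auto

lemma gap_series_term_bound:
  assumes "0 < q" "q < 1" "\<forall>n. \<bar>gap_coeff k q n\<bar> \<le> C"
  shows "\<bar>gap_coeff k q n * q ^ (tri n + m * n)\<bar> \<le> C * q ^ (m * n) * q ^ n"
proof -
  have "\<bar>gap_coeff k q n * q ^ (tri n + m * n)\<bar> = \<bar>gap_coeff k q n\<bar> * (q ^ (m * n) * q ^ tri n)"
    using assms by (simp add: abs_mult power_add)
  also have "\<dots> \<le> C * (q ^ (m * n) * q ^ n)"
    using assms tri_ge[of n]
    by (intro mult_mono order.refl power_decreasing mult_left_mono) (auto intro: order_trans[OF abs_ge_zero])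
  finally show ?thesis by simp
qed

lemma gap_series_summable:
  assumes "0 < q" "q < 1" "k \<ge> 1"
  shows "summable (\<lambda>n. gap_coeff k q n * q ^ (tri n + m * n))"
proof -
  obtain C where C: "\<forall>n. \<bar>gap_coeff k q n\<bar> \<le> C" using gap_coeff_bounded[OF assms] by blast
  have C0: "C \<ge> 0" using C[rule_format, of 0] by simp
  have "norm (gap_coeff k q n * q ^ (tri n + m * n)) \<le> C * q ^ n" for n
  proof -
    have "C * q ^ (m * n) * q ^ n \<le> C * 1 * q ^ n" using assms C0
      by (intro mult_right_mono mult_left_mono power_le_one) auto
    then show ?thesis using gap_series_term_bound[OF assms(1,2) C, of n m] by simp
  qed
  moreover have "summable (\<lambda>n. C * q ^ n)" using assms by (intro summable_mult summable_geometric) auto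
  ultimately show ?thesis by (rule summable_comparison_test'[where N=0, rotated])
qed

text \<open>Passing from m to m + 1 produces the factor 1 - q^n, which the coefficient recursion
  replaces by b (n - k - 1) and q^(n - k) b (n - k). After shifting n by k + 1 and by k,
  \<open>tri_add\<close> turns both sums into the series at m + k + 1; in the second the extra power
  q^(n - k) makes up for the shorter shift.\<close>

lemma gap_series_rec:
  assumes q: "0 < q" "q < 1" and k: "k \<ge> 1"
  shows "gap_series k q m = gap_series k q (Suc m)
     - q ^ (tri k + m * k) * (1 - q ^ (m + k + 1)) * gap_series k q (m + k + 1)"
proof -
  let ?b = "gap_coeff k q"
  let ?T = "\<lambda>m n. ?b n * q ^ (tri n + m * n)"
  have sm: "summable (?T m)" for m using gap_series_summable[OF assms] .
  have "gap_series k q m - gap_series k q (Suc m) = (\<Sum>n. ?T m n - ?T (Suc m) n)"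
    unfolding gap_series_def using sm by (intro suminf_diff)
  also have "(\<lambda>n. ?T m n - ?T (Suc m) n) = (\<lambda>n. ?b n * (1 - q ^ n) * q ^ (tri n + m * n))"
    by (auto simp: power_add algebra_simps)
  also have "\<dots> = (\<lambda>n. (if k < n then ?b (n - Suc k) else 0) * q ^ (tri n + m * n)
                    - (if k \<le> n then q ^ (n - k) * ?b (n - k) else 0) * q ^ (tri n + m * n))" (is "_ = (\<lambda>n. ?u n - ?v n)")
  proof
    fix n show "?b n * (1 - q ^ n) * q ^ (tri n + m * n) = ?u n - ?v n"
    proof (cases "n = 0")
      case False
      then show ?thesis by (simp only: gap_coeff_rec[OF q k, of n] left_diff_distrib)
    qed (use k in auto)
  qed
  also have "(\<Sum>n. ?u n - ?v n) = q ^ (tri (k+1) + m * (k+1)) * gap_series k q (m+k+1)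
                  - q ^ (tri k + m * k) * gap_series k q (m+k+1)"
  proof -
    let ?S = "gap_series k q (m+k+1)"
    have S: "?T (m+k+1) sums ?S" unfolding gap_series_def using sm by (rule summable_sums)
    have "(\<lambda>n. ?u (n + Suc k)) = (\<lambda>n. q ^ (tri (k+1) + m * (k+1)) * ?T (m+k+1) n)"
      using tri_add[of _ "Suc k"] by (auto simp: power_add[symmetric] algebra_simps fun_eq_iff)
    then have "(\<lambda>n. ?u (n + Suc k)) sums (q ^ (tri (k+1) + m * (k+1)) * ?S)"
      using sums_mult[OF S] by simp
    then have u: "?u sums (q ^ (tri (k+1) + m * (k+1)) * ?S)"
      by (subst (asm) sums_iff_shift) (simp)
    have "(\<lambda>n. ?v (n + k)) = (\<lambda>n. q ^ (tri k + m * k) * ?T (m+k+1) n)"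
      using tri_add[of _ k] by (auto simp: power_add[symmetric] algebra_simps fun_eq_iff)
    then have "(\<lambda>n. ?v (n + k)) sums (q ^ (tri k + m * k) * ?S)"
      using sums_mult[OF S] by simp
    then have v: "?v sums (q ^ (tri k + m * k) * ?S)"
      by (subst (asm) sums_iff_shift) (simp)
    show ?thesis using sums_diff[OF u v] by (simp add: sums_iff)
  qed
  also have "tri (k+1) + m * (k+1) = tri k + m * k + (m + k + 1)"
    using tri_add[of k 1] by (simp add: tri_def)
  finally show ?thesis by (simp add: power_add algebra_simps)
qed

text \<open>The boundary condition for large m. Together with the recursion it identifies the series
  with the limit of the run-free probabilities.\<close>

lemma gap_series_near_1:
  assumes q: "0 < q" "q < 1" and k: "k \<ge> 1"
  shows "\<exists>C. \<forall>m. \<bar>gap_series k q m - 1\<bar> \<le> C * q ^ m"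
proof -
  obtain C where C: "\<forall>n. \<bar>gap_coeff k q n\<bar> \<le> C" using gap_coeff_bounded[OF assms] by blast
  have C0: "C \<ge> 0" using C[rule_format, of 0] by simp
  have "\<bar>gap_series k q m - 1\<bar> \<le> C * (1 / (1 - q)) * q ^ m" for m
  proof -
    let ?T = "\<lambda>n. gap_coeff k q n * q ^ (tri n + m * n)"
    have sm: "summable ?T" using gap_series_summable[OF assms] .
    have "gap_series k q m - 1 = (\<Sum>n. ?T (Suc n))"
      unfolding gap_series_def using suminf_split_head[OF sm] by (simp add: tri_def)
    moreover have "\<bar>\<Sum>n. ?T (Suc n)\<bar> \<le> (\<Sum>n. C * q ^ m * q ^ n)"
    proof (subst real_norm_def[symmetric], rule norm_suminf_le)
      show "summable (\<lambda>n. C * q ^ m * q ^ n)" using q by (intro summable_mult summable_geometric) auto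
      fix n
      have "\<bar>?T (Suc n)\<bar> \<le> C * q ^ (m * Suc n) * q ^ Suc n"
        using gap_series_term_bound[OF q C] by blast
      also have "\<dots> \<le> C * q ^ m * q ^ n"
        using q C0 by (intro mult_mono mult_left_mono power_decreasing) auto
      finally show "norm (?T (Suc n)) \<le> C * q ^ m * q ^ n" by simp
    qed
    moreover have "(\<Sum>n. C * q ^ m * q ^ n) = C * q ^ m * (1 / (1 - q))"
      using q by (subst suminf_mult) (auto simp: suminf_geometric)
    ultimately show ?thesis by (simp add: mult_ac)
  qed
  then show ?thesis by blast
qed

section \<open>Run-free probabilities and their limit\<close>

text \<open>The probability that independent events of probabilities \<open>q ^ i\<close>, \<open>m < i \<le> M\<close>, contain no run
  of length \<open>k\<close>.\<close>
definition run_free_prob :: "nat \<Rightarrow> real \<Rightarrow> nat \<Rightarrow> nat \<Rightarrow> real" where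
  "run_free_prob k q m M = run_free_sum k (\<lambda>i. q ^ i / (1 - q ^ i)) m M * (\<Prod>i\<in>{m<..M}. 1 - q ^ i)"

text \<open>The weights are odds: 1 + a i = 1 / (1 - q^i) cancels against one factor of the product,
  and the forbidden block contributes the product of q^i for m < i <= m + k.\<close>

lemma run_free_prob_rec:
  assumes q: "0 < q" "q < 1" and k: "k \<ge> 1" "m + k + 1 \<le> M"
  shows "run_free_prob k q m M = run_free_prob k q (Suc m) M
     - q ^ (tri k + m * k) * (1 - q ^ (m + k + 1)) * run_free_prob k q (m + k + 1) M"
proof -
  let ?a = "\<lambda>i. q ^ i / (1 - q ^ i)"
  have ne: "1 - q ^ i > 0" if "i > 0" for i
    using q that by (simp add: power_less_one_iff)
  have p1: "(\<Prod>i\<in>{m<..M}. 1 - q ^ i) = (1 - q ^ Suc m) * (\<Prod>i\<in>{Suc m<..M}. 1 - q ^ i)"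
  proof -
    have "{m<..M} = insert (Suc m) {Suc m<..M}" using k by auto
    then show ?thesis by simp
  qed
  have p2: "(\<Prod>i\<in>{m<..M}. 1 - q ^ i) = (\<Prod>i\<in>{m<..m+k}. 1 - q ^ i) * ((1 - q ^ (m+k+1)) * (\<Prod>i\<in>{m+k+1<..M}. 1 - q ^ i))"
  proof -
    have "{m<..M} = {m<..m+k} \<union> insert (m+k+1) {m+k+1<..M}" using k by auto
    moreover have "(\<Prod>i\<in>\<dots>. 1 - q ^ i) = (\<Prod>i\<in>{m<..m+k}. 1 - q ^ i) * (\<Prod>i\<in>insert (m+k+1) {m+k+1<..M}. 1 - q ^ i)"
      by (rule prod.union_disjoint) auto
    ultimately show ?thesis by simp
  qed
  have p3: "(\<Prod>i\<in>{m<..m+k}. ?a i) * (\<Prod>i\<in>{m<..m+k}. 1 - q ^ i) = q ^ (tri k + m * k)"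
  proof -
    have "(\<Prod>i\<in>{m<..m+k}. ?a i) * (\<Prod>i\<in>{m<..m+k}. 1 - q ^ i) = (\<Prod>i\<in>{m<..m+k}. q ^ i)"
      unfolding prod.distrib[symmetric] using ne by (intro prod.cong refl) (auto simp: less_imp_neq)
    also have "\<dots> = q ^ (tri k + m * k)"
    proof (induction k)
      case (Suc k)
      have "{m<..m+Suc k} = insert (m+Suc k) {m<..m+k}" by auto
      then show ?case using Suc tri_add[of k 1] by (simp add: tri_def power_add algebra_simps)
    qed (simp add: tri_def)
    finally show ?thesis .
  qed
  have "(1 + ?a (Suc m)) * (1 - q ^ Suc m) = 1" using ne[of "Suc m"] by (simp add: field_simps)
  moreover have "run_free_prob k q m M = (1 + ?a (Suc m)) * run_free_sum k ?a (Suc m) M * (\<Prod>i\<in>{m<..M}. 1 - q ^ i)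
       - (\<Prod>i\<in>{m<..m+k}. ?a i) * run_free_sum k ?a (m+k+1) M * (\<Prod>i\<in>{m<..M}. 1 - q ^ i)"
    unfolding run_free_prob_def using run_free_sum_rec[of k m M ?a] k by (simp add: left_diff_distrib)
  moreover have "(1 + ?a (Suc m)) * run_free_sum k ?a (Suc m) M * (\<Prod>i\<in>{m<..M}. 1 - q ^ i)
      = ((1 + ?a (Suc m)) * (1 - q ^ Suc m)) * run_free_prob k q (Suc m) M"
    unfolding run_free_prob_def p1 by (simp add: mult_ac)
  moreover have "(\<Prod>i\<in>{m<..m+k}. ?a i) * run_free_sum k ?a (m+k+1) M * (\<Prod>i\<in>{m<..M}. 1 - q ^ i)
      = ((\<Prod>i\<in>{m<..m+k}. ?a i) * (\<Prod>i\<in>{m<..m+k}. 1 - q ^ i)) * (1 - q ^ (m+k+1)) * run_free_prob k q (m+k+1) M"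
    unfolding run_free_prob_def p2 by (simp add: mult_ac)
  ultimately show ?thesis unfolding p3 by simp
qed

lemma run_free_sum_le_prod:
  fixes a :: "nat \<Rightarrow> real"
  assumes "\<And>i. i > 0 \<Longrightarrow> a i \<ge> 0"
  shows "run_free_sum k a m M \<le> (\<Prod>i\<in>{m<..M}. 1 + a i)"
proof -
  have "run_free_sum k a m M \<le> (\<Sum>S\<in>Pow {m<..M}. \<Prod>i\<in>S. a i)"
    unfolding run_free_sum_def
  proof (rule sum_mono2)
    fix S assume "S \<in> Pow {m<..M} - run_free_sets k m M"
    then show "(\<Prod>i\<in>S. a i) \<ge> 0" using assms by (intro prod_nonneg) (auto simp: subset_iff)
  qed (auto simp: run_free_sets_def)
  also have "\<dots> = (\<Prod>i\<in>{m<..M}. 1 + a i)"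
    using prod_add[of "{m<..M}" a "\<lambda>_. 1"] by (simp add: add.commute)
  finally show ?thesis .
qed

lemma run_free_sum_ge_1:
  fixes a :: "nat \<Rightarrow> real"
  assumes "\<And>i. i > 0 \<Longrightarrow> a i \<ge> 0" "k \<ge> 1"
  shows "run_free_sum k a m M \<ge> 1"
proof -
  have "{} \<in> run_free_sets k m M" using assms by (auto simp: run_free_sets_def run_free_def)
  moreover have "(\<Prod>i\<in>S. a i) \<ge> 0" if "S \<in> run_free_sets k m M" for S
    using that by (auto simp: run_free_sets_def subset_iff intro!: prod_nonneg assms)
  ultimately have "(\<Prod>i\<in>{}. a i) \<le> run_free_sum k a m M"
    unfolding run_free_sum_def by (intro member_le_sum) auto
  then show ?thesis by simp
qed

text \<open>From above, the sum over all subsets has total probability 1. From below, the empty set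
  alone has probability at least 1 minus the sum of the q^i.\<close>

lemma run_free_prob_near_1:
  assumes q: "0 < q" "q < 1" and k: "k \<ge> 1"
  shows "\<bar>run_free_prob k q m M - 1\<bar> \<le> (1 / (1 - q)) * q ^ m"
proof -
  let ?a = "\<lambda>i. q ^ i / (1 - q ^ i)"
  have ne: "1 - q ^ i > 0" if "i > 0" for i
    using q that by (simp add: power_less_one_iff)
  have a0: "?a i \<ge> 0" if "i > 0" for i using ne[OF that] q by simp
  let ?P = "\<Prod>i\<in>{m<..M}. 1 - q ^ i"
  have P0: "?P > 0" using ne by (intro prod_pos) auto
  have "run_free_prob k q m M \<le> (\<Prod>i\<in>{m<..M}. 1 + ?a i) * ?P"
    unfolding run_free_prob_def using P0 run_free_sum_le_prod[of ?a k m M] a0 by (intro mult_right_mono) auto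
  also have "\<dots> = (\<Prod>i\<in>{m<..M}. 1)"
    unfolding prod.distrib[symmetric]
  proof (intro prod.cong refl)
    fix i assume "i \<in> {m<..M}"
    then show "(1 + ?a i) * (1 - q ^ i) = 1" using ne[of i] by (simp add: field_simps)
  qed
  finally have up: "run_free_prob k q m M \<le> 1" by simp
  have "1 - (\<Sum>i\<in>{m<..M}. q ^ i) \<le> ?P"
  proof -
    have "1 - (\<Sum>i\<in>A. q ^ i) \<le> (\<Prod>i\<in>A. 1 - q ^ i)" if "finite A" for A
      using that
    proof (induction A rule: finite_induct)
      case (insert i A)
      have P: "(\<Prod>i\<in>A. 1 - q ^ i) \<le> 1" "0 \<le> (\<Prod>i\<in>A. 1 - q ^ i)" "0 \<le> q ^ i" "q ^ i \<le> 1"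
        using q by (auto intro!: prod_le_1 prod_nonneg simp: power_le_one)
      have "q ^ i * (\<Prod>i\<in>A. 1 - q ^ i) \<le> q ^ i * 1" using P by (intro mult_left_mono) auto
      then show ?case using insert P by (simp add: algebra_simps)
    qed simp
    then show ?thesis by simp
  qed
  also have "\<dots> \<le> run_free_prob k q m M"
    unfolding run_free_prob_def using run_free_sum_ge_1[of ?a k m M] a0 k P0 by simp
  finally have lo: "1 - (\<Sum>i\<in>{m<..M}. q ^ i) \<le> run_free_prob k q m M" .
  have "(\<Sum>i\<in>{m<..M}. q ^ i) \<le> (\<Sum>i\<in>{m..<m + (Suc M)}. q ^ i)"
    using q by (intro sum_mono2) auto
  also have "\<dots> = (\<Sum>i<Suc M. q ^ (i + m))"
    using sum.shift_bounds_nat_ivl[of "\<lambda>i. q ^ i" 0 m "Suc M"] by (simp add: atLeast0LessThan add.commute)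
  also have "\<dots> = q ^ m * (\<Sum>i<Suc M. q ^ i)" by (simp only: power_add sum_distrib_left mult.commute)
  also have "\<dots> \<le> q ^ m * (\<Sum>i. q ^ i)"
    using q by (intro mult_left_mono sum_le_suminf) auto
  finally have "(\<Sum>i\<in>{m<..M}. q ^ i) \<le> q ^ m * (1 / (1 - q))" using q by (simp add: suminf_geometric)
  then show ?thesis using up lo by (simp add: abs_le_iff mult.commute)
qed

text \<open>The discrepancy satisfies the same linear recursion as both quantities. For m >= M - k
  it is at most A q^m, hence at most A q^(M - k); going back to m = 0 costs a factor 1 + q^m per
  step, and the product of these factors is bounded.\<close>

lemma run_free_prob_tendsto:
  assumes q: "0 < q" "q < 1" and k: "k \<ge> 1"
  shows "(\<lambda>M. run_free_prob k q 0 M) \<longlonglongrightarrow> gap_series k q 0"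
proof -
  obtain C where C: "\<And>m. \<bar>gap_series k q m - 1\<bar> \<le> C * q ^ m"
    using gap_series_near_1[OF assms] by blast
  have C0: "C \<ge> 0" using order_trans[OF abs_ge_zero C[of 0]] by simp
  define A where "A = C + 1 / (1 - q)"
  have A0: "A \<ge> 0" using C0 q by (simp add: A_def)
  let ?D = "\<lambda>M m. \<bar>run_free_prob k q m M - gap_series k q m\<bar>"
  have near: "?D M m \<le> A * q ^ m" for M m
    using C[of m] run_free_prob_near_1[OF assms, of m M] by (simp add: A_def algebra_simps)
  have step: "?D M m \<le> ?D M (Suc m) + q ^ m * ?D M (m+k+1)" if "m + k + 1 \<le> M" for M m
  proof -
    let ?e = "q ^ (tri k + m * k) * (1 - q ^ (m + k + 1))"
    have "m \<le> tri k + m * k" using k by (metis le_add2 le_trans mult.right_neutral mult_le_mono2)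
    then have "q ^ (tri k + m * k) \<le> q ^ m" using q by (intro power_decreasing) auto
    moreover have e1: "0 \<le> 1 - q ^ (m + k + 1)" "1 - q ^ (m + k + 1) \<le> 1"
      using q power_le_one[of q "m+k+1"] by (auto simp del: power_Suc)
    moreover have "0 \<le> ?e" using e1 q by (intro mult_nonneg_nonneg) auto
    moreover have "?e \<le> q ^ (tri k + m * k) * 1" using e1 q by (intro mult_left_mono) auto
    ultimately have e: "0 \<le> ?e" "?e \<le> q ^ m" by linarith+
    have "?D M m = \<bar>(run_free_prob k q (Suc m) M - gap_series k q (Suc m))
        - ?e * (run_free_prob k q (m+k+1) M - gap_series k q (m+k+1))\<bar>"
      using run_free_prob_rec[OF q k that] gap_series_rec[OF q k, of m] by (simp add: algebra_simps)
    also have "\<dots> \<le> ?D M (Suc m) + \<bar>?e * (run_free_prob k q (m+k+1) M - gap_series k q (m+k+1))\<bar>"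
      by (rule abs_triangle_ineq4)
    also have "\<dots> \<le> ?D M (Suc m) + q ^ m * ?D M (m+k+1)"
      using e by (subst abs_mult) (auto intro!: mult_right_mono)
    finally show ?thesis .
  qed
  have bnd: "?D M m \<le> A * q ^ (M - k) * exp (\<Sum>i\<in>{m..<M}. q ^ i)" if "m \<le> M" for M m
    using that
  proof (induction "M - m" arbitrary: m rule: less_induct)
    case less
    show ?case
    proof (cases "m + k + 1 \<le> M")
      case False
      then have "A * q ^ m \<le> A * q ^ (M - k)" using q A0 by (intro mult_left_mono power_decreasing) auto
      also have "\<dots> \<le> A * q ^ (M - k) * exp (\<Sum>i\<in>{m..<M}. q ^ i)"
      proof -
        have "1 \<le> exp (\<Sum>i\<in>{m..<M}. q ^ i)" using q by (simp add: sum_nonneg)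
        moreover have "0 \<le> A * q ^ (M - k)" using q A0 by simp
        ultimately show ?thesis by (metis mult.right_neutral mult_left_mono)
      qed
      finally show ?thesis using near by (rule order_trans[rotated])
    next
      case True
      let ?E = "A * q ^ (M - k) * exp (\<Sum>i\<in>{Suc m..<M}. q ^ i)"
      have E: "A * q ^ (M - k) * exp (\<Sum>i\<in>{m+k+1..<M}. q ^ i) \<le> ?E"
      proof -
        have "(\<Sum>i\<in>{m+k+1..<M}. q ^ i) \<le> (\<Sum>i\<in>{Suc m..<M}. q ^ i)"
          using q by (intro sum_mono2) auto
        then show ?thesis using q A0 by (intro mult_left_mono) auto
      qed
      have 1: "?D M (Suc m) \<le> ?E" using less(1)[of "Suc m"] True by simp
      have "?D M (m+k+1) \<le> A * q ^ (M - k) * exp (\<Sum>i\<in>{m+k+1..<M}. q ^ i)"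
        using less(1)[of "m+k+1"] True by simp
      then have "?D M (m+k+1) \<le> ?E" using E by (rule order_trans)
      then have "q ^ m * ?D M (m+k+1) \<le> q ^ m * ?E" using q by (intro mult_left_mono) auto
      then have "?D M m \<le> ?E + q ^ m * ?E" using step[OF True] 1 by linarith
      also have "\<dots> = ?E * (1 + q ^ m)" by (simp add: algebra_simps)
      also have "\<dots> \<le> ?E * exp (q ^ m)" using A0 q by (intro mult_left_mono exp_ge_add_one_self) auto
      also have "\<dots> = A * q ^ (M - k) * exp (\<Sum>i\<in>{m..<M}. q ^ i)"
        using True by (simp add: sum.atLeast_Suc_lessThan exp_add mult_ac)
      finally show ?thesis .
    qed
  qed
  have "?D M 0 \<le> A * exp (1 / (1 - q)) * q ^ (M - k)" for M
  proof -
    have "(\<Sum>i\<in>{0..<M}. q ^ i) \<le> (\<Sum>i. q ^ i)" using q by (intro sum_le_suminf) auto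
    then have "(\<Sum>i\<in>{0..<M}. q ^ i) \<le> 1 / (1 - q)" using q by (simp add: suminf_geometric)
    then have "A * q ^ (M - k) * exp (\<Sum>i\<in>{0..<M}. q ^ i) \<le> A * q ^ (M - k) * exp (1 / (1 - q))"
      using A0 q by (intro mult_left_mono) auto
    then show ?thesis using bnd[of 0 M] by (simp add: mult_ac)
  qed
  then have ev: "\<forall>\<^sub>F M in sequentially. norm (run_free_prob k q 0 M - gap_series k q 0) \<le> A * exp (1 / (1 - q)) * q ^ (M - k)"
    by simp
  have lim: "(\<lambda>M. A * exp (1 / (1 - q)) * q ^ (M - k)) \<longlonglongrightarrow> 0"
  proof -
    have "(\<lambda>M. q ^ M) \<longlonglongrightarrow> 0" using q by (intro LIMSEQ_power_zero) auto
    then have "(\<lambda>M. q ^ (M - k)) \<longlonglongrightarrow> 0"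
      by (rule filterlim_compose) (rule filterlim_minus_const_nat_at_top)
    from tendsto_mult_left[OF this, of "A * exp (1 / (1 - q))"] show ?thesis by simp
  qed
  have "(\<lambda>M. run_free_prob k q 0 M - gap_series k q 0) \<longlonglongrightarrow> 0"
    by (rule Lim_null_comparison[OF ev lim])
  then show ?thesis by (simp add: LIM_zero_iff)
qed

section \<open>Partitions with a given set of part sizes\<close>

definition support_count :: "nat set \<Rightarrow> nat \<Rightarrow> nat" where
  "support_count S n = card {P \<in> partitions n. set_mset P = S}"

lemma support_count_empty: "support_count {} n = (if n = 0 then 1 else 0)"
proof -
  have "{P \<in> partitions n. set_mset P = {}} = (if n = 0 then {{#}} else {})"
    by (auto simp: partitions_def)
  then show ?thesis by (simp add: support_count_def)
qed

text \<open>Removing one copy of \<open>i\<close> leaves a partition in which \<open>i\<close> still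
  occurs or no longer occurs.\<close>

lemma support_count_insert:
  assumes "i > 0" "i \<notin> S"
  shows "support_count (insert i S) (n + i) = support_count (insert i S) n + support_count S n"
proof -
  let ?A = "{P \<in> partitions n. set_mset P = insert i S}" and ?B = "{P \<in> partitions n. set_mset P = S}"
  have "{P \<in> partitions (n + i). set_mset P = insert i S} = add_mset i ` (?A \<union> ?B)" (is "?L = ?R")
  proof (rule set_eqI, rule iffI)
    fix P assume P: "P \<in> ?L"
    then have "i \<in># P" by auto
    then obtain Q where Q: "P = add_mset i Q" by (meson mset_add)
    have "Q \<in> partitions n" using P Q by (auto simp: partitions_def)
    moreover have "set_mset Q = insert i S \<or> set_mset Q = S"
      using P Q assms by (cases "i \<in># Q") auto
    ultimately show "P \<in> ?R" using Q by blast
  qed (use assms in \<open>auto simp: partitions_def\<close>)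
  then have "support_count (insert i S) (n + i) = card (?A \<union> ?B)"
    unfolding support_count_def by (metis (no_types, lifting) card_image inj_on_def add_mset_add_mset_same_iff)
  also have "\<dots> = card ?A + card ?B"
    using finite_partitions[of n] assms by (intro card_Un_disjoint) auto
  finally show ?thesis by (simp add: support_count_def)
qed

lemma support_count_less:
  assumes "i \<in> S" "n < i"
  shows "support_count S n = 0"
proof -
  have "{P \<in> partitions n. set_mset P = S} = {}"
  proof (rule ccontr)
    assume "\<not> ?thesis"
    then obtain P where "P \<in> partitions n" "i \<in># P" using assms by auto
    then have "i \<le> n" by (auto simp: partitions_def dest: multi_member_split)
    with assms show False by simp
  qed
  then show ?thesis unfolding support_count_def by (simp only: card.empty)
qed

text \<open>The recursion reads X = z^i (X + Y) for the generating functions with and without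
  \<open>i\<close>, which determines X only once convergence is known; hence the joint
  induction.\<close>

lemma support_count_sums_aux:
  fixes z :: "'a::{real_normed_field,banach}"
  assumes z: "norm z < 1" and S: "finite S" "0 \<notin> S"
  shows "summable (\<lambda>n. real (support_count S n) * norm z ^ n) \<and>
         (\<lambda>n. of_nat (support_count S n) * z ^ n) sums (\<Prod>i\<in>S. z ^ i / (1 - z ^ i))"
  using S
proof (induction S rule: finite_induct)
  case empty
  have e: "(\<lambda>n. real (support_count {} n) * norm z ^ n) = (\<lambda>n. if n = 0 then 1 else 0)"
    "(\<lambda>n. of_nat (support_count {} n) * z ^ n) = (\<lambda>n. if n = 0 then 1 else 0)"
    by (auto simp: support_count_empty)
  show ?case
    unfolding e using sums_single[of 0 "\<lambda>_. 1::real"] sums_single[of 0 "\<lambda>_. 1::'a"]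
    by (auto simp: sums_iff)
next
  case (insert i S)
  let ?C = "\<lambda>n. support_count (insert i S) n" and ?c = "\<lambda>n. support_count S n"
  have i: "i > 0" "i \<notin> S" using insert by auto
  have IH: "summable (\<lambda>n. real (?c n) * norm z ^ n)"
    "(\<lambda>n. of_nat (?c n) * z ^ n) sums (\<Prod>i\<in>S. z ^ i / (1 - z ^ i))"
    using insert by auto
  define r where "r = norm z"
  have r: "0 \<le> r" "r < 1" using z by (auto simp: r_def)
  have ri: "r ^ i < 1" using r i by (simp add: power_less_one_iff)
  define A where "A = (\<Sum>n. real (?c n) * r ^ n)"
  have rec: "?C (n + i) = ?C n + ?c n" for n using support_count_insert[OF i] .
  have C0: "?C n = 0" if "n < i" for n using support_count_less[of i "insert i S"] that by auto
  \<comment> \<open>Partial sums obey X <= r^i X + r^i A by the same recursion, which bounds them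
    independently of \<open>N\<close>.\<close>
  have bound: "(\<Sum>n<N. real (?C n) * r ^ n) \<le> r ^ i * A / (1 - r ^ i)" for N
  proof -
    let ?X = "\<Sum>n<N. real (?C n) * r ^ n"
    have "?X \<le> (\<Sum>n<N+i. real (?C n) * r ^ n)" using r by (intro sum_mono2) auto
    also have "\<dots> = (\<Sum>n<i. real (?C n) * r ^ n) + (\<Sum>n<N. real (?C (n + i)) * r ^ (n + i))"
      using sum.atLeastLessThan_concat[of 0 i "N + i" "\<lambda>n. real (?C n) * r ^ n"]
        sum.shift_bounds_nat_ivl[of "\<lambda>n. real (?C n) * r ^ n" 0 i N]
      by (simp add: atLeast0LessThan del: power_add)
    also have "(\<Sum>n<i. real (?C n) * r ^ n) = 0" using C0 by (intro sum.neutral) auto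
    also have "0 + (\<Sum>n<N. real (?C (n + i)) * r ^ (n + i))
        = (\<Sum>n<N. r ^ i * (real (?C n) * r ^ n) + r ^ i * (real (?c n) * r ^ n))"
      unfolding add_0 by (intro sum.cong refl) (simp add: rec power_add ring_distribs)
    also have "\<dots> = r ^ i * ?X + r ^ i * (\<Sum>n<N. real (?c n) * r ^ n)"
      by (simp only: sum.distrib sum_distrib_left)
    also have "(\<Sum>n<N. real (?c n) * r ^ n) \<le> A" unfolding A_def
      using IH(1) r by (intro sum_le_suminf) (auto simp: r_def)
    finally have "?X \<le> r ^ i * ?X + r ^ i * A" using r by (simp add: mult_left_mono)
    then show ?thesis using ri by (simp add: field_simps)
  qed
  have sm: "summable (\<lambda>n. real (?C n) * r ^ n)"
    by (rule summableI_nonneg_bounded[OF _ bound]) (use r in auto)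
  have "summable (\<lambda>n. of_nat (?C n) * z ^ n)"
    by (rule summable_norm_cancel) (use sm in \<open>simp add: norm_mult norm_power r_def\<close>)
  then obtain X where X: "(\<lambda>n. of_nat (?C n) * z ^ n) sums X" by (auto simp: summable_def)
  have "(\<lambda>n. z ^ i * (of_nat (?C n) * z ^ n + of_nat (?c n) * z ^ n)) sums (z ^ i * (X + (\<Prod>i\<in>S. z ^ i / (1 - z ^ i))))"
    by (intro sums_mult sums_add X IH)
  also have "(\<lambda>n. z ^ i * (of_nat (?C n) * z ^ n + of_nat (?c n) * z ^ n)) = (\<lambda>n. of_nat (?C (n + i)) * z ^ (n + i))"
    by (auto simp: rec power_add algebra_simps)
  finally have "(\<lambda>n. of_nat (?C n) * z ^ n) sums (z ^ i * (X + (\<Prod>i\<in>S. z ^ i / (1 - z ^ i))) + (\<Sum>n<i. of_nat (?C n) * z ^ n))"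
    by (subst (asm) sums_iff_shift) simp
  then have "X = z ^ i * (X + (\<Prod>i\<in>S. z ^ i / (1 - z ^ i)))"
    using X C0 by (simp add: sums_iff)
  moreover have "1 - z ^ i \<noteq> 0"
  proof
    assume "1 - z ^ i = 0"
    then have "z ^ i = 1" by simp
    then have "norm z ^ i = 1" by (metis norm_one norm_power)
    then show False using ri by (simp add: r_def)
  qed
  ultimately have "X = z ^ i / (1 - z ^ i) * (\<Prod>i\<in>S. z ^ i / (1 - z ^ i))"
    by (simp add: field_simps)
  then show ?case using X sm insert by (simp add: r_def)
qed

lemma support_count_sums:
  fixes z :: "'a::{real_normed_field,banach}"
  assumes "norm z < 1" "finite S" "0 \<notin> S"
  shows "(\<lambda>n. of_nat (support_count S n) * z ^ n) sums (\<Prod>i\<in>S. z ^ i / (1 - z ^ i))"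
  using support_count_sums_aux[OF assms] by blast

section \<open>Bounded parts and the full generating function\<close>

definition bounded_count :: "nat \<Rightarrow> nat \<Rightarrow> nat \<Rightarrow> nat" where
  "bounded_count k M n = (\<Sum>S\<in>run_free_sets k 0 M. support_count S n)"

lemma bounded_count_sums:
  fixes z :: "'a::{real_normed_field,banach}"
  assumes "norm z < 1"
  shows "(\<lambda>n. of_nat (bounded_count k M n) * z ^ n) sums run_free_sum k (\<lambda>i. z ^ i / (1 - z ^ i)) 0 M"
proof -
  have "(\<lambda>n. \<Sum>S\<in>run_free_sets k 0 M. of_nat (support_count S n) * z ^ n) sums
      (\<Sum>S\<in>run_free_sets k 0 M. \<Prod>i\<in>S. z ^ i / (1 - z ^ i))"
    by (intro sums_sum support_count_sums assms run_free_sets_finite) (auto simp: run_free_sets_def)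
  then show ?thesis by (simp add: bounded_count_def run_free_sum_def sum_distrib_right)
qed

text \<open>\<open>run_free\<close> also tests runs that start at 0; a set of positive numbers
  contains none, which accounts for the guard \<open>j > 0\<close>.\<close>

lemma has_k_sequence_iff:
  assumes "k \<ge> 1" "0 \<notin># P"
  shows "has_k_sequence k P \<longleftrightarrow> \<not> run_free k (set_mset P)"
proof -
  have "j > 0" if "{j..<j+k} \<subseteq> set_mset P" for j
  proof (rule ccontr)
    assume "\<not> j > 0"
    then have "0 \<in> {j..<j+k}" using assms by auto
    with that assms show False by blast
  qed
  then show ?thesis unfolding has_k_sequence_def run_free_def subset_eq by blast
qed

lemma bounded_count_eq_card:
  assumes "k \<ge> 1"
  shows "bounded_count k M n = card {P \<in> partitions n. \<not> has_k_sequence k P \<and> set_mset P \<subseteq> {0<..M}}"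
proof -
  have "bounded_count k M n = card (\<Union>S\<in>run_free_sets k 0 M. {P \<in> partitions n. set_mset P = S})"
    unfolding bounded_count_def support_count_def using finite_partitions[of n]
    by (subst card_UN_disjoint) auto
  also have "(\<Union>S\<in>run_free_sets k 0 M. {P \<in> partitions n. set_mset P = S}) =
      {P \<in> partitions n. \<not> has_k_sequence k P \<and> set_mset P \<subseteq> {0<..M}}"
    using has_k_sequence_iff[OF assms] by (auto simp: run_free_sets_def partitions_def)
  finally show ?thesis .
qed

lemma bounded_count_le: "k \<ge> 1 \<Longrightarrow> bounded_count k M n \<le> p_no_seq k n"
  unfolding bounded_count_eq_card p_no_seq_def
  using finite_partitions[of n] by (intro card_mono) auto

lemma bounded_count_eq:
  assumes "k \<ge> 1" "n \<le> M"
  shows "bounded_count k M n = p_no_seq k n"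
proof -
  have "set_mset P \<subseteq> {0<..M}" if "P \<in> partitions n" for P
  proof
    fix i assume "i \<in># P"
    then have "i \<le> n" "i > 0" using that by (auto simp: partitions_def dest: multi_member_split)
    then show "i \<in> {0<..M}" using assms by simp
  qed
  then show ?thesis unfolding bounded_count_eq_card[OF assms(1)] p_no_seq_def
    by (intro arg_cong[of _ _ card]) auto
qed

text \<open>The coefficients below \<open>N\<close> agree with those for parts at most
  \<open>N\<close>, whose series is a finite run-free sum and lies below a partial Euler product,
  bounded independently of \<open>N\<close>.\<close>

lemma p_no_seq_summable:
  assumes "k \<ge> 1" "0 \<le> r" "r < 1"
  shows "summable (\<lambda>n. real (p_no_seq k n) * r ^ n)"
proof (rule summableI_nonneg_bounded)
  have ri: "1 - r ^ i > 0" "r ^ i \<le> r" if "i > 0" for i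
    using assms that power_decreasing[of 1 i r] by (auto simp: power_less_one_iff)
  fix N
  have s: "(\<lambda>n. real (bounded_count k N n) * r ^ n) sums run_free_sum k (\<lambda>i. r ^ i / (1 - r ^ i)) 0 N"
    using bounded_count_sums[of r k N] assms by simp
  have "(\<Sum>n<N. real (p_no_seq k n) * r ^ n) = (\<Sum>n<N. real (bounded_count k N n) * r ^ n)"
    using assms by (intro sum.cong) (auto simp: bounded_count_eq)
  also have "\<dots> \<le> run_free_sum k (\<lambda>i. r ^ i / (1 - r ^ i)) 0 N"
    using s assms by (metis (no_types, lifting) sum_le_suminf sums_iff finite_lessThan mult_nonneg_nonneg of_nat_0_le_iff zero_le_power)
  also have "\<dots> \<le> (\<Prod>i\<in>{0<..N}. 1 + r ^ i / (1 - r ^ i))"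
    using ri assms by (intro run_free_sum_le_prod) (auto simp: less_imp_le)
  also have "\<dots> \<le> (\<Prod>i\<in>{0<..N}. exp (r ^ i * (1 / (1 - r))))"
  proof (intro prod_mono conjI)
    fix i assume i: "i \<in> {0<..N}"
    show "0 \<le> 1 + r ^ i / (1 - r ^ i)" using ri[of i] i assms by (auto intro!: add_nonneg_nonneg)
    have "r ^ i / (1 - r ^ i) \<le> r ^ i / (1 - r)"
      using ri[of i] i assms by (intro divide_left_mono) (auto intro!: mult_pos_pos)
    then show "1 + r ^ i / (1 - r ^ i) \<le> exp (r ^ i * (1 / (1 - r)))"
      using exp_ge_add_one_self[of "r ^ i * (1 / (1 - r))"] unfolding times_divide_eq_right mult_1_right
      by linarith
  qed
  also have "\<dots> = exp ((\<Sum>i\<in>{0<..N}. r ^ i) * (1 / (1 - r)))"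
    by (simp only: exp_sum[symmetric] sum_distrib_right finite_greaterThanAtMost)
  also have "\<dots> \<le> exp ((1 / (1 - r)) * (1 / (1 - r)))"
  proof -
    have "(\<Sum>i\<in>{0<..N}. r ^ i) \<le> (\<Sum>i. r ^ i)" using assms by (intro sum_le_suminf) auto
    then have "(\<Sum>i\<in>{0<..N}. r ^ i) \<le> 1 / (1 - r)" using assms by (simp add: suminf_geometric)
    then have "(\<Sum>i\<in>{0<..N}. r ^ i) * (1 / (1 - r)) \<le> (1 / (1 - r)) * (1 / (1 - r))"
      using assms by (intro mult_right_mono) auto
    then show ?thesis by (simp only: exp_le_cancel_iff)
  qed
  finally show "(\<Sum>n<N. real (p_no_seq k n) * r ^ n) \<le> exp ((1 / (1 - r)) * (1 / (1 - r)))" .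
qed (use assms in auto)

text \<open>Polymorphic, because the real instance carries the asymptotics near 1 and the complex
  one the Cauchy integral; \<open>no_seq_gf_of_real\<close> links them.\<close>

definition no_seq_gf :: "nat \<Rightarrow> 'a::{real_normed_field,banach} \<Rightarrow> 'a" where
  "no_seq_gf k z = (\<Sum>n. of_nat (p_no_seq k n) * z ^ n)"

lemma no_seq_gf_sums:
  fixes z :: "'a::{real_normed_field,banach}"
  assumes "k \<ge> 1" "norm z < 1"
  shows "(\<lambda>n. of_nat (p_no_seq k n) * z ^ n) sums no_seq_gf k z"
proof -
  have "summable (\<lambda>n. of_nat (p_no_seq k n) * z ^ n)"
    using p_no_seq_summable[of k "norm z"] assms
    by - (rule summable_norm_cancel, simp add: norm_mult norm_power)
  then show ?thesis unfolding no_seq_gf_def by (rule summable_sums)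
qed

text \<open>Coefficients up to \<open>M\<close> are already exact and the others are dominated, so
  the error is at most a tail of the convergent series at \<open>norm z\<close>.\<close>

lemma run_free_sum_tendsto_gf:
  fixes z :: "'a::{real_normed_field,banach}"
  assumes "k \<ge> 1" "norm z < 1"
  shows "(\<lambda>M. run_free_sum k (\<lambda>i. z ^ i / (1 - z ^ i)) 0 M) \<longlonglongrightarrow> no_seq_gf k z"
proof -
  let ?f = "\<lambda>n. real (p_no_seq k n) * norm z ^ n"
  have sf: "summable ?f" using assms by (intro p_no_seq_summable) auto
  have ev: "norm (run_free_sum k (\<lambda>i. z ^ i / (1 - z ^ i)) 0 M - no_seq_gf k z) \<le> suminf ?f - (\<Sum>n<Suc M. ?f n)" for M
  proof -
    let ?g = "\<lambda>n. ?f n - (if n \<in> {..<Suc M} then ?f n else 0)"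
    have g: "?g sums (suminf ?f - (\<Sum>n<Suc M. ?f n))"
      by (intro sums_diff summable_sums sf sums_If_finite_set) auto
    have d: "(\<lambda>n. of_nat (bounded_count k M n) * z ^ n - of_nat (p_no_seq k n) * z ^ n) sums
      (run_free_sum k (\<lambda>i. z ^ i / (1 - z ^ i)) 0 M - no_seq_gf k z)"
      by (intro sums_diff bounded_count_sums no_seq_gf_sums assms)
    have le: "norm (of_nat (bounded_count k M n) * z ^ n - of_nat (p_no_seq k n) * z ^ n) \<le> ?g n" for n
    proof (cases "n \<le> M")
      case False
      have "of_nat (bounded_count k M n) * z ^ n - of_nat (p_no_seq k n) * z ^ n =
         - (of_nat (p_no_seq k n - bounded_count k M n) * z ^ n)"
        using bounded_count_le[OF assms(1), of M n] by (simp add: of_nat_diff algebra_simps)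
      then have "norm (of_nat (bounded_count k M n) * z ^ n - of_nat (p_no_seq k n) * z ^ n) =
         real (p_no_seq k n - bounded_count k M n) * norm z ^ n"
        by (simp only: norm_minus_cancel norm_mult norm_of_nat norm_power)
      also have "\<dots> \<le> ?f n" by (intro mult_right_mono) auto
      finally show ?thesis using False by simp
    qed (use bounded_count_eq[OF assms(1)] in auto)
    show ?thesis using norm_suminf_le[OF le sums_summable[OF g]]
      unfolding sums_unique[OF g, symmetric] sums_unique[OF d, symmetric] .
  qed
  have "(\<lambda>M. suminf ?f - (\<Sum>n<Suc M. ?f n)) \<longlonglongrightarrow> suminf ?f - suminf ?f"
    by (intro tendsto_diff tendsto_const LIMSEQ_Suc summable_LIMSEQ sf)
  then have lim: "(\<lambda>M. suminf ?f - (\<Sum>n<Suc M. ?f n)) \<longlonglongrightarrow> 0" by simp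
  have "(\<lambda>M. run_free_sum k (\<lambda>i. z ^ i / (1 - z ^ i)) 0 M - no_seq_gf k z) \<longlonglongrightarrow> 0"
    by (rule Lim_null_comparison[OF _ lim]) (use ev in simp)
  then show ?thesis by (simp add: LIM_zero_iff)
qed

lemma run_free_1_iff: "run_free 1 S \<longleftrightarrow> S = {}"
proof -
  have "{j..<j+1} = {j}" for j :: nat by auto
  then show ?thesis unfolding run_free_def by auto
qed

theorem no_seq_gf_eq:
  assumes "k \<ge> 1" "0 < q" "q < 1"
  shows "no_seq_gf k q * gap_series 1 q 0 = gap_series k q 0"
proof -
  have "run_free_sets 1 0 M = {{}}" for M
    unfolding run_free_sets_def run_free_1_iff by auto
  then have p1: "run_free_prob 1 q 0 M = (\<Prod>i\<in>{0<..M}. 1 - q ^ i)" for M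
    by (simp add: run_free_prob_def run_free_sum_def)
  have "(\<lambda>M. run_free_sum k (\<lambda>i. q ^ i / (1 - q ^ i)) 0 M * run_free_prob 1 q 0 M) \<longlonglongrightarrow>
     no_seq_gf k q * gap_series 1 q 0"
    using assms by (intro tendsto_mult run_free_sum_tendsto_gf run_free_prob_tendsto) auto
  moreover have "(\<lambda>M. run_free_prob k q 0 M) \<longlonglongrightarrow> gap_series k q 0"
    using assms by (intro run_free_prob_tendsto) auto
  moreover have "run_free_sum k (\<lambda>i. q ^ i / (1 - q ^ i)) 0 M * run_free_prob 1 q 0 M = run_free_prob k q 0 M" for M
    unfolding p1 unfolding run_free_prob_def ..
  ultimately show ?thesis using LIMSEQ_unique by simp
qed

section \<open>Decay away from the real axis\<close>

text \<open>A run of length at least 2 through \<open>i\<close> also contains a neighbour of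
  \<open>i\<close>.\<close>

lemma run_free_insert_isolated:
  assumes "k \<ge> 2" "run_free k S" "i - 1 \<notin> S" "Suc i \<notin> S" "i > 0"
  shows "run_free k (insert i S)"
  unfolding run_free_def
proof (intro allI notI)
  fix j assume j: "{j..<j+k} \<subseteq> insert i S"
  have n: "i - 1 \<notin> {j..<j+k}" "Suc i \<notin> {j..<j+k}" using j assms by auto
  have "i \<notin> {j..<j+k}" using n assms by auto
  then have "{j..<j+k} \<subseteq> S" using j by blast
  with assms(2) show False unfolding run_free_def by blast
qed

text \<open>Deleting the neighbours of \<open>i\<close> and inserting \<open>i\<close> keeps a set run-free; this bounds from below
  the conditional probability that \<open>i\<close> occurs.\<close>
lemma run_free_sum_isolated:
  fixes b :: "nat \<Rightarrow> real"
  assumes k: "k \<ge> 2" and b: "\<And>i. b i \<ge> 0" and i: "0 < i" "i \<le> M"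
  shows "b i * run_free_sum k b 0 M \<le> (1 + b (i-1)) * (1 + b i) * (1 + b (Suc i)) *
     (\<Sum>S | S \<in> run_free_sets k 0 M \<and> i \<in> S. \<Prod>j\<in>S. b j)"
proof -
  let ?R = "run_free_sets k 0 M" and ?p = "\<lambda>S. \<Prod>j\<in>S. b j"
  define J where "J = {i-1, i, Suc i}"
  define R0 where "R0 = {S \<in> ?R. S \<inter> J = {}}"
  have finR: "finite S" if "S \<in> ?R" for S using run_free_sets_finite[OF that] .
  have fin0: "finite R0" by (simp add: R0_def)
  have p0: "?p S \<ge> 0" for S using b by (intro prod_nonneg) auto
  have "run_free_sum k b 0 M = (\<Sum>S\<in>?R. ?p (S - J) * ?p (S \<inter> J))"
    unfolding run_free_sum_def
  proof (intro sum.cong refl)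
    fix S assume S: "S \<in> ?R"
    have "?p S = ?p ((S - J) \<union> (S \<inter> J))" by (intro arg_cong[of _ _ ?p]) blast
    also have "\<dots> = ?p (S - J) * ?p (S \<inter> J)"
      using finR[OF S] by (intro prod.union_disjoint) auto
    finally show "?p S = ?p (S - J) * ?p (S \<inter> J)" .
  qed
  also have "\<dots> = (\<Sum>(A,U)\<in>(\<lambda>S. (S - J, S \<inter> J)) ` ?R. ?p A * ?p U)"
    by (subst sum.reindex) (auto intro!: inj_onI)
  \<comment> \<open>Enlarging the image to all pairs makes the sum factor; the second factor is then
    a full subset sum over at most three elements.\<close>
  also have "\<dots> \<le> (\<Sum>(A,U)\<in>R0 \<times> Pow J. ?p A * ?p U)"
  proof (rule sum_mono2)
    show "finite (R0 \<times> Pow J)" using fin0 by (simp add: J_def)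
    show "(\<lambda>S. (S - J, S \<inter> J)) ` ?R \<subseteq> R0 \<times> Pow J"
      by (auto simp: R0_def run_free_sets_def intro: run_free_mono)
  qed (use p0 in auto)
  also have "\<dots> = (\<Sum>A\<in>R0. ?p A) * (\<Sum>U\<in>Pow J. ?p U)"
    by (simp add: sum.cartesian_product[symmetric] sum_product)
  also have "(\<Sum>U\<in>Pow J. ?p U) = (\<Prod>j\<in>J. 1 + b j)"
    using prod_add[of J b "\<lambda>_. 1"] by (simp add: J_def add.commute)
  also have "\<dots> = (1 + b (i-1)) * (1 + b i) * (1 + b (Suc i))"
  proof -
    obtain i' where "i = Suc i'" using i by (cases i) auto
    then show ?thesis by (simp add: J_def mult_ac)
  qed
  finally have 1: "run_free_sum k b 0 M \<le> (\<Sum>A\<in>R0. ?p A) * ((1 + b (i-1)) * (1 + b i) * (1 + b (Suc i)))" .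
  have inj: "inj_on (insert i) R0"
    by (intro inj_onI) (auto simp: R0_def J_def)
  have "b i * (\<Sum>A\<in>R0. ?p A) = (\<Sum>A\<in>R0. ?p (insert i A))"
    unfolding sum_distrib_left
  proof (intro sum.cong refl)
    fix A assume "A \<in> R0"
    then show "b i * ?p A = ?p (insert i A)" using finR[of A] by (subst prod.insert) (auto simp: R0_def J_def)
  qed
  also have "\<dots> = (\<Sum>S\<in>insert i ` R0. ?p S)" using sum.reindex[OF inj, of ?p] by simp
  also have "\<dots> \<le> (\<Sum>S | S \<in> ?R \<and> i \<in> S. ?p S)"
  proof (rule sum_mono2)
    show "insert i ` R0 \<subseteq> {S. S \<in> ?R \<and> i \<in> S}"
    proof
      fix S assume "S \<in> insert i ` R0"
      then obtain A where A: "S = insert i A" "A \<in> ?R" "A \<inter> J = {}" by (auto simp: R0_def)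
      have "run_free k S" unfolding A(1)
        using A k i by (intro run_free_insert_isolated) (auto simp: run_free_sets_def J_def)
      then show "S \<in> {S. S \<in> ?R \<and> i \<in> S}" using A i by (auto simp: run_free_sets_def)
    qed
  qed (use p0 in auto)
  finally have 2: "b i * (\<Sum>A\<in>R0. ?p A) \<le> (\<Sum>S | S \<in> ?R \<and> i \<in> S. ?p S)" .
  have "b i * run_free_sum k b 0 M \<le> b i * ((\<Sum>A\<in>R0. ?p A) * ((1 + b (i-1)) * (1 + b i) * (1 + b (Suc i))))"
    using 1 b by (intro mult_left_mono) auto
  also have "\<dots> = ((1 + b (i-1)) * (1 + b i) * (1 + b (Suc i))) * (b i * (\<Sum>A\<in>R0. ?p A))"
    by (simp only: mult_ac)
  also have "\<dots> \<le> ((1 + b (i-1)) * (1 + b i) * (1 + b (Suc i))) * (\<Sum>S | S \<in> ?R \<and> i \<in> S. ?p S)"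
    using 2 b by (intro mult_left_mono mult_nonneg_nonneg add_nonneg_nonneg) auto
  finally show ?thesis .
qed

text \<open>Only sets containing \<open>i\<close> are affected, so the loss is 1 - r times their
  total weight, and by the preceding lemma they carry a definite share.\<close>

lemma run_free_sum_scale_one:
  fixes b :: "nat \<Rightarrow> real"
  assumes k: "k \<ge> 2" and b: "\<And>i. b i \<ge> 0" and i: "0 < i" "i \<le> M" and r: "0 \<le> r" "r \<le> 1"
  shows "run_free_sum k (b(i := b i * r)) 0 M \<le>
     (1 - b i / ((1 + b (i-1)) * (1 + b i) * (1 + b (Suc i))) * (1 - r)) * run_free_sum k b 0 M"
proof -
  let ?R = "run_free_sets k 0 M" and ?p = "\<lambda>S. \<Prod>j\<in>S. b j" and ?b = "b(i := b i * r)"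
  let ?X = "\<Sum>S | S \<in> ?R \<and> i \<in> S. ?p S" and ?Y = "\<Sum>S | S \<in> ?R \<and> i \<notin> S. ?p S"
  define D where "D = (1 + b (i-1)) * (1 + b i) * (1 + b (Suc i))"
  have D: "D > 0" unfolding D_def using b by (intro mult_pos_pos add_pos_nonneg) auto
  have sp: "sum f ?R = sum f {S. S \<in> ?R \<and> i \<in> S} + sum f {S. S \<in> ?R \<and> i \<notin> S}" for f :: "nat set \<Rightarrow> real"
    by (subst sum.union_disjoint[symmetric]) (auto intro!: sum.cong)
  have W: "run_free_sum k b 0 M = ?X + ?Y" unfolding run_free_sum_def by (rule sp)
  have "run_free_sum k ?b 0 M = (\<Sum>S | S \<in> ?R \<and> i \<in> S. \<Prod>j\<in>S. ?b j) + (\<Sum>S | S \<in> ?R \<and> i \<notin> S. \<Prod>j\<in>S. ?b j)"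
    unfolding run_free_sum_def by (rule sp)
  also have "(\<Sum>S | S \<in> ?R \<and> i \<in> S. \<Prod>j\<in>S. ?b j) = r * ?X"
    unfolding sum_distrib_left
  proof (intro sum.cong refl)
    fix S assume "S \<in> {S. S \<in> ?R \<and> i \<in> S}"
    then have S: "finite S" "i \<in> S" using run_free_sets_finite by auto
    have "(\<Prod>j\<in>S. ?b j) = ?b i * (\<Prod>j\<in>S - {i}. ?b j)" using S by (rule prod.remove)
    also have "(\<Prod>j\<in>S - {i}. ?b j) = (\<Prod>j\<in>S - {i}. b j)" by (intro prod.cong) auto
    finally show "(\<Prod>j\<in>S. ?b j) = r * ?p S" using prod.remove[OF S, of b] by simp
  qed
  also have "(\<Sum>S | S \<in> ?R \<and> i \<notin> S. \<Prod>j\<in>S. ?b j) = ?Y"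
    by (intro sum.cong prod.cong refl) auto
  finally have "run_free_sum k ?b 0 M = run_free_sum k b 0 M - (1 - r) * ?X"
    unfolding W by (simp only: algebra_simps)
  moreover have "b i / D * run_free_sum k b 0 M \<le> ?X"
  proof -
    have "b i * run_free_sum k b 0 M \<le> D * ?X"
      unfolding D_def by (rule run_free_sum_isolated[OF k _ i]) (use b in auto)
    then show ?thesis using D by (simp add: pos_divide_le_eq mult.commute)
  qed
  then have "(1 - r) * (b i / D * run_free_sum k b 0 M) \<le> (1 - r) * ?X"
    using r by (intro mult_left_mono) auto
  ultimately show ?thesis unfolding D_def[symmetric] by (simp add: algebra_simps)
qed

lemma run_free_sum_scale:
  fixes a r :: "nat \<Rightarrow> real"
  assumes k: "k \<ge> 2" and a: "\<And>i. a i \<ge> 0" and r: "\<And>i. 0 \<le> r i \<and> r i \<le> 1"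
    and T: "finite T" "T \<subseteq> {0<..M}"
  shows "run_free_sum k (\<lambda>i. if i \<in> T then a i * r i else a i) 0 M \<le>
     (\<Prod>i\<in>T. 1 - a i / ((1 + a (i-1)) * (1 + a i) * (1 + a (Suc i))) * (1 - r i)) * run_free_sum k a 0 M"
  using T
proof (induction T rule: finite_induct)
  case (insert i T)
  let ?b = "\<lambda>i. if i \<in> T then a i * r i else a i"
  let ?D = "\<lambda>b. (1 + b (i-1)) * (1 + b i) * (1 + b (Suc i)) :: real"
  have b: "0 \<le> ?b j" "?b j \<le> a j" for j
    using a[of j] r[of j] by (auto simp: mult_left_le)
  have bi: "?b i = a i" using insert by simp
  have Wb: "run_free_sum k ?b 0 M \<ge> 0" using run_free_sum_ge_1[of ?b k 0 M] b k by simp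
  \<comment> \<open>Damping the earlier indices only shrinks the weights around \<open>i\<close>, so
    the share guaranteed at \<open>i\<close> is at least the one computed from the undamped
    weights.\<close>
  have D: "?D ?b \<le> ?D a"
    by (intro mult_mono add_mono order.refl b mult_nonneg_nonneg add_nonneg_nonneg a zero_le_one)
  have Db: "0 < ?D ?b" by (intro mult_pos_pos add_pos_nonneg b zero_less_one)
  have "(\<lambda>j. if j \<in> insert i T then a j * r j else a j) = ?b(i := ?b i * r i)"
    using insert by auto
  then have "run_free_sum k (\<lambda>j. if j \<in> insert i T then a j * r j else a j) 0 M \<le>
     (1 - ?b i / ?D ?b * (1 - r i)) * run_free_sum k ?b 0 M"
    using run_free_sum_scale_one[of k ?b i M "r i"] k b(1) insert.prems r[of i] by auto
  also have "\<dots> \<le> (1 - a i / ?D a * (1 - r i)) * run_free_sum k ?b 0 M"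
  proof (intro mult_right_mono Wb)
    have "0 < ?D a" by (intro mult_pos_pos add_pos_nonneg a zero_less_one)
    then have "a i / ?D a \<le> a i / ?D ?b" by (intro divide_left_mono[OF D a] mult_pos_pos[OF _ Db])
    then have "a i / ?D a \<le> ?b i / ?D ?b" by (simp only: bi)
    then have "a i / ?D a * (1 - r i) \<le> ?b i / ?D ?b * (1 - r i)"
      using r[of i] by (intro mult_right_mono) auto
    then show "1 - ?b i / ?D ?b * (1 - r i) \<le> 1 - a i / ?D a * (1 - r i)" by simp
  qed
  also have "\<dots> \<le> (1 - a i / ?D a * (1 - r i)) *
     ((\<Prod>i\<in>T. 1 - a i / ((1 + a (i-1)) * (1 + a i) * (1 + a (Suc i))) * (1 - r i)) * run_free_sum k a 0 M)"
  proof (rule mult_left_mono)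
    show "run_free_sum k ?b 0 M \<le> (\<Prod>i\<in>T. 1 - a i / ((1 + a (i-1)) * (1 + a i) * (1 + a (Suc i))) * (1 - r i)) * run_free_sum k a 0 M"
      using insert by simp
    have "a i \<le> ?D a"
    proof -
      have "1 * a i * 1 \<le> ?D a" using a by (intro mult_mono) (auto intro!: mult_nonneg_nonneg add_nonneg_nonneg)
      then show ?thesis by simp
    qed
    moreover have "0 < ?D a" using a by (intro mult_pos_pos add_pos_nonneg) auto
    ultimately have "a i / ?D a \<le> 1" "0 \<le> a i / ?D a" using a[of i] by auto
    then have "a i / ?D a * (1 - r i) \<le> 1 * 1" using r[of i] by (intro mult_mono) auto
    then show "0 \<le> 1 - a i / ?D a * (1 - r i)" by simp
  qed
  finally show ?case using insert by (simp add: mult_ac)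
qed simp

section \<open>Oscillation estimates\<close>

lemma norm_one_minus_power_sq:
  "(norm (1 - complex_of_real \<rho> * cis \<alpha>))\<^sup>2 = (1 - \<rho>)\<^sup>2 + 2 * \<rho> * (1 - cos \<alpha>)"
proof -
  have "(norm (1 - complex_of_real \<rho> * cis \<alpha>))\<^sup>2 = (1 - \<rho> * cos \<alpha>)\<^sup>2 + (\<rho> * sin \<alpha>)\<^sup>2"
    by (simp add: cmod_power2)
  also have "\<dots> = 1 - 2 * \<rho> * cos \<alpha> + \<rho>\<^sup>2 * ((cos \<alpha>)\<^sup>2 + (sin \<alpha>)\<^sup>2)"
    by (simp add: power2_eq_square algebra_simps del: sin_cos_squared_add sin_cos_squared_add2 sin_cos_squared_add3)
  finally show ?thesis by (simp add: power2_eq_square algebra_simps)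
qed

text \<open>With D the denominator of \<open>r\<close>, D^2 - (1 - \<rho>)^2 = 2 \<rho> (1 - cos
  \<alpha>). Dividing by (D + 1 - \<rho>) D, which is at most 3 times 2, gives the constant
  1/3.\<close>

lemma ratio_deficit:
  fixes \<rho> \<alpha> :: real
  assumes "0 \<le> \<rho>" "\<rho> < 1"
  defines "r \<equiv> (1 - \<rho>) / norm (1 - complex_of_real \<rho> * cis \<alpha>)"
  shows "0 \<le> r" "r \<le> 1" "\<rho> * (1 - cos \<alpha>) / 3 \<le> 1 - r"
proof -
  define D where "D = norm (1 - complex_of_real \<rho> * cis \<alpha>)"
  have sq: "D\<^sup>2 = (1 - \<rho>)\<^sup>2 + 2 * \<rho> * (1 - cos \<alpha>)" unfolding D_def by (rule norm_one_minus_power_sq)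
  have c: "0 \<le> \<rho> * (1 - cos \<alpha>)" using assms by simp
  have D0: "1 - \<rho> \<le> D" by (rule power2_le_imp_le) (use sq c in \<open>auto simp: D_def\<close>)
  have D2: "D \<le> 2" unfolding D_def using norm_triangle_ineq4[of 1 "complex_of_real \<rho> * cis \<alpha>"] assms
    by (simp add: norm_mult)
  have Dp: "D > 0" using D0 assms by simp
  show "0 \<le> r" "r \<le> 1" using D0 Dp assms by (auto simp: r_def D_def[symmetric])
  have "D * (D + (1 - \<rho>)) \<le> 2 * 3" using D0 D2 Dp assms by (intro mult_mono) auto
  then have "\<rho> * (1 - cos \<alpha>) / 3 * (D * (D + (1 - \<rho>))) \<le> \<rho> * (1 - cos \<alpha>) / 3 * 6"
    using c by (intro mult_left_mono) auto
  also have "\<dots> = D\<^sup>2 - (1 - \<rho>)\<^sup>2" unfolding sq by simp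
  also have "\<dots> = (D - (1 - \<rho>)) * (D + (1 - \<rho>))" by (simp add: power2_eq_square algebra_simps)
  finally have "\<rho> * (1 - cos \<alpha>) / 3 * D \<le> D - (1 - \<rho>)"
    using D0 Dp assms by (simp add: mult.assoc[symmetric] del: times_divide_eq_left)
  then have "\<rho> * (1 - cos \<alpha>) / 3 \<le> (D - (1 - \<rho>)) / D" using Dp by (simp add: pos_le_divide_eq)
  then show "\<rho> * (1 - cos \<alpha>) / 3 \<le> 1 - r" using Dp by (simp add: r_def D_def[symmetric] diff_divide_distrib)
qed

text \<open>This is the nonnegativity of the squared modulus of cis x + cis y - 2.\<close>

lemma one_minus_cos_diff_le: "1 - cos (x - y) \<le> 2 * ((1 - cos x) + (1 - cos (y::real)))"
proof -
  have "0 \<le> (cos x + cos y - 2)\<^sup>2 + (sin x + sin y)\<^sup>2" by simp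
  also have "\<dots> = ((cos x)\<^sup>2 + (sin x)\<^sup>2) + ((cos y)\<^sup>2 + (sin y)\<^sup>2) + 4 + 2 * cos (x - y) - 4 * cos x - 4 * cos y"
    by (simp add: cos_diff power2_eq_square algebra_simps del: sin_cos_squared_add sin_cos_squared_add2 sin_cos_squared_add3)
  finally show ?thesis by simp
qed

lemma one_minus_cos_ge:
  assumes "\<bar>x\<bar> \<le> (1::real)"
  shows "x\<^sup>2 / 4 \<le> 1 - cos x"
proof -
  have c: "1 / 2 \<le> cos t" if "0 \<le> t" "t \<le> 1" for t :: real
    using cos_monotone_0_pi_le[of t "pi/3"] that pi_gt3 by (simp add: cos_60)
  have s: "0 \<le> sin t - t / 2" if t: "0 \<le> t" "t \<le> 1" for t :: real
  proof -
    have "sin 0 - 0 / 2 \<le> sin t - t / 2"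
    proof (rule DERIV_nonneg_imp_nondecreasing[OF t(1)])
      fix u assume "0 \<le> u" "u \<le> t"
      then show "\<exists>y. ((\<lambda>t. sin t - t / 2) has_real_derivative y) (at u) \<and> 0 \<le> y"
        using c[of u] t by (intro exI[of _ "cos u - 1 / 2"]) (auto intro!: derivative_eq_intros)
    qed
    then show ?thesis by simp
  qed
  have "1 - cos 0 - 0\<^sup>2 / 4 \<le> 1 - cos \<bar>x\<bar> - \<bar>x\<bar>\<^sup>2 / 4"
  proof (rule DERIV_nonneg_imp_nondecreasing[of 0 "\<bar>x\<bar>" "\<lambda>x. 1 - cos x - x\<^sup>2 / 4"])
    fix u assume "0 \<le> u" "u \<le> \<bar>x\<bar>"
    then show "\<exists>y. ((\<lambda>x. 1 - cos x - x\<^sup>2 / 4) has_real_derivative y) (at u) \<and> 0 \<le> y"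
      using s[of u] assms by (intro exI[of _ "sin u - u / 2"]) (auto intro!: derivative_eq_intros)
  qed simp
  then show ?thesis by simp
qed

text \<open>A single term may vanish, but the terms at i and i + d cannot both be small when d
  \<theta> is away from multiples of 2 pi. One factor 1/2 comes from
  \<open>one_minus_cos_diff_le\<close>, the other from using the full sum for both shifted
  copies.\<close>

lemma sum_one_minus_cos_shift:
  fixes N d :: nat and \<theta> :: real
  assumes "d \<le> N"
  shows "(real N - real d - 1) * (1 - cos (real d * \<theta>)) / 4 \<le> (\<Sum>i\<in>{N+2..2*N}. 1 - cos (real i * \<theta>))"
proof -
  let ?f = "\<lambda>i. 1 - cos (real i * \<theta>)"
  have f0: "?f i \<ge> 0" for i by simp
  have "(real N - real d - 1) * (?f d / 2) \<le> real (card {N+2..2*N-d}) * (?f d / 2)"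
    using f0[of d] by (intro mult_right_mono) auto
  also have "\<dots> = (\<Sum>i\<in>{N+2..2*N-d}. ?f d / 2)" by simp
  also have "\<dots> \<le> (\<Sum>i\<in>{N+2..2*N-d}. ?f (i + d) + ?f i)"
  proof (rule sum_mono)
    fix i
    show "?f d / 2 \<le> ?f (i + d) + ?f i"
    proof -
      have "real (i + d) * \<theta> - real i * \<theta> = real d * \<theta>" by (simp add: algebra_simps)
      then show ?thesis using one_minus_cos_diff_le[of "real (i + d) * \<theta>" "real i * \<theta>"] by simp
    qed
  qed
  also have "\<dots> = (\<Sum>i\<in>{N+2..2*N-d}. ?f (i + d)) + (\<Sum>i\<in>{N+2..2*N-d}. ?f i)" by (rule sum.distrib)
  also have "(\<Sum>i\<in>{N+2..2*N-d}. ?f (i + d)) = (\<Sum>i\<in>{N+2+d..2*N-d+d}. ?f i)"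
    by (rule sum.shift_bounds_cl_nat_ivl[symmetric])
  also have "\<dots> \<le> (\<Sum>i\<in>{N+2..2*N}. ?f i)"
    using assms by (intro sum_mono2) auto
  also have "(\<Sum>i\<in>{N+2..2*N-d}. ?f i) \<le> (\<Sum>i\<in>{N+2..2*N}. ?f i)"
    by (intro sum_mono2) auto
  finally show ?thesis by simp
qed

text \<open>The shift d is adapted to \<theta>. If \<theta> N is at most 4 in modulus, d = N div 4
  keeps d \<theta> within [-1, 1], where 1 - cos is quadratic; the constant is (N / 4) (N^2
  \<theta>^2 / 256) / 4. Otherwise d is about the inverse of the modulus of \<theta>, so that d
  \<theta> has modulus between 1 and 1 + pi and its cosine is at most 3/4.\<close>

lemma sum_one_minus_cos_lower:
  fixes N :: nat and \<theta> :: real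
  assumes N: "N \<ge> 8" and \<theta>: "\<bar>\<theta>\<bar> \<le> pi"
  shows "min (\<theta>\<^sup>2 * real N ^ 3) (real N) / 4096 \<le> (\<Sum>i\<in>{N+2..2*N}. 1 - cos (real i * \<theta>))"
proof (cases "\<bar>\<theta>\<bar> * real N \<le> 4")
  case True
  define d where "d = N div 4"
  have d: "real N / 8 \<le> real d" "real d \<le> real N / 4" using N by (auto simp: d_def)
  have dN: "d \<le> N" by (simp add: d_def)
  have "\<bar>real d * \<theta>\<bar> \<le> (real N / 4) * \<bar>\<theta>\<bar>"
    unfolding abs_mult using d by (intro mult_right_mono) auto
  then have le1: "\<bar>real d * \<theta>\<bar> \<le> 1" using True by (simp add: mult.commute)
  have "(real N / 8)\<^sup>2 \<le> (real d)\<^sup>2" using d by (intro power_mono) auto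
  then have "(real N)\<^sup>2 / 64 * \<theta>\<^sup>2 \<le> (real d)\<^sup>2 * \<theta>\<^sup>2" by (intro mult_right_mono) (auto simp: power_divide)
  then have 1: "(real N)\<^sup>2 * \<theta>\<^sup>2 / 256 \<le> 1 - cos (real d * \<theta>)"
    using one_minus_cos_ge[OF le1] by (simp add: power_mult_distrib)
  have 2: "real N / 4 \<le> real N - real d - 1" using d N by simp
  have "\<theta>\<^sup>2 * real N ^ 3 / 4096 = (real N / 4) * ((real N)\<^sup>2 * \<theta>\<^sup>2 / 256) / 4"
    by (simp add: power3_eq_cube power2_eq_square)
  also have "\<dots> \<le> (real N - real d - 1) * (1 - cos (real d * \<theta>)) / 4"
    using 1 2 N by (intro divide_right_mono mult_mono) auto
  also have "\<dots> \<le> (\<Sum>i\<in>{N+2..2*N}. 1 - cos (real i * \<theta>))" by (rule sum_one_minus_cos_shift[OF dN])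
  finally show ?thesis by linarith
next
  case False
  define t where "t = \<bar>\<theta>\<bar>"
  have t: "0 < t" "t \<le> pi" "4 < t * real N" using False \<theta> by (auto simp: t_def)
  define d where "d = nat \<lceil>1 / t\<rceil>"
  have d: "1 / t \<le> real d" "real d < 1 / t + 1" using t by (auto simp: d_def) linarith+
  have dt: "1 \<le> real d * t" "real d * t \<le> 1 + t"
    using d t by (auto simp: field_simps)
  have "1 / t < real N / 4" using t by (simp add: field_simps)
  then have 2: "real N / 4 \<le> real N - real d - 1" "d \<le> N" using d N by linarith+
  have "cos (real d * t) \<le> cos 1"
  proof (cases "real d * t \<le> pi")
    case True
    then show ?thesis using dt by (intro cos_monotone_0_pi_le) auto
  next
    case False
    have "cos (2 * pi - real d * t) \<le> cos 1"
      using False dt t pi_gt3 by (intro cos_monotone_0_pi_le) auto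
    then show ?thesis by (simp add: cos_diff)
  qed
  also have "cos 1 \<le> (3/4 :: real)" using one_minus_cos_ge[of 1] by simp
  also have "cos (real d * t) = cos (real d * \<theta>)"
    by (cases "\<theta> \<ge> 0") (auto simp: t_def)
  finally have 1: "1 / 4 \<le> 1 - cos (real d * \<theta>)" by simp
  have "real N / 4096 \<le> (real N / 4) * (1 / 4) / 4" by simp
  also have "\<dots> \<le> (real N - real d - 1) * (1 - cos (real d * \<theta>)) / 4"
    using 1 2 N by (intro divide_right_mono mult_mono) auto
  also have "\<dots> \<le> (\<Sum>i\<in>{N+2..2*N}. 1 - cos (real i * \<theta>))" by (rule sum_one_minus_cos_shift[OF 2(2)])
  finally show ?thesis by linarith
qed

text \<open>Taking absolute values damps the weight a i by r i = (1 - q^i) / norm (1 - z^i), and the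
  damping is kept only for i in \<open>T\<close>. There the share of sets containing i is at least
  1/36 and 1 - r i is at least (1 - cos (i \<theta>)) / 27, whence 972 = 36 * 27.\<close>

lemma run_free_sum_cis_le:
  fixes q \<theta> :: real
  assumes k: "k \<ge> 2" and q: "0 < q" "q < 1" and T: "T \<subseteq> {0<..M}"
    and T': "\<And>i. i \<in> T \<Longrightarrow> 1 / 9 \<le> q ^ i \<and> q ^ (i - 1) \<le> 1 / 2"
  defines "z \<equiv> complex_of_real q * cis \<theta>"
  shows "norm (run_free_sum k (\<lambda>i. z ^ i / (1 - z ^ i)) 0 M) \<le>
    exp (- (\<Sum>i\<in>T. 1 - cos (real i * \<theta>)) / 972) * run_free_sum k (\<lambda>i. q ^ i / (1 - q ^ i)) 0 M"
proof -
  have finT: "finite T" using T finite_subset by blast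
  define a where "a = (\<lambda>i. q ^ i / (1 - q ^ i))"
  define r where "r = (\<lambda>i. (1 - q ^ i) / norm (1 - z ^ i))"
  have zi: "z ^ i = complex_of_real (q ^ i) * cis (real i * \<theta>)" for i
    by (simp add: z_def power_mult_distrib Complex.DeMoivre)
  have q1: "q ^ i < 1" if "i > 0" for i using q that by (simp add: power_less_one_iff)
  have r: "0 \<le> r i \<and> r i \<le> 1" for i
  proof (cases "i = 0")
    case False
    then show ?thesis using ratio_deficit[of "q ^ i" "real i * \<theta>"] q1[of i] q by (simp add: r_def zi)
  qed (simp add: r_def)
  have a: "a i \<ge> 0" for i using q q1[of i] by (cases "i = 0") (auto simp: a_def)
  have na: "norm (z ^ i / (1 - z ^ i)) = a i * r i" if "i > 0" for i
    using q1[OF that] q by (simp add: a_def r_def norm_divide zi norm_mult norm_power)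
  have "norm (run_free_sum k (\<lambda>i. z ^ i / (1 - z ^ i)) 0 M) \<le>
      (\<Sum>S\<in>run_free_sets k 0 M. \<Prod>i\<in>S. norm (z ^ i / (1 - z ^ i)))"
    unfolding run_free_sum_def by (rule order_trans[OF norm_sum]) (simp add: prod_norm)
  also have "\<dots> = (\<Sum>S\<in>run_free_sets k 0 M. \<Prod>i\<in>S. a i * r i)"
    by (intro sum.cong prod.cong refl na) (auto simp: run_free_sets_def)
  also have "\<dots> \<le> (\<Sum>S\<in>run_free_sets k 0 M. \<Prod>i\<in>S. if i \<in> T then a i * r i else a i)"
    using a r by (intro sum_mono prod_mono) (auto simp: mult_left_le)
  also have "\<dots> = run_free_sum k (\<lambda>i. if i \<in> T then a i * r i else a i) 0 M"
    by (simp add: run_free_sum_def)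
  also have "\<dots> \<le> (\<Prod>i\<in>T. 1 - a i / ((1 + a (i-1)) * (1 + a i) * (1 + a (Suc i))) * (1 - r i)) * run_free_sum k a 0 M"
    by (rule run_free_sum_scale[OF k a r finT T])
  also have "\<dots> \<le> (\<Prod>i\<in>T. exp (- ((1 - cos (real i * \<theta>)) / 972))) * run_free_sum k a 0 M"
  proof (intro mult_right_mono prod_mono)
    show "run_free_sum k a 0 M \<ge> 0" using run_free_sum_ge_1[of a k 0 M] a k by simp
    fix i assume i: "i \<in> T"
    have i0: "i > 0" using T i by auto
    have qi: "1 / 9 \<le> q ^ i" "q ^ (i-1) \<le> 1 / 2" using T'[OF i] by auto
    have "i - 1 \<noteq> 0" using qi(2) by (intro notI) simp
    then have pos: "0 < 1 - q ^ i" "0 < 1 - q ^ (i-1)" "0 < 1 - q ^ Suc i"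
      using q1[of i] q1[of "i-1"] q1[of "Suc i"] i0 by (auto simp del: power_Suc)
    have "q ^ Suc i \<le> q ^ (i-1)" using q by (intro power_decreasing) auto
    then have qs: "q ^ Suc i \<le> 1 / 2" using qi by linarith
    let ?\<delta> = "a i / ((1 + a (i-1)) * (1 + a i) * (1 + a (Suc i)))"
    have one: "1 + a j = 1 / (1 - q ^ j)" if "0 < 1 - q ^ j" for j using that by (simp add: a_def field_simps)
    have \<delta>: "?\<delta> = q ^ i * (1 - q ^ (i-1)) * (1 - q ^ Suc i)"
      unfolding one[OF pos(1)] one[OF pos(2)] one[OF pos(3)] using pos by (simp add: a_def field_simps del: power_Suc)
    have "1 / 9 * (1 / 2) * (1 / 2) \<le> ?\<delta>" unfolding \<delta> using qi qs q by (intro mult_mono) auto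
    then have \<delta>1: "1 / 36 \<le> ?\<delta>" by simp
    have \<delta>2: "?\<delta> \<le> 1"
    proof -
      have "?\<delta> \<le> 1 * 1 * 1" unfolding \<delta> using pos q by (intro mult_mono mult_nonneg_nonneg) (auto simp del: power_Suc simp: power_le_one)
      then show ?thesis by simp
    qed
    have rd: "q ^ i * (1 - cos (real i * \<theta>)) / 3 \<le> 1 - r i"
      using ratio_deficit(3)[of "q ^ i" "real i * \<theta>"] q1[OF i0] q by (simp add: r_def zi)
    have "(1 - cos (real i * \<theta>)) / 27 = 1 / 9 * (1 - cos (real i * \<theta>)) / 3" by simp
    also have "\<dots> \<le> q ^ i * (1 - cos (real i * \<theta>)) / 3"
      using qi(1) by (intro divide_right_mono mult_right_mono) auto
    finally have rr: "(1 - cos (real i * \<theta>)) / 27 \<le> 1 - r i" using rd by linarith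
    have "1 / 36 * ((1 - cos (real i * \<theta>)) / 27) \<le> ?\<delta> * (1 - r i)"
    proof (rule mult_mono[OF \<delta>1 rr])
      show "0 \<le> ?\<delta>" using \<delta>1 by linarith
    qed simp
    then have "1 - ?\<delta> * (1 - r i) \<le> 1 + (- ((1 - cos (real i * \<theta>)) / 972))" by simp
    also have "\<dots> \<le> exp (- ((1 - cos (real i * \<theta>)) / 972))" by (rule exp_ge_add_one_self)
    finally have 1: "1 - ?\<delta> * (1 - r i) \<le> exp (- ((1 - cos (real i * \<theta>)) / 972))" .
    have "?\<delta> * (1 - r i) \<le> 1 * 1" using \<delta>2 r[of i] by (intro mult_mono) auto
    then show "0 \<le> 1 - ?\<delta> * (1 - r i) \<and> 1 - ?\<delta> * (1 - r i) \<le> exp (- ((1 - cos (real i * \<theta>)) / 972))"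
      using 1 by simp
  qed
  also have "(\<Prod>i\<in>T. exp (- ((1 - cos (real i * \<theta>)) / 972))) = exp (- (\<Sum>i\<in>T. 1 - cos (real i * \<theta>)) / 972)"
    unfolding exp_sum[OF finT, symmetric] sum_negf sum_divide_distrib[symmetric] by simp
  finally show ?thesis by (simp add: a_def)
qed

text \<open>The indices i from N + 2 to 2 N with N about 1 / s have s i between 1 and 2, so q^i is
  neither near 0 nor near 1. The exponent is quadratic in \<theta> up to the order of s and
  saturates at 1 / s, the number of useful indices.\<close>

theorem no_seq_gf_cis_le:
  assumes k: "k \<ge> 2"
  obtains c where "c > 0" "\<And>s \<theta>. 0 < s \<Longrightarrow> s \<le> 1 / 9 \<Longrightarrow> \<bar>\<theta>\<bar> \<le> pi \<Longrightarrow>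
    norm (no_seq_gf k (complex_of_real (exp (- s)) * cis \<theta>)) \<le>
      no_seq_gf k (exp (- s)) * exp (- c * min (\<theta>\<^sup>2 / s ^ 3) (1 / s))"
proof
  \<comment> \<open>8 from N >= 1 / (2 s), cubed; 4096 from the cosine sum; 972 from the damping per
    index.\<close>
  define c :: real where "c = 1 / (8 * 4096 * 972)"
  show "c > 0" by (simp add: c_def)
  fix s \<theta> :: real
  assume s: "0 < s" "s \<le> 1 / 9" and \<theta>: "\<bar>\<theta>\<bar> \<le> pi"
  define N where "N = nat \<lfloor>1 / s\<rfloor>"
  have s9: "9 \<le> 1 / s" using s by (simp add: field_simps)
  have N: "real N \<le> 1 / s" "1 / s < real N + 1" using s by (auto simp: N_def)
  have N8: "N \<ge> 8" using N s9 by linarith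
  have Ns: "1 / (2 * s) \<le> real N" using N s9 by (simp add: field_simps)
  define q where "q = exp (- s)"
  define z where "z = complex_of_real q * cis \<theta>"
  have q: "0 < q" "q < 1" using s by (auto simp: q_def)
  have qp: "q ^ i = exp (- (s * real i))" for i by (simp add: q_def exp_of_nat_mult[symmetric] mult.commute)
  let ?T = "{N+2..2*N}"
  have T': "1 / 9 \<le> q ^ i \<and> q ^ (i - 1) \<le> 1 / 2" if i: "i \<in> ?T" for i
  proof
    have "s * real i \<le> s * (2 * (1 / s))" using i N s by (intro mult_left_mono) auto
    then have "s * real i \<le> 2" using s by simp
    then have "exp (s * real i) \<le> exp 2" by simp
    also have "exp 2 = exp 1 * exp (1::real)" by (simp add: exp_add[symmetric])
    also have "\<dots> \<le> 3 * 3" using exp_le by (intro mult_mono) auto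
    finally show "1 / 9 \<le> q ^ i" by (simp add: qp exp_minus field_simps)
    have "s * (1 / s) \<le> s * real (i - 1)" using i N s by (intro mult_left_mono) auto
    moreover have "s * (1 / s) = 1" using s by simp
    ultimately have "1 \<le> s * real (i - 1)" by linarith
    then have "2 \<le> exp (s * real (i - 1))" using exp_ge_add_one_self[of "s * real (i-1)"] by linarith
    then have "inverse (exp (s * real (i - 1))) \<le> inverse 2" by (intro le_imp_inverse_le) auto
    then show "q ^ (i - 1) \<le> 1 / 2" unfolding qp exp_minus by simp
  qed
  have "norm (run_free_sum k (\<lambda>i. z ^ i / (1 - z ^ i)) 0 M) \<le>
     exp (- (\<Sum>i\<in>?T. 1 - cos (real i * \<theta>)) / 972) * run_free_sum k (\<lambda>i. q ^ i / (1 - q ^ i)) 0 M"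
    if "M \<ge> 2 * N" for M
    unfolding z_def using that by (intro run_free_sum_cis_le k q T') auto
  then have ev: "\<forall>\<^sub>F M in sequentially. norm (run_free_sum k (\<lambda>i. z ^ i / (1 - z ^ i)) 0 M) \<le>
     exp (- (\<Sum>i\<in>?T. 1 - cos (real i * \<theta>)) / 972) * run_free_sum k (\<lambda>i. q ^ i / (1 - q ^ i)) 0 M"
    using eventually_ge_at_top[of "2 * N"] by (rule eventually_mono[rotated])
  have "norm (no_seq_gf k z) \<le> exp (- (\<Sum>i\<in>?T. 1 - cos (real i * \<theta>)) / 972) * no_seq_gf k q"
    by (rule tendsto_le[OF _ _ _ ev])
       (use k q in \<open>auto intro!: tendsto_intros run_free_sum_tendsto_gf simp: z_def norm_mult\<close>)
  also have "\<dots> \<le> exp (- c * min (\<theta>\<^sup>2 / s ^ 3) (1 / s)) * no_seq_gf k q"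
  proof (rule mult_right_mono)
    have "min (\<theta>\<^sup>2 / s ^ 3) (1 / s) / 8 \<le> min (\<theta>\<^sup>2 * real N ^ 3) (real N)"
    proof (rule min.boundedI)
      have "(1 / (2 * s)) ^ 3 \<le> real N ^ 3" using Ns s by (intro power_mono) auto
      then have "\<theta>\<^sup>2 * (1 / (2 * s)) ^ 3 \<le> \<theta>\<^sup>2 * real N ^ 3" by (intro mult_left_mono) auto
      moreover have "\<theta>\<^sup>2 * (1 / (2 * s)) ^ 3 = \<theta>\<^sup>2 / s ^ 3 / 8" by (simp add: power_mult_distrib power_divide)
      moreover have "min (\<theta>\<^sup>2 / s ^ 3) (1 / s) / 8 \<le> \<theta>\<^sup>2 / s ^ 3 / 8"
        by (intro divide_right_mono min.cobounded1) simp
      ultimately show "min (\<theta>\<^sup>2 / s ^ 3) (1 / s) / 8 \<le> \<theta>\<^sup>2 * real N ^ 3" by simp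
      have "min (\<theta>\<^sup>2 / s ^ 3) (1 / s) / 8 \<le> 1 / s / 8"
        by (intro divide_right_mono min.cobounded2) simp
      also have "\<dots> \<le> 1 / (2 * s)" using s by (simp add: field_simps)
      finally show "min (\<theta>\<^sup>2 / s ^ 3) (1 / s) / 8 \<le> real N" using Ns by simp
    qed
    then have "c * min (\<theta>\<^sup>2 / s ^ 3) (1 / s) \<le> min (\<theta>\<^sup>2 * real N ^ 3) (real N) / 4096 / 972"
      by (simp add: c_def)
    also have "\<dots> \<le> (\<Sum>i\<in>?T. 1 - cos (real i * \<theta>)) / 972"
      using sum_one_minus_cos_lower[OF N8 \<theta>] by (intro divide_right_mono) auto
    finally show "exp (- (\<Sum>i\<in>?T. 1 - cos (real i * \<theta>)) / 972) \<le> exp (- c * min (\<theta>\<^sup>2 / s ^ 3) (1 / s))"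
      by simp
    show "0 \<le> no_seq_gf k q" unfolding no_seq_gf_def using no_seq_gf_sums[of k q] k q
      by (intro suminf_nonneg) (auto simp: sums_iff)
  qed
  finally show "norm (no_seq_gf k (complex_of_real (exp (- s)) * cis \<theta>)) \<le>
      no_seq_gf k (exp (- s)) * exp (- c * min (\<theta>\<^sup>2 / s ^ 3) (1 / s))"
    by (simp add: z_def q_def mult.commute)
qed

section \<open>Integral representation of the gap series\<close>

definition gap_fun :: "nat \<Rightarrow> real \<Rightarrow> complex \<Rightarrow> complex" where
  "gap_fun k q z = (\<Sum>n. of_real (gap_coeff k q n) * z ^ n)"

lemma gap_fun_sums:
  assumes q: "0 < q" "q < 1" and k: "k \<ge> 1" and z: "norm z < 1"
  shows "summable (\<lambda>n. \<bar>gap_coeff k q n\<bar> * norm z ^ n)"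
    "(\<lambda>n. of_real (gap_coeff k q n) * z ^ n) sums gap_fun k q z"
proof -
  obtain C where C: "\<And>n. \<bar>gap_coeff k q n\<bar> \<le> C" using gap_coeff_bounded[OF q k] by blast
  have b: "norm (\<bar>gap_coeff k q n\<bar> * norm z ^ n) \<le> C * norm z ^ n" for n
    using C[of n] by (simp add: mult_right_mono)
  have sm: "summable (\<lambda>n. C * norm z ^ n)" using z by (intro summable_mult summable_geometric) auto
  show *: "summable (\<lambda>n. \<bar>gap_coeff k q n\<bar> * norm z ^ n)"
    by (rule summable_comparison_test'[OF sm, where N=0]) (rule b)
  have "summable (\<lambda>n. of_real (gap_coeff k q n) * z ^ n :: complex)"
    by (rule summable_norm_cancel) (use * in \<open>simp add: norm_mult norm_power\<close>)
  then show "(\<lambda>n. of_real (gap_coeff k q n) * z ^ n) sums gap_fun k q z"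
    unfolding gap_fun_def by (rule summable_sums)
qed

lemma gap_fun_holomorphic:
  assumes "0 < q" "q < 1" "k \<ge> 1"
  shows "gap_fun k q holomorphic_on ball 0 1"
  using power_series_holomorphic[of 0 1 "\<lambda>n. of_real (gap_coeff k q n)" "gap_fun k q"] gap_fun_sums(2)[OF assms]
  by simp

lemma gap_fun_0 [simp]: "gap_fun k q 0 = 1"
  by (simp add: gap_fun_def)

lemma gap_fun_eq:
  assumes q: "0 < q" "q < 1" and k: "k \<ge> 1" and z: "norm z < 1"
  shows "gap_fun k q z * (1 - z ^ (k + 1)) = (1 - z ^ k) * gap_fun k q (of_real q * z)"
proof -
  let ?b = "\<lambda>n. complex_of_real (gap_coeff k q n)"
  have qz: "norm (of_real q * z) < 1" using q z mult_strict_mono[of q 1 "norm z" 1] by (simp add: norm_mult)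
  have 1: "(\<lambda>n. ?b n * z ^ n) sums gap_fun k q z" using gap_fun_sums[OF q k z] by blast
  have 2: "(\<lambda>n. ?b n * (of_real q * z) ^ n) sums gap_fun k q (of_real q * z)" using gap_fun_sums[OF q k qz] by blast
  have e: "?b n * z ^ n - ?b n * (of_real q * z) ^ n =
     (if k < n then ?b (n - Suc k) else 0) * z ^ n - (if k \<le> n then of_real (q ^ (n - k)) * ?b (n - k) else 0) * z ^ n" for n
  proof (cases "n = 0")
    case False
    have "?b n * z ^ n - ?b n * (of_real q * z) ^ n = of_real (gap_coeff k q n * (1 - q ^ n)) * z ^ n"
      by (simp add: power_mult_distrib algebra_simps)
    also have "\<dots> = of_real ((if k < n then gap_coeff k q (n - Suc k) else 0) - (if k \<le> n then q ^ (n - k) * gap_coeff k q (n - k) else 0)) * z ^ n"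
      using False by (subst gap_coeff_rec[OF q k]) auto
    also have "\<dots> = (if k < n then ?b (n - Suc k) else 0) * z ^ n - (if k \<le> n then of_real (q ^ (n - k)) * ?b (n - k) else 0) * z ^ n"
      by (simp only: of_real_diff left_diff_distrib if_distrib[of complex_of_real] of_real_mult of_real_0)
    finally show ?thesis .
  qed (use k in auto)
  have "(\<lambda>n. z ^ Suc k * (?b n * z ^ n)) sums (z ^ Suc k * gap_fun k q z)" by (rule sums_mult[OF 1])
  also have "(\<lambda>n. z ^ Suc k * (?b n * z ^ n)) = (\<lambda>n. (if k < n + Suc k then ?b (n + Suc k - Suc k) else 0) * z ^ (n + Suc k))"
    by (auto simp: power_add algebra_simps)
  finally have u: "(\<lambda>n. (if k < n then ?b (n - Suc k) else 0) * z ^ n) sums (z ^ Suc k * gap_fun k q z)"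
    by (subst (asm) sums_iff_shift) simp
  have "(\<lambda>n. z ^ k * (?b n * (of_real q * z) ^ n)) sums (z ^ k * gap_fun k q (of_real q * z))" by (rule sums_mult[OF 2])
  also have "(\<lambda>n. z ^ k * (?b n * (of_real q * z) ^ n)) = (\<lambda>n. (if k \<le> n + k then of_real (q ^ (n + k - k)) * ?b (n + k - k) else 0) * z ^ (n + k))"
    by (auto simp: power_add power_mult_distrib algebra_simps)
  finally have v: "(\<lambda>n. (if k \<le> n then of_real (q ^ (n - k)) * ?b (n - k) else 0) * z ^ n) sums (z ^ k * gap_fun k q (of_real q * z))"
    by (subst (asm) sums_iff_shift) simp
  have "gap_fun k q z - gap_fun k q (of_real q * z) = z ^ Suc k * gap_fun k q z - z ^ k * gap_fun k q (of_real q * z)"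
    using sums_unique2[OF sums_diff[OF 1 2, unfolded e] sums_diff[OF u v]] .
  then show ?thesis by (simp add: algebra_simps)
qed

text \<open>Since q^(tri n) = exp (- s n^2 / 2) exp (- s n / 2), the first factor is the
  characteristic function of a standard normal variable at n sqrt s. With w = - \<i> sqrt s x the
  density becomes the Gaussian factor here, and the second factor becomes the shift by s /
  2.\<close>

definition gap_int :: "nat \<Rightarrow> real \<Rightarrow> complex \<Rightarrow> complex" where
  "gap_int k s w = exp (w\<^sup>2 / of_real (2 * s)) * gap_fun k (exp (- s)) (exp (- w - of_real (s / 2)))"

text \<open>Sum and expectation commute because each term has constant modulus in x and the power
  series converges absolutely at radius exp (- s / 2) < 1.\<close>

lemma gap_series_eq_expectation:
  assumes s: "0 < s" and k: "k \<ge> 1"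
  shows "complex_of_real (gap_series k (exp (- s)) 0) =
    (\<integral>x. gap_fun k (exp (- s)) (of_real (exp (- s / 2)) * cis (sqrt s * x)) \<partial>std_normal_distribution)"
    "integrable std_normal_distribution (\<lambda>x. gap_fun k (exp (- s)) (of_real (exp (- s / 2)) * cis (sqrt s * x)))"
proof -
  let ?q = "exp (- s)" and ?M = "std_normal_distribution"
  let ?b = "\<lambda>n. complex_of_real (gap_coeff k ?q n)"
  let ?f = "\<lambda>n x. ?b n * (of_real (exp (- s / 2)) * cis (sqrt s * x)) ^ n"
  have q: "0 < ?q" "?q < 1" using s by auto
  interpret real_distribution ?M by (rule real_dist_normal_dist)
  have r: "exp (- s / 2) < 1" using s by simp
  have nf: "norm (?f n x) = \<bar>gap_coeff k ?q n\<bar> * exp (- s / 2) ^ n" for n x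
    by (simp add: norm_mult norm_power)
  have sm: "summable (\<lambda>n. \<bar>gap_coeff k ?q n\<bar> * exp (- s / 2) ^ n)"
    using gap_fun_sums(1)[OF q k, of "of_real (exp (- s / 2))"] r by simp
  have meas: "(\<lambda>x. ?f n x) \<in> borel_measurable ?M" for n
  proof -
    have "(\<lambda>x. ?f n x) \<in> borel_measurable borel"
      by (rule borel_measurable_continuous_onI) (auto intro!: continuous_intros simp: cis_conv_exp)
    then show ?thesis by simp
  qed
  have int: "integrable ?M (?f n)" for n
    by (rule integrable_const_bound[where B="\<bar>gap_coeff k ?q n\<bar> * exp (- s / 2) ^ n"])
       (use nf meas in auto)
  have val: "(\<integral>x. ?f n x \<partial>?M) = of_real (gap_coeff k ?q n * ?q ^ (tri n + 0 * n))" for n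
  proof -
    have "(\<integral>x. ?f n x \<partial>?M) = (\<integral>x. (?b n * of_real (exp (- s / 2)) ^ n) * iexp ((real n * sqrt s) * x) \<partial>?M)"
      by (intro Bochner_Integration.integral_cong refl)
         (simp add: power_mult_distrib cis_conv_exp exp_of_nat_mult[symmetric] mult_ac)
    also have "\<dots> = (?b n * of_real (exp (- s / 2)) ^ n) * char ?M (real n * sqrt s)"
      unfolding char_def by simp
    also have "char ?M (real n * sqrt s) = complex_of_real (exp (- ((real n * sqrt s)\<^sup>2) / 2))"
      by (simp add: char_std_normal_distribution)
    also have "(real n * sqrt s)\<^sup>2 = (real n)\<^sup>2 * s" using s by (simp add: power_mult_distrib)
    also have "(?b n * of_real (exp (- s / 2)) ^ n) * complex_of_real (exp (- ((real n)\<^sup>2 * s) / 2)) =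
       of_real (gap_coeff k ?q n * (exp (- s / 2) ^ n * exp (- ((real n)\<^sup>2 * s) / 2)))" by simp
    also have "exp (- s / 2) ^ n * exp (- ((real n)\<^sup>2 * s) / 2) = exp (- s * real (tri n))"
    proof -
      have "even (n * (n + 1))" by simp
      then have "real (tri n) = real (n * (n + 1)) / 2" unfolding tri_def using real_of_nat_div[of 2 "n * (n+1)"] by simp
      then show ?thesis
        by (simp add: exp_of_nat_mult[symmetric] exp_add[symmetric] power2_eq_square algebra_simps add_divide_distrib)
    qed
    also have "\<dots> = ?q ^ (tri n + 0 * n)" by (simp add: exp_of_nat_mult[symmetric] mult.commute)
    finally show ?thesis .
  qed
  have gf: "gap_fun k ?q (of_real (exp (- s / 2)) * cis (sqrt s * x)) = (\<Sum>n. ?f n x)" for x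
    by (simp add: gap_fun_def)
  have "integrable ?M (\<lambda>x. \<Sum>n. ?f n x)" and
    I: "(\<integral>x. (\<Sum>n. ?f n x) \<partial>?M) = (\<Sum>n. \<integral>x. ?f n x \<partial>?M)"
    using integrable_suminf[of ?M ?f] integral_suminf[of ?M ?f] int sm nf
    by (auto simp: prob_space.prob_space[OF prob_space_axioms, simplified])
  then show "integrable ?M (\<lambda>x. gap_fun k ?q (of_real (exp (- s / 2)) * cis (sqrt s * x)))"
    unfolding gf by simp
  have "summable (\<lambda>n. gap_coeff k ?q n * ?q ^ (tri n + 0 * n))" by (rule gap_series_summable[OF q k])
  then show "complex_of_real (gap_series k ?q 0) = (\<integral>x. gap_fun k ?q (of_real (exp (- s / 2)) * cis (sqrt s * x)) \<partial>?M)"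
    unfolding gf I val gap_series_def by (rule suminf_of_real)
qed

lemma gap_series_eq_integral:
  assumes s: "0 < s" and k: "k \<ge> 1"
  shows "integrable lborel (\<lambda>v. gap_int k s (\<i> * of_real v))"
    "complex_of_real (gap_series k (exp (- s)) 0 * sqrt (2 * pi * s)) = (\<integral>v. gap_int k s (\<i> * of_real v) \<partial>lborel)"
proof -
  let ?q = "exp (- s)"
  let ?g = "\<lambda>x. gap_fun k ?q (of_real (exp (- s / 2)) * cis (sqrt s * x))"
  have q: "0 < ?q" "?q < 1" using s by auto
  let ?h = "\<lambda>x. std_normal_density x *\<^sub>R ?g x"
  have contg: "continuous_on UNIV ?g"
  proof (rule continuous_on_compose2[OF holomorphic_on_imp_continuous_on[OF gap_fun_holomorphic[OF q k]]])
    show "continuous_on UNIV (\<lambda>x. of_real (exp (- s / 2)) * cis (sqrt s * x))"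
      by (auto simp: cis_conv_exp intro!: continuous_intros)
  qed (use s in \<open>auto simp: norm_mult\<close>)
  have mg: "?g \<in> borel_measurable borel" by (rule borel_measurable_continuous_onI[OF contg])
  have int: "integrable lborel ?h"
    using gap_series_eq_expectation(2)[OF s k] mg
    by (subst (asm) integrable_density) auto
  have val: "complex_of_real (gap_series k ?q 0) = (\<integral>x. ?h x \<partial>lborel)"
    unfolding gap_series_eq_expectation(1)[OF s k] using mg by (subst integral_density) auto
  \<comment> \<open>The substitution x = - v / sqrt s; its sign turns cis (sqrt s x) into exp (-
    \<i> v).\<close>
  have ss: "sqrt s > 0" using s by simp
  have hs: "?h (0 + (- 1 / sqrt s) * v) = of_real (1 / sqrt (2 * pi)) * gap_int k s (\<i> * of_real v)" for v
  proof -
    have "(- 1 / sqrt s * v)\<^sup>2 = v\<^sup>2 / s" using s by (simp add: power_divide power_mult_distrib)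
    then have 1: "std_normal_density (0 + (- 1 / sqrt s) * v) = 1 / sqrt (2 * pi) * exp (- v\<^sup>2 / (2 * s))"
      by (simp add: std_normal_density_def)
    have 2: "of_real (exp (- s / 2)) * cis (sqrt s * (0 + (- 1 / sqrt s) * v)) = exp (- (\<i> * of_real v) - of_real (s / 2))"
      using ss by (simp add: cis_conv_exp exp_of_real[symmetric] exp_add[symmetric] exp_diff exp_minus field_simps)
    have 3: "exp ((\<i> * of_real v)\<^sup>2 / of_real (2 * s)) = complex_of_real (exp (- v\<^sup>2 / (2 * s)))"
      by (simp add: exp_of_real[symmetric] power_mult_distrib)
    show ?thesis unfolding 1 2 gap_int_def 3 by (simp add: scaleR_conv_of_real)
  qed
  have nz: "- 1 / sqrt s \<noteq> 0" using ss by simp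
  have "integrable lborel (\<lambda>v. ?h (0 + (- 1 / sqrt s) * v))"
    by (rule lborel_integrable_real_affine[OF int nz])
  then have "integrable lborel (\<lambda>v. of_real (sqrt (2 * pi)) * (of_real (1 / sqrt (2 * pi)) * gap_int k s (\<i> * of_real v)))"
    unfolding hs by (rule integrable_mult_right)
  moreover have cancel: "of_real (sqrt (2 * pi)) * (of_real (1 / sqrt (2 * pi)) * x) = x" for x :: complex
    by simp
  ultimately show "integrable lborel (\<lambda>v. gap_int k s (\<i> * of_real v))" unfolding cancel by blast
  have "complex_of_real (gap_series k ?q 0) = \<bar>- 1 / sqrt s\<bar> *\<^sub>R (\<integral>v. ?h (0 + (- 1 / sqrt s) * v) \<partial>lborel)"
    unfolding val by (rule lborel_integral_real_affine[OF nz])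
  also have "\<dots> = of_real (1 / (sqrt s * sqrt (2 * pi))) * (\<integral>v. gap_int k s (\<i> * of_real v) \<partial>lborel)"
    unfolding hs using ss by (simp add: scaleR_conv_of_real)
  finally have G: "complex_of_real (gap_series k ?q 0) = of_real (1 / (sqrt s * sqrt (2 * pi))) * (\<integral>v. gap_int k s (\<i> * of_real v) \<partial>lborel)" .
  have "sqrt (2 * pi * s) = sqrt s * sqrt (2 * pi)" by (simp add: real_sqrt_mult)
  then show "complex_of_real (gap_series k ?q 0 * sqrt (2 * pi * s)) = (\<integral>v. gap_int k s (\<i> * of_real v) \<partial>lborel)"
    unfolding of_real_mult G using ss by simp
qed

section \<open>The dilogarithmic phase\<close>

text \<open>The term \<open>n = 0\<close> vanishes because \<open>1 / 0 = 0\<close>.\<close>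
definition dilog :: "complex \<Rightarrow> complex" where
  "dilog z = (\<Sum>n. z ^ n / of_nat n ^ 2)"

lemma inverse_squares_sums_0: "(\<lambda>n. 1 / real n ^ 2) sums (pi\<^sup>2 / 6)"
proof -
  have "(\<lambda>n. 1 / real (n + 1) ^ 2) sums (pi\<^sup>2 / 6)" using inverse_squares_sums by (simp add: add_ac)
  then show ?thesis by (subst (asm) sums_iff_shift) simp
qed

lemma dilog_sums:
  assumes "norm z \<le> 1"
  shows "(\<lambda>n. z ^ n / of_nat n ^ 2) sums dilog z"
proof -
  have "summable (\<lambda>n. z ^ n / of_nat n ^ 2)"
  proof (rule summable_comparison_test'[where N=0])
    show "summable (\<lambda>n. 1 / real n ^ 2)" using inverse_squares_sums_0 by (simp add: sums_iff)
    show "norm (z ^ n / of_nat n ^ 2) \<le> 1 / real n ^ 2" for n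
      using assms by (simp add: norm_divide norm_power power_le_one divide_right_mono)
  qed
  then show ?thesis unfolding dilog_def by (rule summable_sums)
qed

lemma dilog_1: "dilog 1 = of_real (pi\<^sup>2 / 6)"
proof -
  have "(\<lambda>n. complex_of_real (1 / real n ^ 2)) sums of_real (pi\<^sup>2 / 6)"
    using inverse_squares_sums_0 by (rule sums_of_real)
  moreover have "(\<lambda>n. complex_of_real (1 / real n ^ 2)) sums dilog 1"
    using dilog_sums[of 1] by simp
  ultimately show ?thesis by (rule sums_unique2[symmetric])
qed

lemma pi_sq_le: "pi\<^sup>2 / 6 \<le> 3"
proof -
  have "pi\<^sup>2 \<le> 4\<^sup>2" using pi_less_4 by (intro power_mono) auto
  then show ?thesis by simp
qed

lemma norm_dilog_le:
  assumes "norm z \<le> 1"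
  shows "norm (dilog z) \<le> 3 * norm z" "norm (dilog z - z) \<le> 3 * norm z ^ 2"
proof -
  have *: "norm (\<Sum>n. f n) \<le> 3 * c" if f: "\<And>n. norm (f n) \<le> c * (1 / real n ^ 2)" and "c \<ge> 0" for f :: "nat \<Rightarrow> complex" and c
  proof -
    have s: "(\<lambda>n. c * (1 / real n ^ 2)) sums (c * (pi\<^sup>2 / 6))" by (rule sums_mult[OF inverse_squares_sums_0])
    have "norm (\<Sum>n. f n) \<le> (\<Sum>n. c * (1 / real n ^ 2))"
      by (rule norm_suminf_le[OF f sums_summable[OF s]])
    also have "\<dots> = c * (pi\<^sup>2 / 6)" using s by (simp add: sums_iff)
    also have "\<dots> \<le> c * 3" using pi_sq_le that by (intro mult_left_mono) auto
    finally show ?thesis by (simp add: mult.commute)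
  qed
  have p: "norm z ^ n \<le> norm z ^ m" if "m \<le> n" for m n using assms that by (intro power_decreasing) auto
  show "norm (dilog z) \<le> 3 * norm z" unfolding dilog_def
  proof (rule *)
    fix n show "norm (z ^ n / of_nat n ^ 2) \<le> norm z * (1 / real n ^ 2)"
      using p[of 1 n] by (cases "n = 0") (auto simp: norm_divide norm_power divide_right_mono)
  qed simp
  have "(\<lambda>n. z ^ n / of_nat n ^ 2 - (if n = 1 then z else 0)) sums (dilog z - z)"
    using sums_single[of 1 "\<lambda>_. z"] by (intro sums_diff dilog_sums assms) auto
  then have "dilog z - z = (\<Sum>n. z ^ n / of_nat n ^ 2 - (if n = 1 then z else 0))" by (simp add: sums_iff)
  also have "norm \<dots> \<le> 3 * norm z ^ 2"
  proof (rule *)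
    fix n show "norm (z ^ n / of_nat n ^ 2 - (if n = 1 then z else 0)) \<le> norm z ^ 2 * (1 / real n ^ 2)"
      using p[of 2 n] by (cases "n = 0 \<or> n = 1") (auto simp: norm_divide norm_power divide_right_mono)
  qed simp
  finally show "norm (dilog z - z) \<le> 3 * norm z ^ 2" .
qed

lemma continuous_on_dilog: "continuous_on (cball 0 1) dilog"
proof -
  have ul: "uniform_limit (cball 0 1) (\<lambda>n z. \<Sum>i<n. z ^ i / of_nat i ^ 2) (\<lambda>z::complex. \<Sum>i. z ^ i / of_nat i ^ 2) sequentially"
  proof (rule Weierstrass_m_test)
    show "summable (\<lambda>n. 1 / real n ^ 2)" using inverse_squares_sums_0 by (simp add: sums_iff)
    show "norm (z ^ n / of_nat n ^ 2) \<le> 1 / real n ^ 2" if "z \<in> cball 0 1" for n and z :: complex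
      using that by (simp add: norm_divide norm_power power_le_one divide_right_mono)
  qed
  have "continuous_on (cball 0 1) (\<lambda>z. \<Sum>i. z ^ i / of_nat i ^ 2 :: complex)"
  proof (rule uniform_limit_theorem[OF _ ul])
    have "continuous_on (cball 0 1) (\<lambda>z::complex. \<Sum>i<n. z ^ i / of_nat i ^ 2)" for n
      unfolding divide_inverse
      by (intro continuous_on_sum continuous_on_mult_right continuous_on_power continuous_on_id)
    then show "\<forall>\<^sub>F n in sequentially. continuous_on (cball 0 1) (\<lambda>z::complex. \<Sum>i<n. z ^ i / of_nat i ^ 2)"
      by (intro always_eventually allI)
  qed simp
  then show ?thesis by (simp add: dilog_def[abs_def])
qed

text \<open>Termwise, z times the derivative of the dilogarithm is - Ln (1 - z); the chain rule
  supplies the factor z.\<close>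

lemma dilog_exp_has_derivative:
  fixes a :: real
  assumes a: "a > 0" and w: "Re w < 0"
  shows "((\<lambda>w. dilog (exp (of_real a * w))) has_field_derivative (- of_real a * Ln (1 - exp (of_real a * w)))) (at w)"
proof -
  let ?c = "\<lambda>n. 1 / of_nat n ^ 2 :: complex"
  define z where "z = exp (of_real a * w)"
  have z: "norm z < 1" using a w by (simp add: z_def mult_pos_neg)
  have sm: "summable (\<lambda>n. ?c n * u ^ n)" if "norm u < 1" for u
    using dilog_sums[of u] that by (simp add: sums_iff)
  have d: "(dilog has_field_derivative (\<Sum>n. diffs ?c n * z ^ n)) (at z)"
    using termdiffs_strong'[of 1 ?c z, OF sm z] by (simp add: dilog_def[abs_def])
  have eq: "z * (\<Sum>n. diffs ?c n * z ^ n) = - Ln (1 - z)"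
  proof -
    have L: "(\<lambda>n. z ^ n / of_nat n) sums (- Ln (1 - z))"
      using sums_minus[OF Ln_series'[of "- z"]] z by simp
    have "summable (\<lambda>n. diffs ?c n * z ^ n)"
      by (rule termdiff_converges[OF z]) (use sm in auto)
    then have "(\<lambda>n. z * (diffs ?c n * z ^ n)) sums (z * (\<Sum>n. diffs ?c n * z ^ n))"
      by (intro sums_mult summable_sums)
    also have "(\<lambda>n. z * (diffs ?c n * z ^ n)) = (\<lambda>n. z ^ (Suc n) / of_nat (Suc n))"
      by (auto simp: diffs_def power2_eq_square simp del: of_nat_Suc)
    finally have "(\<lambda>n. z ^ n / of_nat n) sums (z * (\<Sum>n. diffs ?c n * z ^ n))"
      by (subst (asm) sums_Suc_iff) simp
    then show ?thesis using L by (rule sums_unique2)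
  qed
  have "((\<lambda>w. exp (of_real a * w)) has_field_derivative (of_real a * z)) (at w)"
    unfolding z_def by (auto intro!: derivative_eq_intros)
  from DERIV_chain2[OF d[unfolded z_def] this]
  have "((\<lambda>w. dilog (exp (of_real a * w))) has_field_derivative ((\<Sum>n. diffs ?c n * z ^ n) * (of_real a * z))) (at w)"
    by (simp add: z_def)
  also have "(\<Sum>n. diffs ?c n * z ^ n) * (of_real a * z) = of_real a * (z * (\<Sum>n. diffs ?c n * z ^ n))"
    by (simp only: mult_ac)
  also have "\<dots> = - of_real a * Ln (1 - z)" unfolding eq by simp
  finally show ?thesis by (simp only: z_def)
qed

text \<open>Up to sign, the second derivative of Ln (1 - exp (a w)). With t = - a Re w, 1 - exp (-
  t) >= exp (- t / 2) t / 2, so both exp (- t) and \<open>a\<close> cancel.\<close>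

lemma one_minus_exp_bound:
  fixes a :: real
  assumes a: "a > 0" and w: "Re w < 0"
  shows "norm (of_real a ^ 2 * exp (of_real a * w) / (1 - exp (of_real a * w)) ^ 2) \<le> 4 / (Re w)\<^sup>2"
proof -
  define t where "t = - (a * Re w)"
  have t: "t > 0" using a w by (simp add: t_def mult_pos_neg)
  have e: "norm (exp (of_real a * w)) = exp (- t)" by (simp add: t_def)
  have "t / 2 \<le> exp (t / 2) - exp (- (t / 2))"
  proof -
    have "1 + t / 2 \<le> exp (t / 2)" by (rule exp_ge_add_one_self)
    moreover have "exp (- (t / 2)) \<le> 1" using t by simp
    ultimately show ?thesis by linarith
  qed
  then have "exp (- (t / 2)) * (t / 2) \<le> exp (- (t / 2)) * (exp (t / 2) - exp (- (t / 2)))"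
    by (intro mult_left_mono) auto
  also have "\<dots> = 1 - exp (- t)" by (simp add: right_diff_distrib exp_add[symmetric])
  also have "\<dots> \<le> norm (1 - exp (of_real a * w))"
    using norm_triangle_ineq2[of 1 "exp (of_real a * w)"] e by simp
  finally have 1: "exp (- (t / 2)) * (t / 2) \<le> norm (1 - exp (of_real a * w))" .
  have "(exp (- (t / 2)) * (t / 2))\<^sup>2 \<le> norm (1 - exp (of_real a * w)) ^ 2"
    using 1 t by (intro power_mono) auto
  moreover have "(exp (- (t / 2)) * (t / 2))\<^sup>2 = exp (- t) * (t\<^sup>2 / 4)"
    by (simp add: power_mult_distrib power_divide exp_double[symmetric])
  ultimately have 2: "exp (- t) * (t\<^sup>2 / 4) \<le> norm (1 - exp (of_real a * w)) ^ 2" by simp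
  have pos: "exp (- t) * (t\<^sup>2 / 4) > 0" using t by simp
  have "norm (of_real a ^ 2 * exp (of_real a * w) / (1 - exp (of_real a * w)) ^ 2)
      = a\<^sup>2 * exp (- t) / norm (1 - exp (of_real a * w)) ^ 2"
    using e by (simp add: norm_mult norm_divide norm_power)
  also have "\<dots> \<le> a\<^sup>2 * exp (- t) / (exp (- t) * (t\<^sup>2 / 4))"
    using 2 pos by (intro divide_left_mono mult_pos_pos[OF order_less_le_trans[OF pos 2] pos]) auto
  also have "\<dots> = 4 / (Re w)\<^sup>2" using a w by (simp add: t_def power_mult_distrib)
  finally show ?thesis .
qed

lemma one_minus_exp_notin:
  assumes "a > 0" "Re w < 0"
  shows "1 - exp (complex_of_real a * w) \<notin> \<real>\<^sub>\<le>\<^sub>0" "1 - exp (complex_of_real a * w) \<noteq> 0"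
proof -
  have "norm (exp (complex_of_real a * w)) < 1" using assms by (simp add: mult_pos_neg)
  then have "Re (exp (complex_of_real a * w)) < 1" using complex_Re_le_cmod order_le_less_trans by blast
  then show "1 - exp (complex_of_real a * w) \<notin> \<real>\<^sub>\<le>\<^sub>0" "1 - exp (complex_of_real a * w) \<noteq> 0"
    by (auto simp: complex_nonpos_Reals_iff simp del: Re_exp)
qed

text \<open>On the left half-plane, the logarithm of \<open>(exp ((k + 1) * w) - 1) / (exp (k * w) - 1)\<close>, which is the ratio
  of the integrand at \<open>w + s / 2\<close> and \<open>w - s / 2\<close>; \<open>phase_left\<close> is its primitive.\<close>
definition log_left :: "nat \<Rightarrow> complex \<Rightarrow> complex" where
  "log_left k w = Ln (1 - exp (of_real (real k + 1) * w)) - Ln (1 - exp (of_real (real k) * w))"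

definition phase_left :: "nat \<Rightarrow> complex \<Rightarrow> complex" where
  "phase_left k w = dilog (exp (of_real (real k) * w)) / of_real (real k)
      - dilog (exp (of_real (real k + 1) * w)) / of_real (real k + 1)"

lemma phase_left_has_derivative:
  assumes "k \<ge> 1" "Re w < 0"
  shows "(phase_left k has_field_derivative log_left k w) (at w)"
proof -
  have k: "real k > 0" "real k + 1 > 0" using assms by auto
  have "(phase_left k has_field_derivative
     (- of_real (real k) * Ln (1 - exp (of_real (real k) * w))) / of_real (real k)
     - (- of_real (real k + 1) * Ln (1 - exp (of_real (real k + 1) * w))) / of_real (real k + 1)) (at w)"
    unfolding phase_left_def[abs_def]
    by (intro DERIV_diff DERIV_cdivide dilog_exp_has_derivative k assms)
  then show ?thesis using k by (simp add: log_left_def del: of_real_add)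
qed

text \<open>The inverse-square decay is what makes the errors of infinitely many steps
  summable.\<close>

lemma log_left_derivs:
  assumes k: "k \<ge> 1"
  obtains D1 D2 where
    "\<And>w. Re w < 0 \<Longrightarrow> (log_left k has_field_derivative D1 w) (at w)"
    "\<And>w. Re w < 0 \<Longrightarrow> (D1 has_field_derivative D2 w) (at w)"
    "\<And>w. Re w < 0 \<Longrightarrow> norm (D2 w) \<le> 8 / (Re w)\<^sup>2"
proof -
  define E1 where "E1 = (\<lambda>(a::real) (w::complex). - of_real a * exp (of_real a * w) / (1 - exp (of_real a * w)))"
  define E2 where "E2 = (\<lambda>(a::real) (w::complex). - (of_real a ^ 2 * exp (of_real a * w) / (1 - exp (of_real a * w)) ^ 2))"
  have 1: "((\<lambda>w. Ln (1 - exp (of_real a * w))) has_field_derivative E1 a w) (at w)"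
    if "a > 0" "Re w < 0" for a w
    unfolding E1_def using one_minus_exp_notin[OF that]
    by (auto intro!: derivative_eq_intros simp: field_simps)
  have 2: "(E1 a has_field_derivative E2 a w) (at w)" if "a > 0" "Re w < 0" for a w
    unfolding E1_def E2_def using one_minus_exp_notin[OF that]
    by (auto intro!: derivative_eq_intros simp: field_simps power2_eq_square)
  have kp: "real k > 0" "real k + 1 > 0" using assms by auto
  show ?thesis
  proof
    fix w :: complex assume w: "Re w < 0"
    show "(log_left k has_field_derivative (E1 (real k + 1) w - E1 (real k) w)) (at w)"
      unfolding log_left_def[abs_def] by (intro DERIV_diff 1 kp w)
    show "((\<lambda>w. E1 (real k + 1) w - E1 (real k) w) has_field_derivative (E2 (real k + 1) w - E2 (real k) w)) (at w)"
      by (intro DERIV_diff 2 kp w)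
    have "norm (E2 (real k + 1) w - E2 (real k) w) \<le> 4 / (Re w)\<^sup>2 + 4 / (Re w)\<^sup>2"
      unfolding E2_def by (rule norm_triangle_le_diff, rule add_mono)
        (simp_all only: norm_minus_cancel one_minus_exp_bound kp w)
    then show "norm (E2 (real k + 1) w - E2 (real k) w) \<le> 8 / (Re w)\<^sup>2" by simp
  qed
qed

section \<open>Logarithm and phase on the strip\<close>

definition strip :: "nat \<Rightarrow> complex set" where
  "strip k = {w. \<bar>Im w\<bar> < 2 * pi / (real k + 1)}"

lemma convex_halfplanes:
  "convex {w. Re w < c}" "convex {w. Re w > c}" "open {w. Re w < c}" "open {w. Re w > c}"
  "convex {w. Im w < c}" "convex {w. Im w > c}" "open {w. Im w < c}" "open {w. Im w > c}"
  by (auto simp: convex_halfspace_Re_lt convex_halfspace_Re_gt convex_halfspace_Im_lt convex_halfspace_Im_gt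
        open_halfspace_Re_lt open_halfspace_Re_gt open_halfspace_Im_lt open_halfspace_Im_gt)

lemma strip_eq: "strip k = {w. Im w < 2 * pi / (real k + 1)} \<inter> {w. Im w > - (2 * pi / (real k + 1))}"
  by (auto simp: strip_def abs_less_iff)

lemma strip_convex: "convex (strip k)" and strip_open: "open (strip k)"
  unfolding strip_eq by (auto intro!: convex_Int open_Int convex_halfplanes)

lemma geometric_exp: "(exp w - 1) * (\<Sum>i<n. exp (of_nat i * w)) = exp (of_nat n * w) - (1::complex)"
proof -
  have "exp (of_nat i * w) = exp w ^ i" for i by (simp add: exp_of_nat_mult)
  then show ?thesis by (simp add: power_diff_1_eq)
qed

text \<open>Dividing exp (n w) - 1 by exp w - 1 removes the zero at 0. The remaining zeros lie on
  the imaginary axis at distance at least 2 pi / n from 0, and for n = k + 1 this is the half-height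
  of \<open>strip\<close>.\<close>

lemma geometric_exp_nonzero:
  assumes "w \<in> strip k" "n \<le> k + 1" "n \<ge> 1"
  shows "(\<Sum>i<n. exp (of_nat i * w)) \<noteq> (0::complex)"
proof
  assume *: "(\<Sum>i<n. exp (of_nat i * w)) = 0"
  then have "exp (of_nat n * w) = 1" using geometric_exp[of w n] by simp
  then obtain m :: int where m: "Re (of_nat n * w) = 0" "Im (of_nat n * w) = of_int (2 * m) * pi"
    by (auto simp: exp_eq_1)
  have re: "Re w = 0" and im: "Im w * real n = 2 * pi * of_int m" using m assms by (auto simp: mult_ac)
  have "m = 0"
  proof (rule ccontr)
    assume "m \<noteq> 0"
    then have "1 \<le> \<bar>real_of_int m\<bar>" by linarith
    then have "2 * pi * 1 \<le> 2 * pi * \<bar>real_of_int m\<bar>" by (intro mult_left_mono) auto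
    also have "\<dots> = \<bar>Im w\<bar> * real n" using arg_cong[OF im, of abs] by (simp add: abs_mult)
    also have "\<dots> \<le> \<bar>Im w\<bar> * (real k + 1)" using assms by (intro mult_left_mono) auto
    also have "\<dots> < 2 * pi" using assms by (simp add: strip_def field_simps)
    finally show False by simp
  qed
  then have "w = 0" using re im assms by (intro complex_eqI) auto
  then show False using * assms by simp
qed

lemma exp_eq_imp_diff_const:
  assumes f: "f holomorphic_on A" and g: "g holomorphic_on A" and A: "open A" "convex A"
    and e: "\<And>z. z \<in> A \<Longrightarrow> exp (f z) = exp (g z)"
  shows "\<exists>c. \<forall>z\<in>A. f z = g z + c"
proof -
  have "\<exists>c. \<forall>z\<in>A. f z - g z = c"
  proof (rule has_field_derivative_zero_constant[OF A(2)])
    fix z assume z: "z \<in> A"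
    have df: "(f has_field_derivative deriv f z) (at z)" and dg: "(g has_field_derivative deriv g z) (at z)"
      using holomorphic_derivI[OF f A(1) z] holomorphic_derivI[OF g A(1) z] by auto
    have "((\<lambda>z. exp (f z)) has_field_derivative exp (f z) * deriv f z) (at z)"
      using df by (auto intro!: derivative_eq_intros)
    moreover have "((\<lambda>z. exp (g z)) has_field_derivative exp (g z) * deriv g z) (at z)"
      using dg by (auto intro!: derivative_eq_intros)
    then have "((\<lambda>z. exp (f z)) has_field_derivative exp (g z) * deriv g z) (at z)"
      by (rule has_field_derivative_transform_within_open[OF _ A(1) z]) (simp add: e)
    ultimately have "exp (f z) * deriv f z = exp (g z) * deriv g z" by (rule DERIV_unique)
    then have "deriv f z = deriv g z" using e[OF z] by simp
    then show "((\<lambda>z. f z - g z) has_field_derivative 0) (at z within A)"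
      using DERIV_diff[OF df dg] by (auto intro: has_field_derivative_at_within)
  qed
  then show ?thesis by (auto simp: algebra_simps)
qed

lemma strip_of_real [simp]: "complex_of_real x \<in> strip k"
  by (simp add: strip_def)

lemma exp_log_left:
  assumes "k \<ge> 1" "Re w < 0"
  shows "exp (log_left k w) * (\<Sum>i<k. exp (of_nat i * w)) = (\<Sum>i<k+1. exp (of_nat i * w))"
proof -
  have nz: "1 - exp (of_real (real k + 1) * w) \<noteq> 0" "1 - exp (of_real (real k) * w) \<noteq> 0" "1 - exp (of_real 1 * w) \<noteq> 0"
    using assms by (intro one_minus_exp_notin; simp)+
  have "exp (log_left k w) * (1 - exp (of_nat k * w)) = 1 - exp (of_nat (k+1) * w)"
    using nz by (simp add: log_left_def exp_diff add_ac)
  moreover have "1 - exp (of_nat n * w) = - ((exp w - 1) * (\<Sum>i<n. exp (of_nat i * w)))" for n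
    unfolding geometric_exp by simp
  ultimately have "(exp w - 1) * (exp (log_left k w) * (\<Sum>i<k. exp (of_nat i * w))) = (exp w - 1) * (\<Sum>i<k+1. exp (of_nat i * w))"
    by (simp only: mult_minus_right mult.left_commute neg_equal_iff_equal)
  then show ?thesis using nz(3) by simp
qed

text \<open>On the right half-plane exp ((k + 1) w) and exp (k w) are factored out; their quotient
  is exp w and the rest is the left formula at - w.\<close>

lemma exp_log_right:
  assumes "k \<ge> 1" "Re w > 0"
  shows "exp (w + log_left k (- w)) * (\<Sum>i<k. exp (of_nat i * w)) = (\<Sum>i<k+1. exp (of_nat i * w))"
proof -
  have nz: "1 - exp (of_real (real k + 1) * (- w)) \<noteq> 0" "1 - exp (of_real (real k) * (- w)) \<noteq> 0" "1 - exp (of_real 1 * (- w)) \<noteq> 0"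
    using assms by (intro one_minus_exp_notin; simp)+
  have "exp (log_left k (- w)) * (1 - exp (- (of_nat k * w))) = 1 - exp (- (of_nat (k+1) * w))"
    using nz by (simp add: log_left_def exp_diff add_ac)
  moreover have "exp (of_nat (k+1) * w) = exp (of_nat k * w) * exp w"
    by (simp add: exp_add[symmetric] algebra_simps)
  moreover have "E * x * (A - 1) = A * E - 1" if "x * (1 - inverse A) = 1 - inverse (A * E)" "A \<noteq> 0" "E \<noteq> 0" for A E x :: complex
  proof -
    have "E * x * (A - 1) = A * E * (x * (1 - inverse A))" using that(2) by (simp add: right_diff_distrib left_diff_distrib)
    also have "\<dots> = A * E - 1" unfolding that(1) using that(2,3) right_inverse[of "A * E"] by (simp add: right_diff_distrib del: inverse_mult_distrib)
    finally show ?thesis .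
  qed
  ultimately have "exp (w + log_left k (- w)) * (exp (of_nat k * w) - 1) = exp (of_nat (k+1) * w) - 1"
    by (simp only: exp_add exp_minus exp_not_eq_zero not_False_eq_True)
  then have "(exp w - 1) * (exp (w + log_left k (- w)) * (\<Sum>i<k. exp (of_nat i * w))) = (exp w - 1) * (\<Sum>i<k+1. exp (of_nat i * w))"
    unfolding geometric_exp[symmetric] by (simp only: mult.left_commute)
  moreover have "exp w \<noteq> 1" using nz(3) by (simp add: exp_minus)
  ultimately show ?thesis by simp
qed

lemma log_left_holomorphic: "k \<ge> 1 \<Longrightarrow> log_left k holomorphic_on {w. Re w < 0}"
  unfolding holomorphic_on_open[OF convex_halfplanes(3)] by (rule log_left_derivs) blast+

lemma tendsto_const_eq:
  fixes f :: "'a \<Rightarrow> 'b::t2_space"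
  assumes "(f \<longlongrightarrow> a) F" "\<forall>\<^sub>F x in F. f x = c" "F \<noteq> bot"
  shows "a = c"
  using tendsto_unique[OF assms(3,1) tendsto_eventually[OF assms(2)]] .

text \<open>A holomorphic logarithm of the zero-free quotient exists on the convex strip and differs
  from each explicit formula by a constant. The two constants agree: at x and - x on the real line
  both formulas evaluate \<open>log_left\<close> at the same point, so letting x tend to 0 compares
  them.\<close>

lemma log_exists:
  assumes k: "k \<ge> 1"
  obtains \<Lambda> where "\<Lambda> holomorphic_on strip k"
    "\<And>w. w \<in> strip k \<Longrightarrow> Re w < 0 \<Longrightarrow> \<Lambda> w = log_left k w"
    "\<And>w. w \<in> strip k \<Longrightarrow> Re w > 0 \<Longrightarrow> \<Lambda> w = w + log_left k (- w)"
proof -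
  define h where "h = (\<lambda>w. (\<Sum>i<k+1. exp (of_nat i * w)) / (\<Sum>i<k. exp (of_nat i * w)) :: complex)"
  have nz: "(\<Sum>i<k. exp (of_nat i * w)) \<noteq> (0::complex)" "(\<Sum>i<k+1. exp (of_nat i * w)) \<noteq> (0::complex)" if "w \<in> strip k" for w
    using geometric_exp_nonzero[OF that, of k] geometric_exp_nonzero[OF that, of "k+1"] k by auto
  have holh: "h holomorphic_on strip k"
    unfolding h_def using nz by (intro holomorphic_intros) auto
  obtain \<Lambda>0 where \<Lambda>0: "\<Lambda>0 holomorphic_on strip k" "\<And>w. w \<in> strip k \<Longrightarrow> exp (\<Lambda>0 w) = h w"
    using holomorphic_logarithm_exists[OF strip_convex strip_open holh, of 0] nz
    by (auto simp: h_def strip_def)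
  define L where "L = strip k \<inter> {w. Re w < 0}"
  define R where "R = strip k \<inter> {w. Re w > 0}"
  have LR: "open L" "convex L" "open R" "convex R"
    unfolding L_def R_def by (auto intro!: open_Int convex_Int strip_open strip_convex convex_halfplanes)
  have "\<exists>c. \<forall>w\<in>L. \<Lambda>0 w = log_left k w + c"
  proof (rule exp_eq_imp_diff_const[OF _ _ LR(1,2)])
    show "\<Lambda>0 holomorphic_on L" "log_left k holomorphic_on L"
      using \<Lambda>0(1) log_left_holomorphic[OF k] by (auto simp: L_def intro: holomorphic_on_subset)
    fix w assume "w \<in> L"
    then have w: "w \<in> strip k" "Re w < 0" by (auto simp: L_def)
    have "exp (\<Lambda>0 w) = exp (log_left k w) * (\<Sum>i<k. exp (of_nat i * w)) / (\<Sum>i<k. exp (of_nat i * w))"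
      unfolding \<Lambda>0(2)[OF w(1)] exp_log_left[OF k w(2)] h_def ..
    then show "exp (\<Lambda>0 w) = exp (log_left k w)" using nz(1)[OF w(1)] by simp
  qed
  then obtain c where c: "\<And>w. w \<in> L \<Longrightarrow> \<Lambda>0 w = log_left k w + c" by blast
  define \<Lambda> where "\<Lambda> = (\<lambda>w. \<Lambda>0 w - c)"
  have "\<exists>c. \<forall>w\<in>R. \<Lambda>0 w = w + log_left k (- w) + c"
  proof (rule exp_eq_imp_diff_const[OF _ _ LR(3,4)])
    show "\<Lambda>0 holomorphic_on R" using \<Lambda>0(1) by (auto simp: R_def intro: holomorphic_on_subset)
    have "(log_left k \<circ> uminus) holomorphic_on R"
      by (rule holomorphic_on_compose_gen[OF _ log_left_holomorphic[OF k]])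
         (auto simp: R_def intro!: holomorphic_intros)
    then show "(\<lambda>w. w + log_left k (- w)) holomorphic_on R"
      by (auto simp: o_def intro!: holomorphic_intros)
    fix w assume "w \<in> R"
    then have w: "w \<in> strip k" "Re w > 0" by (auto simp: R_def)
    have "exp (\<Lambda>0 w) = exp (w + log_left k (- w)) * (\<Sum>i<k. exp (of_nat i * w)) / (\<Sum>i<k. exp (of_nat i * w))"
      unfolding \<Lambda>0(2)[OF w(1)] exp_log_right[OF k w(2)] h_def ..
    then show "exp (\<Lambda>0 w) = exp (w + log_left k (- w))" using nz(1)[OF w(1)] by simp
  qed
  then obtain d where d: "\<And>w. w \<in> R \<Longrightarrow> \<Lambda>0 w = w + log_left k (- w) + d" by blast
  have hol: "\<Lambda> holomorphic_on strip k" unfolding \<Lambda>_def by (intro holomorphic_intros \<Lambda>0)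
  have cont: "isCont \<Lambda>0 0"
    using \<Lambda>0(1) strip_open by (metis continuous_on_interior holomorphic_on_imp_continuous_on interior_open of_real_0 strip_of_real)
  have lim1: "((\<lambda>x. \<Lambda>0 (of_real x)) \<longlongrightarrow> \<Lambda>0 0) (at_right 0)"
    by (rule isCont_tendsto_compose[OF cont]) (auto intro!: tendsto_eq_intros)
  have lim2: "((\<lambda>x. \<Lambda>0 (- of_real x)) \<longlongrightarrow> \<Lambda>0 0) (at_right 0)"
    by (rule isCont_tendsto_compose[OF cont]) (auto intro!: tendsto_eq_intros)
  have "((\<lambda>x. \<Lambda>0 (of_real x) - of_real x - \<Lambda>0 (- of_real x)) \<longlongrightarrow> \<Lambda>0 0 - of_real 0 - \<Lambda>0 0) (at_right 0)"
    by (intro tendsto_diff lim1 lim2 tendsto_of_real tendsto_ident_at)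
  moreover have "\<forall>\<^sub>F x in at_right 0. \<Lambda>0 (of_real x) - of_real x - \<Lambda>0 (- of_real x) = d - c"
  proof (rule eventually_at_right_less[THEN eventually_mono])
    fix x :: real assume "0 < x"
    then have "complex_of_real x \<in> R" "- complex_of_real x \<in> L" by (auto simp: L_def R_def strip_def)
    then show "\<Lambda>0 (of_real x) - of_real x - \<Lambda>0 (- of_real x) = d - c"
      using c[of "- of_real x"] d[of "of_real x"] by simp
  qed
  ultimately have "\<Lambda>0 0 - of_real 0 - \<Lambda>0 0 = d - c"
    by (rule tendsto_const_eq) simp
  then have "c = d" by simp
  then show ?thesis using that[of \<Lambda>] hol c d by (auto simp: \<Lambda>_def L_def R_def)
qed

text \<open>The value - 2 phase_left k 0. It is forced by gluing at 0 the phase w^2 / 2 - phase_left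
  k (- w) on the right to a phase c + phase_left k w on the left.\<close>

definition phase_const :: "nat \<Rightarrow> real" where
  "phase_const k = - (pi\<^sup>2 / (3 * real k * (real k + 1)))"

lemma phase_left_0:
  assumes "k \<ge> 1"
  shows "phase_left k 0 = - of_real (phase_const k) / 2"
    "((\<lambda>x. phase_left k (- of_real x)) \<longlongrightarrow> phase_left k 0) (at_right 0)"
proof -
  have "phase_left k 0 = of_real (pi\<^sup>2 / 6 / real k - pi\<^sup>2 / 6 / (real k + 1))"
    by (simp add: phase_left_def dilog_1)
  also have "pi\<^sup>2 / 6 / real k - pi\<^sup>2 / 6 / (real k + 1) = - phase_const k / 2"
    using assms by (simp add: phase_const_def field_simps)
  finally show "phase_left k 0 = - of_real (phase_const k) / 2" by simp
  have *: "((\<lambda>x. dilog (exp (of_real a * (- of_real x)))) \<longlongrightarrow> dilog (exp (of_real a * 0))) (at_right 0)" if "a > 0" for a :: real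
  proof -
    have c: "continuous (at 1 within cball 0 1) dilog"
      using continuous_on_dilog by (simp add: continuous_on_eq_continuous_within)
    have "((\<lambda>x. exp (of_real a * (- of_real x)) :: complex) \<longlongrightarrow> exp (of_real a * (- of_real 0))) (at_right 0)"
      by (intro tendsto_intros)
    then have "((\<lambda>x. exp (of_real a * (- of_real x)) :: complex) \<longlongrightarrow> 1) (at_right 0)" by simp
    moreover have "\<forall>\<^sub>F x in at_right 0. exp (of_real a * (- of_real x)) \<in> cball (0::complex) 1"
      using that by (intro eventually_at_right_less[THEN eventually_mono]) simp
    ultimately have "((\<lambda>x. dilog (exp (of_real a * (- of_real x)))) \<longlongrightarrow> dilog 1) (at_right 0)"
      by (intro continuous_within_tendsto_compose[OF c])
    then show ?thesis by simp
  qed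
  show "((\<lambda>x. phase_left k (- of_real x)) \<longlongrightarrow> phase_left k 0) (at_right 0)"
    unfolding phase_left_def using assms
    by (intro tendsto_diff tendsto_divide tendsto_const *) (auto simp del: of_real_add)
qed

lemma phase_exists:
  assumes k: "k \<ge> 1"
  obtains \<Phi> \<Lambda> where "\<Lambda> holomorphic_on strip k"
    "\<And>w. w \<in> strip k \<Longrightarrow> (\<Phi> has_field_derivative \<Lambda> w) (at w)"
    "\<And>w. w \<in> strip k \<Longrightarrow> Re w < 0 \<Longrightarrow> \<Lambda> w = log_left k w"
    "\<And>w. w \<in> strip k \<Longrightarrow> Re w > 0 \<Longrightarrow> \<Lambda> w = w + log_left k (- w)"
    "\<And>w. w \<in> strip k \<Longrightarrow> Re w < 0 \<Longrightarrow> \<Phi> w = of_real (phase_const k) + phase_left k w"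
    "\<And>w. w \<in> strip k \<Longrightarrow> Re w > 0 \<Longrightarrow> \<Phi> w = w\<^sup>2 / 2 - phase_left k (- w)"
proof -
  obtain \<Lambda> where \<Lambda>: "\<Lambda> holomorphic_on strip k"
    "\<And>w. w \<in> strip k \<Longrightarrow> Re w < 0 \<Longrightarrow> \<Lambda> w = log_left k w"
    "\<And>w. w \<in> strip k \<Longrightarrow> Re w > 0 \<Longrightarrow> \<Lambda> w = w + log_left k (- w)"
    using log_exists[OF k] by blast
  obtain \<Phi>0 where \<Phi>0: "\<And>w. w \<in> strip k \<Longrightarrow> (\<Phi>0 has_field_derivative \<Lambda> w) (at w within strip k)"
    using holomorphic_convex_primitive'[OF strip_convex strip_open \<Lambda>(1)] by blast
  \<comment> \<open>The value at 0 is chosen so that no constant remains on the right, where \<Phi>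
    must match the Gaussian exponent w^2 / 2.\<close>
  define \<Phi> where "\<Phi> = (\<lambda>w. \<Phi>0 w - \<Phi>0 0 + of_real (phase_const k) / 2)"
  have d: "(\<Phi> has_field_derivative \<Lambda> w) (at w)" if "w \<in> strip k" for w
    unfolding \<Phi>_def using \<Phi>0[OF that] at_within_open[OF that strip_open]
    by (auto intro!: derivative_eq_intros)
  have cont: "isCont \<Phi> 0" using d[of 0] DERIV_isCont by (metis of_real_0 strip_of_real)
  have \<Phi>00: "\<Phi> 0 = of_real (phase_const k) / 2" by (simp add: \<Phi>_def)
  define L where "L = strip k \<inter> {w. Re w < 0}"
  define R where "R = strip k \<inter> {w. Re w > 0}"
  have LR: "convex L" "convex R"
    unfolding L_def R_def by (auto intro!: convex_Int strip_convex convex_halfplanes)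
  have "\<exists>c. \<forall>w\<in>L. \<Phi> w - phase_left k w = c"
  proof (rule has_field_derivative_zero_constant[OF LR(1)])
    fix w assume "w \<in> L"
    then have w: "w \<in> strip k" "Re w < 0" by (auto simp: L_def)
    show "((\<lambda>w. \<Phi> w - phase_left k w) has_field_derivative 0) (at w within L)"
      using DERIV_diff[OF d[OF w(1)] phase_left_has_derivative[OF k w(2)]] \<Lambda>(2)[OF w]
      by (auto intro: has_field_derivative_at_within)
  qed
  then obtain c where c: "\<And>w. w \<in> L \<Longrightarrow> \<Phi> w - phase_left k w = c" by blast
  have "\<exists>c. \<forall>w\<in>R. \<Phi> w - (w\<^sup>2 / 2 - phase_left k (- w)) = c"
  proof (rule has_field_derivative_zero_constant[OF LR(2)])
    fix w assume "w \<in> R"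
    then have w: "w \<in> strip k" "Re w > 0" by (auto simp: R_def)
    have "((\<lambda>w. phase_left k (- w)) has_field_derivative log_left k (- w) * (- 1)) (at w)"
      using w by (intro DERIV_chain2[OF phase_left_has_derivative[OF k]]) (auto intro!: derivative_eq_intros)
    then have "((\<lambda>w. \<Phi> w - (w\<^sup>2 / 2 - phase_left k (- w))) has_field_derivative
        \<Lambda> w - (w - log_left k (- w) * (- 1))) (at w)"
      by (intro DERIV_diff d w) (auto intro!: derivative_eq_intros)
    then show "((\<lambda>w. \<Phi> w - (w\<^sup>2 / 2 - phase_left k (- w))) has_field_derivative 0) (at w within R)"
      using \<Lambda>(3)[OF w] by (auto intro: has_field_derivative_at_within)
  qed
  then obtain e where e: "\<And>w. w \<in> R \<Longrightarrow> \<Phi> w - (w\<^sup>2 / 2 - phase_left k (- w)) = e" by blast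
  have "((\<lambda>x. \<Phi> (- of_real x)) \<longlongrightarrow> \<Phi> 0) (at_right 0)"
    by (rule isCont_tendsto_compose[OF cont]) (auto intro!: tendsto_eq_intros)
  then have "((\<lambda>x. \<Phi> (- of_real x) - phase_left k (- of_real x)) \<longlongrightarrow> \<Phi> 0 - phase_left k 0) (at_right 0)"
    by (intro tendsto_diff phase_left_0 k)
  moreover have "\<forall>\<^sub>F x in at_right 0. \<Phi> (- of_real x) - phase_left k (- of_real x) = c"
    by (rule eventually_at_right_less[THEN eventually_mono], rule c) (auto simp: L_def strip_def)
  ultimately have c': "\<Phi> 0 - phase_left k 0 = c"
    by (rule tendsto_const_eq) simp
  have "((\<lambda>x. \<Phi> (of_real x)) \<longlongrightarrow> \<Phi> 0) (at_right 0)"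
    by (rule isCont_tendsto_compose[OF cont]) (auto intro!: tendsto_eq_intros)
  then have "((\<lambda>x. \<Phi> (of_real x) - ((of_real x)\<^sup>2 / 2 - phase_left k (- of_real x))) \<longlongrightarrow> \<Phi> 0 - ((of_real 0)\<^sup>2 / 2 - phase_left k 0)) (at_right 0)"
    by (intro tendsto_diff phase_left_0 k tendsto_intros) auto
  moreover have "\<forall>\<^sub>F x in at_right 0. \<Phi> (of_real x) - ((of_real x)\<^sup>2 / 2 - phase_left k (- of_real x)) = e"
    by (rule eventually_at_right_less[THEN eventually_mono], rule e) (auto simp: R_def strip_def)
  ultimately have e': "\<Phi> 0 - ((of_real 0)\<^sup>2 / 2 - phase_left k 0) = e"
    by (rule tendsto_const_eq) simp
  have "c = of_real (phase_const k)" "e = 0"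
    using c' e' \<Phi>00 phase_left_0(1)[OF k] by auto
  then show ?thesis
    using c e by (intro that[of \<Lambda> \<Phi>] \<Lambda> d) (auto simp: L_def R_def algebra_simps)
qed

section \<open>The integrand in a strip\<close>

text \<open>Away from the imaginary axis the explicit formulas apply. Near it they are singular at 0
  although \<Lambda> is not, so compactness of a rectangle strictly inside the strip takes
  over.\<close>

lemma log_second_derivative_bound:
  assumes k: "k \<ge> 1" and hol: "\<Lambda> holomorphic_on strip k"
    and left: "\<And>w. w \<in> strip k \<Longrightarrow> Re w < 0 \<Longrightarrow> \<Lambda> w = log_left k w"
    and right: "\<And>w. w \<in> strip k \<Longrightarrow> Re w > 0 \<Longrightarrow> \<Lambda> w = w + log_left k (- w)"
    and y: "y < 2 * pi / (real k + 1)"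
  shows "\<exists>C\<ge>0. \<forall>w. \<bar>Im w\<bar> \<le> y \<longrightarrow> norm (deriv (deriv \<Lambda>) w) \<le> C / (1 + (Re w)\<^sup>2)"
proof -
  obtain D1 D2 where D: "\<And>w. Re w < 0 \<Longrightarrow> (log_left k has_field_derivative D1 w) (at w)"
    "\<And>w. Re w < 0 \<Longrightarrow> (D1 has_field_derivative D2 w) (at w)"
    "\<And>w. Re w < 0 \<Longrightarrow> norm (D2 w) \<le> 8 / (Re w)\<^sup>2"
    using log_left_derivs[OF k] by blast
  define L where "L = strip k \<inter> {w. Re w < 0}"
  define R where "R = strip k \<inter> {w. Re w > 0}"
  have LR: "open L" "open R" unfolding L_def R_def by (auto intro!: open_Int strip_open convex_halfplanes)
  have dL: "deriv \<Lambda> w = D1 w" if "w \<in> L" for w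
  proof (rule DERIV_imp_deriv, rule has_field_derivative_transform_within_open[OF _ LR(1) that])
    show "(log_left k has_field_derivative D1 w) (at w)" using D(1) that by (auto simp: L_def)
  qed (auto simp: L_def left)
  have ddL: "deriv (deriv \<Lambda>) w = D2 w" if "w \<in> L" for w
  proof (rule DERIV_imp_deriv, rule has_field_derivative_transform_within_open[OF _ LR(1) that])
    show "(D1 has_field_derivative D2 w) (at w)" using D(2) that by (auto simp: L_def)
  qed (auto simp: dL)
  have dR: "deriv \<Lambda> w = 1 - D1 (- w)" if "w \<in> R" for w
  proof (rule DERIV_imp_deriv, rule has_field_derivative_transform_within_open[OF _ LR(2) that])
    have "((\<lambda>w. log_left k (- w)) has_field_derivative D1 (- w) * (- 1)) (at w)"
      using that by (intro DERIV_chain2[OF D(1)]) (auto intro!: derivative_eq_intros simp: R_def)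
    then show "((\<lambda>w. w + log_left k (- w)) has_field_derivative 1 - D1 (- w)) (at w)"
      by (auto intro!: derivative_eq_intros)
  qed (auto simp: R_def right)
  have ddR: "deriv (deriv \<Lambda>) w = D2 (- w)" if "w \<in> R" for w
  proof (rule DERIV_imp_deriv, rule has_field_derivative_transform_within_open[OF _ LR(2) that])
    have "((\<lambda>w. D1 (- w)) has_field_derivative D2 (- w) * (- 1)) (at w)"
      using that by (intro DERIV_chain2[OF D(2)]) (auto intro!: derivative_eq_intros simp: R_def)
    then show "((\<lambda>w. 1 - D1 (- w)) has_field_derivative D2 (- w)) (at w)"
      by (auto intro!: derivative_eq_intros)
  qed (auto simp: dR)
  have far: "norm (deriv (deriv \<Lambda>) w) \<le> 8 / (Re w)\<^sup>2" if "\<bar>Im w\<bar> \<le> y" "Re w \<noteq> 0" for w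
  proof (cases "Re w < 0")
    case True
    then show ?thesis using ddL[of w] D(3)[of w] that y by (auto simp: L_def strip_def)
  next
    case False
    then show ?thesis using ddR[of w] D(3)[of "- w"] that y by (auto simp: R_def strip_def)
  qed
  define K where "K = cbox (Complex (-1) (-y)) (Complex 1 y)"
  have K: "w \<in> K \<longleftrightarrow> \<bar>Re w\<bar> \<le> 1 \<and> \<bar>Im w\<bar> \<le> y" for w
    by (auto simp: K_def in_cbox_complex_iff abs_le_iff)
  have "K \<subseteq> strip k" using y by (auto simp: K strip_def)
  moreover have "deriv (deriv \<Lambda>) holomorphic_on strip k"
    by (intro holomorphic_deriv hol strip_open)
  ultimately have "continuous_on K (deriv (deriv \<Lambda>))"
    using holomorphic_on_imp_continuous_on continuous_on_subset by blast
  then have "compact (deriv (deriv \<Lambda>) ` K)"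
    by (rule compact_continuous_image) (simp add: K_def)
  then have "bounded (deriv (deriv \<Lambda>) ` K)" by (rule compact_imp_bounded)
  then obtain B where B: "\<And>w. w \<in> K \<Longrightarrow> norm (deriv (deriv \<Lambda>) w) \<le> B"
    unfolding bounded_iff by (metis imageI)
  define C where "C = max 16 (2 * B)"
  have "norm (deriv (deriv \<Lambda>) w) \<le> C / (1 + (Re w)\<^sup>2)" if w: "\<bar>Im w\<bar> \<le> y" for w
  proof (cases "\<bar>Re w\<bar> \<le> 1")
    case True
    then have "(Re w)\<^sup>2 \<le> 1" by (simp add: abs_square_le_1)
    have C: "2 * norm (deriv (deriv \<Lambda>) w) \<le> C" using B[of w] True w by (simp add: K C_def)
    have "norm (deriv (deriv \<Lambda>) w) * (1 + (Re w)\<^sup>2) \<le> norm (deriv (deriv \<Lambda>) w) * 2"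
      using \<open>(Re w)\<^sup>2 \<le> 1\<close> by (intro mult_left_mono) auto
    also have "\<dots> \<le> C" using C by simp
    finally show ?thesis by (simp add: pos_le_divide_eq add_pos_nonneg)
  next
    case False
    then have 1: "1 \<le> (Re w)\<^sup>2" using abs_square_le_1[of "Re w"] by linarith
    then have "Re w \<noteq> 0" by auto
    then have "norm (deriv (deriv \<Lambda>) w) \<le> 8 / (Re w)\<^sup>2" using far w by blast
    also have "\<dots> = 16 / (2 * (Re w)\<^sup>2)" by simp
    also have "\<dots> \<le> 16 / (1 + (Re w)\<^sup>2)" using 1 by (intro divide_left_mono) (auto intro!: mult_pos_pos add_pos_nonneg)
    also have "\<dots> \<le> C / (1 + (Re w)\<^sup>2)" by (intro divide_right_mono) (auto simp: C_def)
    finally show ?thesis .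
  qed
  then show ?thesis by (intro exI[of _ C]) (auto simp: C_def)
qed

text \<open>The midpoint rule: in the difference of \<Phi> at m + s / 2 and m - s / 2 the even
  Taylor terms cancel, leaving \<Lambda> m times s and a cubic remainder controlled by the second
  derivative of \<Lambda>.\<close>

lemma midpoint_error:
  assumes hol: "\<Lambda> holomorphic_on strip k"
    and d: "\<And>w. w \<in> strip k \<Longrightarrow> (\<Phi> has_field_derivative \<Lambda> w) (at w)"
    and y: "y < 2 * pi / (real k + 1)"
    and C: "C \<ge> 0" "\<And>w. \<bar>Im w\<bar> \<le> y \<Longrightarrow> norm (deriv (deriv \<Lambda>) w) \<le> C / (1 + (Re w)\<^sup>2)"
    and s: "0 < s" "s \<le> 1" and m: "\<bar>Im m\<bar> \<le> y"
  shows "norm (\<Lambda> m - (\<Phi> (m + of_real (s / 2)) - \<Phi> (m - of_real (s / 2))) / of_real s) \<le> C * s\<^sup>2 / (1 + (Re m)\<^sup>2)"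
proof -
  \<comment> \<open>On this segment 1 + (Re x)^2 is at least half of 1 + (Re m)^2, so the bound at
    the centre serves throughout; s <= 1 keeps both evaluation points inside.\<close>
  define S where "S = cbox (Complex (Re m - 1/2) (Im m)) (Complex (Re m + 1/2) (Im m))"
  have S: "w \<in> S \<longleftrightarrow> \<bar>Re w - Re m\<bar> \<le> 1 / 2 \<and> Im w = Im m" for w
    unfolding S_def in_cbox_complex_iff abs_le_iff complex.sel atLeastAtMost_iff by linarith
  define f where "f = (\<lambda>i::nat. if i = 0 then \<Phi> else (deriv ^^ (i - 1)) \<Lambda>)"
  have f: "(f i has_field_derivative f (Suc i) x) (at x within S)" if "x \<in> S" for i x
  proof -
    have x: "x \<in> strip k" using that m y by (auto simp: S strip_def)
    show ?thesis
    proof (cases i)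
      case 0
      then show ?thesis using d[OF x] by (simp add: f_def has_field_derivative_at_within)
    next
      case (Suc j)
      have "(deriv ^^ j) \<Lambda> holomorphic_on strip k" by (intro holomorphic_higher_deriv hol strip_open)
      then show ?thesis using holomorphic_derivI[OF _ strip_open x] Suc
        by (simp add: f_def has_field_derivative_at_within)
    qed
  qed
  define B where "B = 2 * C / (1 + (Re m)\<^sup>2)"
  have B: "norm (f (Suc 2) x) \<le> B" if "x \<in> S" for x
  proof -
    have x: "\<bar>Im x\<bar> \<le> y" "\<bar>Re x - Re m\<bar> \<le> 1 / 2" using that m by (auto simp: S)
    have "(Re m - 2 * (Re x - Re m))\<^sup>2 \<ge> 0" by simp
    have "1 + (Re m)\<^sup>2 \<le> 2 * (1 + (Re x)\<^sup>2)"
    proof -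
      have "(Re x - Re m)\<^sup>2 \<le> (1/2)\<^sup>2" using x(2) by (simp add: abs_le_square_iff[symmetric])
      moreover have "0 \<le> (2 * Re x - Re m)\<^sup>2" by simp
      ultimately show ?thesis by (simp add: power2_eq_square algebra_simps)
    qed
    then have "C * (1 + (Re m)\<^sup>2) \<le> C * (2 * (1 + (Re x)\<^sup>2))" using C by (intro mult_left_mono) auto
    moreover have "0 < 1 + (Re m)\<^sup>2" "0 < 1 + (Re x)\<^sup>2" by (auto intro: add_pos_nonneg)
    ultimately have "C / (1 + (Re x)\<^sup>2) \<le> B" unfolding B_def by (simp add: field_simps)
    then show ?thesis using C(2)[OF x(1)] by (simp add: f_def numeral_2_eq_2)
  qed
  have mS: "m \<in> S" "m + of_real (s/2) \<in> S" "m - of_real (s/2) \<in> S" using s by (auto simp: S)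
  have conv: "convex S" by (simp add: S_def)
  have T: "norm (f 0 z - (\<Sum>i\<le>2. f i m * (z - m) ^ i / fact i)) \<le> B * norm (z - m) ^ Suc 2 / fact 2" if "z \<in> S" for z
    by (rule complex_Taylor[OF conv f B mS(1) that])
  have E: "(\<Sum>i\<le>2. f i m * (z - m) ^ i / fact i) = \<Phi> m + \<Lambda> m * (z - m) + deriv \<Lambda> m * (z - m)\<^sup>2 / 2" for z
    by (simp add: f_def numeral_2_eq_2)
  have f0: "f 0 = \<Phi>" by (simp add: f_def)
  have 1: "norm (\<Phi> (m + of_real (s/2)) - (\<Phi> m + \<Lambda> m * of_real (s/2) + deriv \<Lambda> m * (of_real (s/2))\<^sup>2 / 2)) \<le> B * (s/2) ^ 3 / 2"
    using T[OF mS(2)] s unfolding E f0 by (simp add: norm_power numeral_3_eq_3 numeral_2_eq_2)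
  have 2: "norm (\<Phi> (m - of_real (s/2)) - (\<Phi> m - \<Lambda> m * of_real (s/2) + deriv \<Lambda> m * (of_real (s/2))\<^sup>2 / 2)) \<le> B * (s/2) ^ 3 / 2"
    using T[OF mS(3)] s unfolding E f0 by (simp add: norm_power numeral_3_eq_3 numeral_2_eq_2)
  have "norm (\<Phi> (m + of_real (s/2)) - \<Phi> (m - of_real (s/2)) - \<Lambda> m * of_real s) \<le> B * (s/2) ^ 3 / 2 + B * (s/2) ^ 3 / 2"
    using norm_triangle_le_diff[OF add_mono[OF 1 2]] by (simp add: algebra_simps)
  also have "\<dots> = C * s\<^sup>2 / (1 + (Re m)\<^sup>2) * s / 4"
  proof -
    have "2 * C / D * (s/2) ^ 3 / 2 + 2 * C / D * (s/2) ^ 3 / 2 = C * s\<^sup>2 / D * s / 4" if "D \<noteq> 0" for D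
      using that by (simp add: power3_eq_cube power2_eq_square field_simps)
    moreover have "1 + (Re m)\<^sup>2 \<noteq> 0" by (metis add_pos_nonneg less_irrefl zero_le_power2 zero_less_one)
    ultimately show ?thesis unfolding B_def by blast
  qed
  also have "\<dots> \<le> C * s\<^sup>2 / (1 + (Re m)\<^sup>2) * s"
  proof -
    have "x / 4 \<le> x" if "0 \<le> x" for x :: real using that by simp
    moreover have "0 \<le> C * s\<^sup>2 / (1 + (Re m)\<^sup>2) * s"
      using C(1) s by (intro mult_nonneg_nonneg divide_nonneg_nonneg add_nonneg_nonneg) auto
    ultimately show ?thesis by blast
  qed
  finally have 3: "norm (\<Phi> (m + of_real (s/2)) - \<Phi> (m - of_real (s/2)) - \<Lambda> m * of_real s) \<le> C * s\<^sup>2 / (1 + (Re m)\<^sup>2) * s" .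
  have "\<Lambda> m - (\<Phi> (m + of_real (s / 2)) - \<Phi> (m - of_real (s / 2))) / of_real s
     = - ((\<Phi> (m + of_real (s/2)) - \<Phi> (m - of_real (s/2)) - \<Lambda> m * of_real s) / of_real s)"
    using s by (simp add: field_simps)
  also have "norm \<dots> = norm (\<Phi> (m + of_real (s/2)) - \<Phi> (m - of_real (s/2)) - \<Lambda> m * of_real s) / s"
    using s by (simp only: norm_minus_cancel norm_divide norm_of_real abs_of_pos)
  also have "\<dots> \<le> C * s\<^sup>2 / (1 + (Re m)\<^sup>2)" using 3 s by (simp add: pos_divide_le_eq)
  finally show ?thesis .
qed

text \<open>A Riemann sum of the derivative of arctan. Each term is at most twice an arctan
  increment, so the bound is uniform in \<open>x\<close>, \<open>s\<close> and
  \<open>M\<close>.\<close>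

lemma sum_inverse_one_plus_square:
  fixes x s :: real
  assumes s: "0 < s" "s \<le> 1"
  shows "(\<Sum>j<M. s / (1 + (x + (real j + 1/2) * s)\<^sup>2)) \<le> 2 * pi"
proof -
  have st: "s / (1 + (x + (real j + 1/2) * s)\<^sup>2) \<le> 2 * (arctan (x + real (Suc j) * s) - arctan (x + real j * s))" for j
  proof -
    have "x + real j * s < x + real (Suc j) * s" using s by simp
    then obtain \<xi> where \<xi>: "x + real j * s < \<xi>" "\<xi> < x + real (Suc j) * s"
      "arctan (x + real (Suc j) * s) - arctan (x + real j * s) = (x + real (Suc j) * s - (x + real j * s)) * inverse (1 + \<xi>\<^sup>2)"
      using MVT2[of _ _ arctan "\<lambda>x. inverse (1 + x\<^sup>2)"] DERIV_arctan by blast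
    let ?m = "x + (real j + 1/2) * s"
    have "(\<xi> - ?m)\<^sup>2 \<le> (1/2)\<^sup>2"
    proof -
      have "?m = x + real j * s + s / 2" "x + real (Suc j) * s = x + real j * s + s"
        by (simp_all add: algebra_simps)
      then have "\<bar>\<xi> - ?m\<bar> \<le> 1/2" using \<xi>(1,2) s unfolding abs_le_iff by linarith
      then show ?thesis by (simp add: abs_le_square_iff[symmetric])
    qed
    moreover have "0 \<le> (2 * ?m - \<xi>)\<^sup>2" by simp
    ultimately have "1 + \<xi>\<^sup>2 \<le> 2 * (1 + ?m\<^sup>2)" by (simp only: power2_eq_square) (simp add: algebra_simps)
    then have "s / (2 * (1 + ?m\<^sup>2)) \<le> s / (1 + \<xi>\<^sup>2)"
      using s by (intro divide_left_mono) (auto intro!: mult_pos_pos add_pos_nonneg)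
    moreover have "arctan (x + real (Suc j) * s) - arctan (x + real j * s) = s / (1 + \<xi>\<^sup>2)"
      unfolding \<xi>(3) by (simp add: divide_inverse algebra_simps)
    moreover have "s / a = 2 * (s / (2 * a))" for a by simp
    note this[of "1 + ?m\<^sup>2"]
    ultimately show ?thesis by (metis mult_left_mono zero_le_numeral)
  qed
  have "(\<Sum>j<M. s / (1 + (x + (real j + 1/2) * s)\<^sup>2)) \<le> (\<Sum>j<M. 2 * (arctan (x + real (Suc j) * s) - arctan (x + real j * s)))"
    by (intro sum_mono st)
  also have "\<dots> = 2 * (arctan (x + real M * s) - arctan x)"
    unfolding sum_distrib_left[symmetric] using sum_lessThan_telescope[of "\<lambda>j. arctan (x + real j * s)" M] by simp
  also have "\<dots> \<le> 2 * pi" using arctan_bounded[of "x + real M * s"] arctan_bounded[of x] by simp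
  finally show ?thesis .
qed

lemma norm_exp_minus_1_le: "norm (exp z - 1) \<le> norm z * exp (norm (z::complex))"
proof -
  have "norm (exp z - exp 0) \<le> exp (norm z) * norm (z - 0)"
  proof (rule field_differentiable_bound[of "cball 0 (norm z)" exp exp])
    show "(exp has_field_derivative exp x) (at x within cball 0 (norm z))" for x :: complex
      by (rule DERIV_exp[THEN has_field_derivative_at_within])
    fix x :: complex assume "x \<in> cball 0 (norm z)"
    then have "exp (norm x) \<le> exp (norm z)" by simp
    then show "norm (exp x) \<le> exp (norm z)" using norm_exp[of x] by (rule order_trans[rotated])
  qed auto
  then show ?thesis by (simp add: mult.commute)
qed

section \<open>Functional equation and continuation of the integrand\<close>

lemma gap_int_shift:
  assumes k: "k \<ge> 1" and s: "s > 0" and w: "Re w > - s / 2"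
  shows "gap_int k s (w + of_real s) = gap_int k s w * exp ((w + of_real (s/2)) + log_left k (- (w + of_real (s/2))))"
proof -
  define u where "u = w + of_real (s/2)"
  define z where "z = exp (- u)"
  have u: "Re u > 0" using w by (simp add: u_def)
  have z: "norm z < 1" using u by (simp add: z_def)
  have qz: "exp (- (w + of_real s) - of_real (s/2)) = of_real (exp (- s)) * z"
    by (simp add: z_def u_def exp_of_real[symmetric] exp_add[symmetric] algebra_simps)
  have zz: "exp (- w - of_real (s/2)) = z" by (simp add: z_def u_def)
  \<comment> \<open>The Gaussian exponent grows by w + s / 2 over one step, which supplies the
    summand u that \<open>log_left\<close> at - u lacks on the right half-plane.\<close>
  have e: "exp ((w + of_real s)\<^sup>2 / of_real (2 * s)) = exp (w\<^sup>2 / of_real (2 * s)) * exp u"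
    using s by (simp add: u_def exp_add[symmetric] power2_eq_square field_simps)
  have zn: "exp (of_real (real n) * (- u)) = z ^ n" for n
    by (simp add: z_def exp_of_nat_mult[symmetric])
  have zn1: "exp (of_real (real k + 1) * (- u)) = z ^ (k + 1)"
    using zn[of "k + 1"] by (simp only: of_nat_add of_nat_1)
  have nz: "1 - z ^ (k + 1) \<noteq> 0" "1 - z ^ k \<noteq> 0"
    unfolding zn[symmetric, of k] zn1[symmetric] using u k by (intro one_minus_exp_notin; simp)+
  have "exp (log_left k (- u)) = (1 - z ^ (k + 1)) / (1 - z ^ k)"
    unfolding log_left_def zn zn1 exp_diff using nz by simp
  moreover have "gap_fun k (exp (- s)) (of_real (exp (- s)) * z) = gap_fun k (exp (- s)) z * (1 - z ^ (k + 1)) / (1 - z ^ k)"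
  proof -
    have q1: "exp (- s) < 1" using s by simp
    show ?thesis unfolding gap_fun_eq[OF exp_gt_zero q1 k z] using nz by simp
  qed
  ultimately show ?thesis unfolding gap_int_def qz zz e u_def[symmetric] exp_add by simp
qed

text \<open>The continuation of \<open>gap_int\<close> to \<open>Re w > - (N + 1 / 2) * s\<close> through its functional equation.\<close>
definition gap_ext :: "nat \<Rightarrow> real \<Rightarrow> (complex \<Rightarrow> complex) \<Rightarrow> nat \<Rightarrow> complex \<Rightarrow> complex" where
  "gap_ext k s \<Lambda> N w = gap_int k s (w + of_real (real N * s)) * exp (- (\<Sum>j<N. \<Lambda> (w + of_real ((real j + 1/2) * s))))"

lemma strip_add_of_real [simp]: "w + complex_of_real x \<in> strip k \<longleftrightarrow> w \<in> strip k"
  by (simp add: strip_def)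

lemma gap_int_iterate:
  assumes k: "k \<ge> 1" and s: "s > 0" and w: "Re w > - s / 2" "w \<in> strip k"
    and right: "\<And>w. w \<in> strip k \<Longrightarrow> Re w > 0 \<Longrightarrow> \<Lambda> w = w + log_left k (- w)"
  shows "gap_int k s (w + of_real (real N * s)) = gap_int k s w * exp (\<Sum>j<N. \<Lambda> (w + of_real ((real j + 1/2) * s)))"
proof (induction N)
  case (Suc N)
  have Ns: "0 \<le> real N * s" using s by simp
  let ?w = "w + of_real (real N * s)"
  have "w + of_real (real (Suc N) * s) = ?w + of_real s" by (simp add: algebra_simps)
  also have "gap_int k s \<dots> = gap_int k s ?w * exp ((?w + of_real (s/2)) + log_left k (- (?w + of_real (s/2))))"
    using w Ns by (intro gap_int_shift k s) (simp add: algebra_simps)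
  also have "(?w + of_real (s/2)) + log_left k (- (?w + of_real (s/2))) = \<Lambda> (?w + of_real (s/2))"
  proof (rule right[symmetric])
    show "?w + of_real (s/2) \<in> strip k" using w(2) by (simp only: strip_add_of_real)
    show "Re (?w + of_real (s/2)) > 0" using w(1) Ns by simp
  qed
  also have "?w + of_real (s/2) = w + of_real ((real N + 1/2) * s)" by (simp add: algebra_simps)
  finally show ?case using Suc by (simp add: exp_add)
qed simp

lemma gap_ext_eq:
  assumes k: "k \<ge> 1" and s: "s > 0" and w: "Re w > - s / 2" "w \<in> strip k"
    and right: "\<And>w. w \<in> strip k \<Longrightarrow> Re w > 0 \<Longrightarrow> \<Lambda> w = w + log_left k (- w)"
  shows "gap_ext k s \<Lambda> N w = gap_int k s w"
proof -
  have "gap_int k s (w + of_real (real N * s)) = gap_int k s w * exp (\<Sum>j<N. \<Lambda> (w + of_real ((real j + 1/2) * s)))"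
    by (rule gap_int_iterate[OF assms])
  then show ?thesis by (simp only: gap_ext_def mult.assoc exp_minus_inverse mult_1_right)
qed

text \<open>Extra steps beyond the half-plane of \<open>gap_int\<close> change nothing, so the
  number of steps can be sent to infinity.\<close>

lemma gap_ext_add:
  assumes k: "k \<ge> 1" and s: "s > 0" and w: "Re w + real N * s > - s / 2" "w \<in> strip k"
    and right: "\<And>w. w \<in> strip k \<Longrightarrow> Re w > 0 \<Longrightarrow> \<Lambda> w = w + log_left k (- w)"
  shows "gap_ext k s \<Lambda> (N + M) w = gap_ext k s \<Lambda> N w"
proof -
  let ?w = "w + of_real (real N * s)" and ?t = "\<lambda>j. \<Lambda> (w + of_real ((real j + 1/2) * s))"
  have "w + of_real (real (N + M) * s) = ?w + of_real (real M * s)" by (simp add: algebra_simps)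
  also have "gap_int k s \<dots> = gap_int k s ?w * exp (\<Sum>j<M. \<Lambda> (?w + of_real ((real j + 1/2) * s)))"
    using w by (intro gap_int_iterate k s right) (auto simp del: of_real_mult)
  also have "(\<Sum>j<M. \<Lambda> (?w + of_real ((real j + 1/2) * s))) = (\<Sum>j<M. ?t (j + N))"
    by (intro sum.cong refl arg_cong[of _ _ \<Lambda>]) (simp add: algebra_simps)
  also have "\<dots> = (\<Sum>j\<in>{N..<N+M}. ?t j)"
    using sum.shift_bounds_nat_ivl[of ?t 0 N M] by (simp add: atLeast0LessThan add.commute)
  finally have 1: "gap_int k s (w + of_real (real (N + M) * s)) = gap_int k s ?w * exp (\<Sum>j\<in>{N..<N+M}. ?t j)" .
  have "(\<Sum>j<N+M. ?t j) = (\<Sum>j<N. ?t j) + (\<Sum>j\<in>{N..<N+M}. ?t j)"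
    using sum.atLeastLessThan_concat[of 0 N "N+M" ?t] by (simp add: atLeast0LessThan)
  moreover have "exp Y * exp (- (X + Y)) = exp (- X)" for X Y :: complex by (simp add: exp_add[symmetric])
  ultimately show ?thesis unfolding gap_ext_def 1 by (simp only: mult.assoc)
qed

lemma gap_int_holomorphic:
  assumes k: "k \<ge> 1" and s: "s > 0"
  shows "gap_int k s holomorphic_on {w. Re w > - s / 2}"
proof -
  have "gap_fun k (exp (- s)) holomorphic_on ball 0 1" using s k by (intro gap_fun_holomorphic) auto
  then have "(gap_fun k (exp (- s)) \<circ> (\<lambda>w. exp (- w - of_real (s / 2)))) holomorphic_on {w. Re w > - s / 2}"
    by (rule holomorphic_on_compose_gen[rotated]) (auto intro!: holomorphic_intros)
  then show ?thesis unfolding gap_int_def[abs_def] o_def using s by (intro holomorphic_intros) auto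
qed

lemma gap_ext_holomorphic:
  assumes k: "k \<ge> 1" and s: "s > 0" and hol: "\<Lambda> holomorphic_on strip k"
  shows "gap_ext k s \<Lambda> N holomorphic_on (strip k \<inter> {w. Re w > - s / 2 - real N * s})" (is "_ holomorphic_on ?A")
proof -
  have "(gap_int k s \<circ> (\<lambda>w. w + of_real (real N * s))) holomorphic_on ?A"
    by (rule holomorphic_on_compose_gen[OF _ gap_int_holomorphic[OF k s]]) (auto intro!: holomorphic_intros)
  moreover have "(\<Lambda> \<circ> (\<lambda>w. w + of_real ((real j + 1/2) * s))) holomorphic_on ?A" for j
    by (rule holomorphic_on_compose_gen[OF _ hol]) (auto intro!: holomorphic_intros simp del: of_real_mult)
  ultimately show ?thesis unfolding gap_ext_def[abs_def] o_def by (intro holomorphic_intros)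
qed

text \<open>At + infinity the argument of \<open>gap_fun\<close> and both dilogarithms tend to 0,
  and the Gaussian cancels against w^2 / 2. This fixes the constant that a difference equation
  leaves open.\<close>

lemma gap_int_normalised_tendsto:
  assumes k: "k \<ge> 1" and s: "s > 0" and w: "w \<in> strip k"
    and \<Phi>: "\<And>w. w \<in> strip k \<Longrightarrow> Re w > 0 \<Longrightarrow> \<Phi> w = w\<^sup>2 / 2 - phase_left k (- w)"
  shows "(\<lambda>M. gap_int k s (w + of_real (real M * s)) * exp (- \<Phi> (w + of_real (real M * s)) / of_real s)) \<longlonglongrightarrow> 1"
proof -
  let ?w = "\<lambda>M. w + of_real (real M * s)"
  define z where "z = (\<lambda>M. exp (- ?w M))"
  have "filterlim (\<lambda>M. real M * s) at_top sequentially"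
    using s by (intro filterlim_at_top_mult_tendsto_pos[OF tendsto_const _ filterlim_real_sequentially])
       (auto simp: mult.commute filterlim_real_sequentially)
  then have lim: "filterlim (\<lambda>M. Re w + real M * s) at_top sequentially"
    by (rule filterlim_tendsto_add_at_top[OF tendsto_const])
  have "(\<lambda>M. exp (- (Re w + real M * s))) \<longlonglongrightarrow> 0"
    using lim by (intro filterlim_compose[OF exp_at_bot] filterlim_compose[OF filterlim_uminus_at_bot_at_top])
  then have z0: "z \<longlonglongrightarrow> 0" unfolding z_def by - (rule tendsto_norm_zero_cancel, simp)
  have contB: "isCont (gap_fun k (exp (- s))) 0"
    using gap_fun_holomorphic[of "exp (- s)" k] s k
    by (intro continuous_on_interior[OF holomorphic_on_imp_continuous_on]) auto
  have contD: "isCont dilog 0"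
    using continuous_on_interior[OF continuous_on_dilog] by simp
  have B: "(\<lambda>M. gap_fun k (exp (- s)) (z M * exp (- of_real (s/2)))) \<longlonglongrightarrow> 1"
  proof -
    have "(\<lambda>M. gap_fun k (exp (- s)) (z M * exp (- of_real (s/2)))) \<longlonglongrightarrow> gap_fun k (exp (- s)) 0"
      by (rule isCont_tendsto_compose[OF contB]) (use z0 in \<open>auto intro!: tendsto_eq_intros\<close>)
    then show ?thesis by simp
  qed
  have d0: "dilog 0 = 0" using norm_dilog_le(1)[of 0] by simp
  have zn: "exp (of_real (real n) * (- ?w M)) = z M ^ n" for n M
    unfolding z_def by (simp only: exp_of_nat_mult[symmetric] of_real_of_nat_eq)
  have zn1: "exp (of_real (real k + 1) * (- ?w M)) = z M ^ (k + 1)" for M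
    using zn[of "k + 1"] by (simp only: of_nat_add of_nat_1)
  have P: "(\<lambda>M. phase_left k (- ?w M)) \<longlonglongrightarrow> 0"
  proof -
    have "(\<lambda>M. dilog (z M ^ k) / of_real (real k) - dilog (z M ^ (k + 1)) / of_real (real k + 1)) \<longlonglongrightarrow>
       dilog (0 ^ k) / of_real (real k) - dilog (0 ^ (k + 1)) / of_real (real k + 1)"
    proof (intro tendsto_diff tendsto_divide tendsto_const)
      show "(\<lambda>M. dilog (z M ^ k)) \<longlonglongrightarrow> dilog (0 ^ k)"
        using k contD by (intro isCont_tendsto_compose[of _ dilog] tendsto_power z0) (auto simp: power_0_left)
      show "(\<lambda>M. dilog (z M ^ (k + 1))) \<longlonglongrightarrow> dilog (0 ^ (k + 1))"
        using k contD by (intro isCont_tendsto_compose[of _ dilog] tendsto_power z0) (auto simp: power_0_left)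
    qed (use k in \<open>auto simp del: of_real_add\<close>)
    then show ?thesis unfolding phase_left_def zn zn1 using k d0 by (simp add: power_0_left)
  qed
  have "(\<lambda>M. gap_fun k (exp (- s)) (z M * exp (- of_real (s/2))) * exp (phase_left k (- ?w M) / of_real s)) \<longlonglongrightarrow> 1 * exp (0 / of_real s)"
    using s by (intro tendsto_mult B tendsto_exp tendsto_divide P tendsto_const) auto
  then have L: "(\<lambda>M. gap_fun k (exp (- s)) (z M * exp (- of_real (s/2))) * exp (phase_left k (- ?w M) / of_real s)) \<longlonglongrightarrow> 1" by simp
  have "\<forall>\<^sub>F M in sequentially. Re w + real M * s > 0"
    using lim by (simp add: filterlim_at_top_dense)
  then have ev: "\<forall>\<^sub>F M in sequentially. gap_int k s (?w M) * exp (- \<Phi> (?w M) / of_real s)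
     = gap_fun k (exp (- s)) (z M * exp (- of_real (s/2))) * exp (phase_left k (- ?w M) / of_real s)"
  proof eventually_elim
    case (elim M)
    have \<Phi>M: "\<Phi> (?w M) = (?w M)\<^sup>2 / 2 - phase_left k (- ?w M)" using elim w by (intro \<Phi>) (auto simp del: of_real_mult)
    have "exp (- ?w M - of_real (s / 2)) = z M * exp (- of_real (s/2))" by (simp add: z_def exp_add[symmetric])
    moreover have "exp ((?w M)\<^sup>2 / of_real (2 * s)) * exp (- ((?w M)\<^sup>2 / 2 - phase_left k (- ?w M)) / of_real s)
        = exp (phase_left k (- ?w M) / of_real s)"
      unfolding exp_add[symmetric] using s by (intro arg_cong[of _ _ exp]) (simp add: field_simps)
    ultimately show ?case unfolding gap_int_def \<Phi>M by (simp only: mult_ac)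
  qed
  show ?thesis using L by (rule Lim_transform_eventually) (use ev in \<open>simp add: eq_commute\<close>)
qed

text \<open>Over each step of length s, the logarithm of the integrand and \<Phi> / s differ in
  their increment by the midpoint error, at most C s^2 / (1 + x^2). Summed over all steps to +
  infinity, where the quotient tends to 1, this is O(s), uniformly in \<open>N\<close> and in the
  height up to y.\<close>

theorem gap_ext_asymp:
  assumes k: "k \<ge> 1" and hol: "\<Lambda> holomorphic_on strip k"
    and d: "\<And>w. w \<in> strip k \<Longrightarrow> (\<Phi> has_field_derivative \<Lambda> w) (at w)"
    and left: "\<And>w. w \<in> strip k \<Longrightarrow> Re w < 0 \<Longrightarrow> \<Lambda> w = log_left k w"
    and right: "\<And>w. w \<in> strip k \<Longrightarrow> Re w > 0 \<Longrightarrow> \<Lambda> w = w + log_left k (- w)"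
    and \<Phi>: "\<And>w. w \<in> strip k \<Longrightarrow> Re w > 0 \<Longrightarrow> \<Phi> w = w\<^sup>2 / 2 - phase_left k (- w)"
    and y: "y < 2 * pi / (real k + 1)"
  shows "\<exists>K\<ge>0. \<forall>s N w. 0 < s \<longrightarrow> s \<le> 1 \<longrightarrow> \<bar>Im w\<bar> \<le> y \<longrightarrow> Re w + real N * s > - s / 2 \<longrightarrow>
     norm (gap_ext k s \<Lambda> N w * exp (- \<Phi> w / of_real s) - 1) \<le> K * s"
proof -
  obtain C where C: "C \<ge> 0" "\<And>w. \<bar>Im w\<bar> \<le> y \<Longrightarrow> norm (deriv (deriv \<Lambda>) w) \<le> C / (1 + (Re w)\<^sup>2)"
    using log_second_derivative_bound[OF k hol left right y] by blast
  define K where "K = C * (2 * pi)"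
  have K0: "K \<ge> 0" using C by (simp add: K_def)
  have main: "norm (gap_ext k s \<Lambda> N w * exp (- \<Phi> w / of_real s) - 1) \<le> K * exp K * s"
    if s: "0 < s" "s \<le> 1" and im: "\<bar>Im w\<bar> \<le> y" and re: "Re w + real N * s > - s / 2" for s N w
  proof -
    have w: "w \<in> strip k" using im y by (simp add: strip_def)
    let ?m = "\<lambda>j. w + of_real ((real j + 1/2) * s)" and ?w = "\<lambda>M. w + of_real (real M * s)"
    let ?\<tau> = "\<lambda>j. \<Lambda> (?m j) - (\<Phi> (?w (Suc j)) - \<Phi> (?w j)) / of_real s"
    have \<tau>: "norm (?\<tau> j) \<le> C * s * (s / (1 + (Re w + (real j + 1/2) * s)\<^sup>2))" for j
    proof -
      have "norm (\<Lambda> (?m j) - (\<Phi> (?m j + of_real (s / 2)) - \<Phi> (?m j - of_real (s / 2))) / of_real s) \<le> C * s\<^sup>2 / (1 + (Re (?m j))\<^sup>2)"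
        using im by (intro midpoint_error[OF hol d y C s]) auto
      also have "?m j + of_real (s/2) = ?w (Suc j)" by (simp add: algebra_simps)
      also have "?m j - of_real (s/2) = ?w j" by (simp add: algebra_simps)
      finally show ?thesis by (simp add: power2_eq_square mult.assoc)
    qed
    have sum\<tau>: "norm (\<Sum>j<M. ?\<tau> j) \<le> K * s" for M
    proof -
      have "norm (\<Sum>j<M. ?\<tau> j) \<le> (\<Sum>j<M. C * s * (s / (1 + (Re w + (real j + 1/2) * s)\<^sup>2)))"
        by (rule sum_norm_le) (rule \<tau>)
      also have "\<dots> = C * s * (\<Sum>j<M. s / (1 + (Re w + (real j + 1/2) * s)\<^sup>2))" by (rule sum_distrib_left[symmetric])
      also have "\<dots> \<le> C * s * (2 * pi)" using C s by (intro mult_left_mono sum_inverse_one_plus_square) auto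
      finally show ?thesis by (simp add: K_def mult_ac)
    qed
    have Ks: "K * s \<le> K" using K0 s by (simp add: mult_left_le)
    define A where "A = (\<lambda>M. gap_int k s (?w M) * exp (- \<Phi> (?w M) / of_real s))"
    have A: "A \<longlonglongrightarrow> 1" unfolding A_def by (rule gap_int_normalised_tendsto[OF k s(1) w \<Phi>])
    \<comment> \<open>An exact identity for every \<open>M\<close> by telescoping; as M tends to
      infinity A tends to 1 and only the errors survive.\<close>
    have X: "gap_ext k s \<Lambda> N w * exp (- \<Phi> w / of_real s) = A (N + M) * exp (- (\<Sum>j<N+M. ?\<tau> j))" for M
    proof -
      have "(\<Sum>j<N+M. ?\<tau> j) = (\<Sum>j<N+M. \<Lambda> (?m j)) - (\<Sum>j<N+M. \<Phi> (?w (Suc j)) - \<Phi> (?w j)) / of_real s"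
      proof -
        have sd: "(\<Sum>j<n. a j - b j / c) = (\<Sum>j<n. a j) - (\<Sum>j<n. b j) / c" for a b :: "nat \<Rightarrow> complex" and c n
          by (simp add: sum_subtractf sum_divide_distrib)
        show ?thesis by (rule sd)
      qed
      also have "(\<Sum>j<N+M. \<Phi> (?w (Suc j)) - \<Phi> (?w j)) = \<Phi> (?w (N+M)) - \<Phi> (?w 0)"
        by (rule sum_lessThan_telescope)
      finally have t: "(\<Sum>j<N+M. ?\<tau> j) = (\<Sum>j<N+M. \<Lambda> (?m j)) - (\<Phi> (?w (N+M)) - \<Phi> w) / of_real s" by simp
      have "gap_ext k s \<Lambda> N w = gap_ext k s \<Lambda> (N + M) w"
        by (rule gap_ext_add[symmetric, OF k s(1) re w right])
      then have "gap_ext k s \<Lambda> N w * exp (- \<Phi> w / of_real s) = gap_int k s (?w (N+M)) * exp (- (\<Sum>j<N+M. \<Lambda> (?m j)) + - \<Phi> w / of_real s)"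
        unfolding gap_ext_def exp_add by (simp only: mult.assoc)
      also have "- (\<Sum>j<N+M. \<Lambda> (?m j)) + - \<Phi> w / of_real s = - \<Phi> (?w (N+M)) / of_real s + - (\<Sum>j<N+M. ?\<tau> j)"
        unfolding t using s by (simp add: field_simps)
      finally show ?thesis unfolding A_def exp_add by (simp only: mult.assoc)
    qed
    have bd: "norm (A (N + M) * exp (- (\<Sum>j<N+M. ?\<tau> j)) - 1) \<le> norm (A (N + M) - 1) * exp K + K * exp K * s" for M
    proof -
      define S where "S = - (\<Sum>j<N+M. ?\<tau> j)"
      have S: "norm S \<le> K * s" "norm S \<le> K" using sum\<tau>[of "N + M"] Ks unfolding S_def norm_minus_cancel by simp_all
      have eS: "exp (norm S) \<le> exp K" using S by (simp only: exp_le_cancel_iff)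
      have "A (N + M) * exp S - 1 = (A (N + M) - 1) * exp S + (exp S - 1)" by (simp add: algebra_simps)
      also have "norm \<dots> \<le> norm (A (N + M) - 1) * norm (exp S) + norm (exp S - 1)"
        using norm_triangle_ineq[of "(A (N + M) - 1) * exp S" "exp S - 1"] by (simp only: norm_mult)
      also have "\<dots> \<le> norm (A (N + M) - 1) * exp K + (K * s) * exp K"
      proof (intro add_mono mult_left_mono)
        show "norm (exp S) \<le> exp K" using norm_exp[of S] eS by (rule order_trans)
        show "norm (exp S - 1) \<le> K * s * exp K"
          by (rule order_trans[OF norm_exp_minus_1_le]) (use S eS K0 s in \<open>intro mult_mono; simp\<close>)
      qed simp
      finally show ?thesis by (simp only: S_def mult_ac)
    qed
    have "(\<lambda>M. norm (A (N + M) - 1) * exp K + K * exp K * s) \<longlonglongrightarrow> norm (1 - 1 :: complex) * exp K + K * exp K * s"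
      by (intro tendsto_intros LIMSEQ_ignore_initial_segment[OF A, of N, unfolded add.commute[of _ N]])
    then have "norm (gap_ext k s \<Lambda> N w * exp (- \<Phi> w / of_real s) - 1) \<le> norm (1 - 1 :: complex) * exp K + K * exp K * s"
      by (rule tendsto_lowerbound) (use bd X in \<open>auto intro!: always_eventually\<close>)
    then show ?thesis by simp
  qed
  show ?thesis using main K0 by (intro exI[of _ "K * exp K"]) auto
qed

section \<open>The integrand on the imaginary axis\<close>

lemma Ln_one_minus_cis:
  assumes "0 < \<theta>" "\<theta> < 2 * pi"
  shows "Ln (1 - cis \<theta>) = Complex (ln (2 * sin (\<theta> / 2))) ((\<theta> - pi) / 2)"
proof -
  have s: "sin (\<theta> / 2) > 0" using assms by (intro sin_gt_zero) auto
  have c: "cos \<theta> = 1 - 2 * (sin (\<theta> / 2))\<^sup>2" "sin \<theta> = 2 * sin (\<theta> / 2) * cos (\<theta> / 2)"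
    using cos_double_sin[of "\<theta> / 2"] sin_double[of "\<theta> / 2"] by auto
  have t: "(\<theta> - pi) / 2 = \<theta> / 2 - pi / 2" by (simp add: diff_divide_distrib)
  have "exp (Complex (ln (2 * sin (\<theta> / 2))) ((\<theta> - pi) / 2)) = 1 - cis \<theta>"
    unfolding t using s by (intro complex_eqI) (auto simp: Re_exp Im_exp cos_diff sin_diff c power2_eq_square)
  then have "Ln (1 - cis \<theta>) = Ln (exp (Complex (ln (2 * sin (\<theta> / 2))) ((\<theta> - pi) / 2)))" by simp
  also have "\<dots> = Complex (ln (2 * sin (\<theta> / 2))) ((\<theta> - pi) / 2)"
    using assms by (intro Ln_exp) auto
  finally show ?thesis .
qed

lemma one_minus_exp_strip:
  assumes "0 < Im w" "Im w < 2 * pi"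
  shows "1 - exp w \<notin> \<real>\<^sub>\<le>\<^sub>0"
proof
  assume "1 - exp w \<in> \<real>\<^sub>\<le>\<^sub>0"
  then have im: "exp (Re w) * sin (Im w) = 0" and re: "1 \<le> exp (Re w) * cos (Im w)"
    by (auto simp: complex_nonpos_Reals_iff Re_exp Im_exp)
  have "sin (Im w) = 0" using im by simp
  then obtain i :: int where i: "Im w = of_int i * pi" using sin_zero_iff_int2 by blast
  then have "0 < of_int i * pi" "of_int i * pi < 2 * pi" using assms by auto
  then have "0 < i" "real_of_int i < 2" by (auto simp: zero_less_mult_iff)
  then have "i = 1" by linarith
  then have "cos (Im w) = - 1" using i by simp
  then show False using re exp_gt_zero[of "Re w"] by (simp del: exp_gt_zero)
qed

text \<open>The Fourier series of a quadratic Bernoulli polynomial. A primitive of - Ln (1 - exp w)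
  crosses the imaginary axis between 0 and 2 pi and, by continuity from the left, equals the
  dilogarithm there up to a constant. Its real part has derivative (t - pi) / 2, and the value at 0
  is pi^2 / 6.\<close>

lemma Re_dilog_cis:
  assumes "0 \<le> \<theta>" "\<theta> \<le> 2 * pi"
  shows "Re (dilog (cis \<theta>)) = pi\<^sup>2 / 6 - \<theta> * (2 * pi - \<theta>) / 4"
proof -
  define S where "S = {w. Im w < 2 * pi} \<inter> {w. Im w > 0}"
  have S: "convex S" "open S" unfolding S_def by (auto intro!: convex_Int open_Int convex_halfplanes)
  have "(\<lambda>w. - Ln (1 - exp w)) holomorphic_on S"
    using one_minus_exp_strip by (intro holomorphic_intros) (auto simp: S_def)
  then obtain P where P': "\<And>w. w \<in> S \<Longrightarrow> (P has_field_derivative - Ln (1 - exp w)) (at w within S)"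
    using holomorphic_convex_primitive'[OF S] by blast
  have P: "(P has_field_derivative - Ln (1 - exp w)) (at w)" if "w \<in> S" for w
    using P'[OF that] by (simp only: at_within_open[OF that S(2)])
  have "\<exists>c. \<forall>w\<in>S \<inter> {w. Re w < 0}. P w - dilog (exp w) = c"
  proof (rule has_field_derivative_zero_constant)
    show "convex (S \<inter> {w. Re w < 0})" by (intro convex_Int S convex_halfplanes)
    fix w assume w: "w \<in> S \<inter> {w. Re w < 0}"
    then have "((\<lambda>w. P w - dilog (exp w)) has_field_derivative - Ln (1 - exp w) - (- Ln (1 - exp w))) (at w)"
      using dilog_exp_has_derivative[of 1 w] by (intro DERIV_diff P) auto
    then show "((\<lambda>w. P w - dilog (exp w)) has_field_derivative 0) (at w within S \<inter> {w. Re w < 0})"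
      by (auto intro: has_field_derivative_at_within)
  qed
  then obtain c where c: "\<And>w. w \<in> S \<Longrightarrow> Re w < 0 \<Longrightarrow> P w - dilog (exp w) = c" by blast
  have Pc: "P (\<i> * of_real t) - dilog (cis t) = c" if t: "0 < t" "t < 2 * pi" for t
  proof -
    have inS: "\<i> * of_real t - of_real x \<in> S" for x using t by (simp add: S_def)
    have "isCont P (\<i> * of_real t)" using P[OF inS[of 0]] DERIV_isCont by auto
    then have "((\<lambda>x. P (\<i> * of_real t - of_real x)) \<longlongrightarrow> P (\<i> * of_real t)) (at_right 0)"
      by (rule isCont_tendsto_compose) (auto intro!: tendsto_eq_intros)
    moreover have "((\<lambda>x. dilog (exp (\<i> * of_real t - of_real x))) \<longlongrightarrow> dilog (cis t)) (at_right 0)"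
    proof -
      have cd: "continuous (at (cis t) within cball 0 1) dilog"
        using continuous_on_dilog by (simp add: continuous_on_eq_continuous_within)
      have ev: "\<forall>\<^sub>F x in at_right 0. exp (\<i> * of_real t - of_real x) \<in> cball 0 1"
        by (intro eventually_at_right_less[THEN eventually_mono]) simp
      have "((\<lambda>x. exp (\<i> * of_real t - of_real x)) \<longlongrightarrow> exp (\<i> * of_real t - of_real 0)) (at_right 0)"
        by (intro tendsto_intros)
      then have lim: "((\<lambda>x. exp (\<i> * of_real t - of_real x)) \<longlongrightarrow> cis t) (at_right 0)" by (simp add: cis_conv_exp)
      show ?thesis by (rule continuous_within_tendsto_compose[OF cd ev lim])
    qed
    ultimately have "((\<lambda>x. P (\<i> * of_real t - of_real x) - dilog (exp (\<i> * of_real t - of_real x))) \<longlongrightarrow>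
        P (\<i> * of_real t) - dilog (cis t)) (at_right 0)" by (rule tendsto_diff)
    moreover have "\<forall>\<^sub>F x in at_right 0. P (\<i> * of_real t - of_real x) - dilog (exp (\<i> * of_real t - of_real x)) = c"
      using inS by (intro eventually_at_right_less[THEN eventually_mono] c) auto
    ultimately show ?thesis by (rule tendsto_const_eq) simp
  qed
  define u where "u = (\<lambda>t. Re (dilog (cis t)) + t * (2 * pi - t) / 4)"
  have du: "(u has_real_derivative 0) (at t)" if t: "0 < t" "t < 2 * pi" for t
  proof -
    have inS: "\<i> * of_real t \<in> S" using t by (simp add: S_def)
    have L: "- Ln (1 - exp (\<i> * of_real t)) = - Complex (ln (2 * sin (t / 2))) ((t - pi) / 2)"
      using Ln_one_minus_cis[OF t] by (simp add: cis_conv_exp)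
    have "((\<lambda>t. P (\<i> * of_real t)) has_vector_derivative \<i> * (- Ln (1 - exp (\<i> * of_real t)))) (at t)"
    proof (rule has_vector_derivative_real_field)
      have "((\<lambda>z. P (\<i> * z)) has_field_derivative (- Ln (1 - exp (\<i> * of_real t))) * \<i>) (at (of_real t))"
        by (rule DERIV_chain2[where g="\<lambda>z. \<i> * z" and x="of_real t", OF P[OF inS]]) (auto intro!: derivative_eq_intros)
      then show "((\<lambda>z. P (\<i> * z)) has_field_derivative \<i> * (- Ln (1 - exp (\<i> * of_real t)))) (at (of_real t))"
        by (simp only: mult.commute)
    qed
    then have "((\<lambda>t. Re (P (\<i> * of_real t))) has_vector_derivative Re (\<i> * (- Ln (1 - exp (\<i> * of_real t))))) (at t)"
      by (rule bounded_linear.has_vector_derivative[OF bounded_linear_Re])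
    then have "((\<lambda>t. Re (P (\<i> * of_real t))) has_real_derivative (t - pi) / 2) (at t)"
      unfolding L by (simp add: has_real_derivative_iff_has_vector_derivative)
    moreover have "((\<lambda>t. t * (2 * pi - t) / 4) has_real_derivative (2 * pi - 2 * t) / 4) (at t)"
      by (auto intro!: derivative_eq_intros simp: field_simps)
    ultimately have "((\<lambda>t. Re (P (\<i> * of_real t)) - Re c + t * (2 * pi - t) / 4) has_real_derivative
        ((t - pi) / 2 - 0 + (2 * pi - 2 * t) / 4)) (at t)"
      by (intro DERIV_add DERIV_diff DERIV_const)
    then have d1: "((\<lambda>t. Re (P (\<i> * of_real t)) - Re c + t * (2 * pi - t) / 4) has_real_derivative 0) (at t)"
      by (simp add: field_simps)
    show ?thesis
    proof (rule has_field_derivative_transform_within_open[OF d1])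
      show "open {0<..<2 * pi}" "t \<in> {0<..<2 * pi}" using t by auto
      fix x :: real assume "x \<in> {0<..<2 * pi}"
      then show "Re (P (\<i> * of_real x)) - Re c + x * (2 * pi - x) / 4 = u x"
        using Pc[of x] by (auto simp: u_def)
    qed
  qed
  have cu: "continuous_on {0..2 * pi} u"
    unfolding u_def
    by (intro continuous_intros continuous_on_compose2[OF continuous_on_dilog]) auto
  have "u \<theta> = u 0"
    by (rule DERIV_isconst2[of 0 "2 * pi" u]) (use cu du assms in auto)
  then show ?thesis by (simp add: u_def dilog_1)
qed

lemma Re_dilog_cis_floor:
  fixes x :: real
  assumes "x \<ge> 0"
  obtains n :: real where "n \<in> \<int>" "n \<ge> 0" "2 * pi * n \<le> x" "x < 2 * pi * (n + 1)"
    "Re (dilog (cis x)) = pi\<^sup>2 / 6 - (x - 2 * pi * n) * (2 * pi * (n + 1) - x) / 4"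
proof
  define m where "m = \<lfloor>x / (2 * pi)\<rfloor>"
  have m: "of_int m \<le> x / (2 * pi)" "x / (2 * pi) < of_int m + 1" by (auto simp: m_def)
  show "real_of_int m \<in> \<int>" by simp
  show "0 \<le> real_of_int m" using assms by (simp add: m_def)
  show 1: "2 * pi * real_of_int m \<le> x" "x < 2 * pi * (real_of_int m + 1)"
    using m by (auto simp: field_simps)
  have "cis x = cis (x - 2 * pi * of_int m)"
    by (simp add: cis_divide[symmetric] cis_multiple_2pi)
  then show "Re (dilog (cis x)) = pi\<^sup>2 / 6 - (x - 2 * pi * real_of_int m) * (2 * pi * (real_of_int m + 1) - x) / 4"
    using 1 Re_dilog_cis[of "x - 2 * pi * of_int m"] by (simp add: algebra_simps)
qed

text \<open>This keeps half of the Gaussian decay - v^2 / 2 on the axis. If n and m periods are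
  completed by k v and (k + 1) v, both real parts are explicit quadratics, the v^2 terms leave v^2 /
  4, and the rest is the inequality \<open>key\<close>.\<close>

lemma dilog_cis_combination_le:
  fixes v :: real
  assumes k: "k \<ge> 1" and v: "v \<ge> 0"
  shows "Re (dilog (cis (real (k + 1) * v))) / real (k + 1) - Re (dilog (cis (real k * v))) / real k
     \<le> v\<^sup>2 / 4 - pi\<^sup>2 / (6 * real k * (real k + 1))"
proof -
  define a where "a = real k"
  have a: "a \<ge> 1" using k by (simp add: a_def)
  obtain n where n: "n \<in> \<int>" "n \<ge> 0" "2 * pi * n \<le> a * v" "a * v < 2 * pi * (n + 1)"
    "Re (dilog (cis (a * v))) = pi\<^sup>2 / 6 - (a * v - 2 * pi * n) * (2 * pi * (n + 1) - a * v) / 4"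
    using Re_dilog_cis_floor[of "a * v"] a v by auto
  obtain m where m: "m \<in> \<int>" "m \<ge> 0" "2 * pi * m \<le> (a + 1) * v" "(a + 1) * v < 2 * pi * (m + 1)"
    "Re (dilog (cis ((a + 1) * v))) = pi\<^sup>2 / 6 - ((a + 1) * v - 2 * pi * m) * (2 * pi * (m + 1) - (a + 1) * v) / 4"
    using Re_dilog_cis_floor[of "(a + 1) * v"] a v by auto
  have ex: "(pi\<^sup>2 / 6 - (b * v - 2 * pi * n) * (2 * pi * (n + 1) - b * v) / 4) / b
      = pi\<^sup>2 / (6 * b) + b * v\<^sup>2 / 4 - pi * v * (2 * n + 1) / 2 + pi\<^sup>2 * n * (n + 1) / b" if "b > 0" for b n :: real
    using that by (simp add: field_simps power2_eq_square)
  \<comment> \<open>For n < m, the end of period n bounds v from above and the start of period m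
    bounds it from below. Both quotients are thereby compared with v / 2, and (m - n + 1) / 2 <= m -
    n finishes.\<close>
  have key: "pi\<^sup>2 * m * (m + 1) / (a + 1) - pi\<^sup>2 * n * (n + 1) / a \<le> pi * v * (m - n)"
  proof -
    have "n * (2 * pi) < (m + 1) * (2 * pi)" using n(3) m(4) v by (simp add: algebra_simps)
    then have "n < m + 1" by simp
    then have nm: "n \<le> m" using n(1) m(1) by (auto elim!: Ints_cases)
    show ?thesis
    proof (cases "n = m")
      case True
      have "pi\<^sup>2 * n * (n + 1) / (a + 1) \<le> pi\<^sup>2 * n * (n + 1) / a"
        using a n(2) by (intro divide_left_mono) auto
      then show ?thesis using True by simp
    next
      case False
      then have nm1: "n + 1 \<le> m" using nm n(1) m(1) by (auto elim!: Ints_cases)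
      have "pi * m / (a + 1) \<le> v / 2" using m(3) a by (simp add: field_simps)
      then have "pi * m / (a + 1) * (pi * (m + 1)) \<le> v / 2 * (pi * (m + 1))"
        using m(2) by (intro mult_right_mono) auto
      moreover have "v / 2 \<le> pi * (n + 1) / a" using n(4) a by (simp add: field_simps)
      then have "v / 2 * (pi * n) \<le> pi * (n + 1) / a * (pi * n)"
        using n(2) by (intro mult_right_mono) auto
      moreover have "pi\<^sup>2 * m * (m + 1) / (a + 1) = pi * m / (a + 1) * (pi * (m + 1))" "pi\<^sup>2 * n * (n + 1) / a = pi * (n + 1) / a * (pi * n)"
        by (simp_all add: power2_eq_square)
      ultimately have "pi\<^sup>2 * m * (m + 1) / (a + 1) - pi\<^sup>2 * n * (n + 1) / a \<le> v / 2 * (pi * (m + 1)) - v / 2 * (pi * n)" by linarith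
      also have "\<dots> = pi * v * ((m - n + 1) / 2)" by (simp add: field_simps)
      also have "\<dots> \<le> pi * v * (m - n)" using nm1 v by (intro mult_left_mono) auto
      finally show ?thesis .
    qed
  qed
  have e1: "Re (dilog (cis (a * v))) / a = pi\<^sup>2 / (6 * a) + a * v\<^sup>2 / 4 - pi * v * (2 * n + 1) / 2 + pi\<^sup>2 * n * (n + 1) / a"
    unfolding n(5) using a by (intro ex) auto
  have e2: "Re (dilog (cis ((a + 1) * v))) / (a + 1) = pi\<^sup>2 / (6 * (a + 1)) + (a + 1) * v\<^sup>2 / 4 - pi * v * (2 * m + 1) / 2 + pi\<^sup>2 * m * (m + 1) / (a + 1)"
    unfolding m(5) using a by (intro ex) auto
  have "Re (dilog (cis ((a + 1) * v))) / (a + 1) - Re (dilog (cis (a * v))) / a =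
     (pi\<^sup>2 / (6 * (a + 1)) - pi\<^sup>2 / (6 * a)) + v\<^sup>2 / 4 - pi * v * (m - n) + (pi\<^sup>2 * m * (m + 1) / (a + 1) - pi\<^sup>2 * n * (n + 1) / a)"
    unfolding e1 e2 by (simp add: algebra_simps add_divide_distrib diff_divide_distrib)
  also have "pi\<^sup>2 / (6 * (a + 1)) - pi\<^sup>2 / (6 * a) = - (pi\<^sup>2 / (6 * a * (a + 1)))"
  proof -
    have "1 / (a + 1) - 1 / a = - (1 / (a * (a + 1)))" using a by (simp add: field_simps)
    then have "pi\<^sup>2 / 6 * (1 / (a + 1) - 1 / a) = pi\<^sup>2 / 6 * (- (1 / (a * (a + 1))))" by simp
    then show ?thesis
      by (simp only: right_diff_distrib mult_minus_right times_divide_times_eq mult_1_right mult.assoc)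
  qed
  finally have E: "Re (dilog (cis ((a + 1) * v))) / (a + 1) - Re (dilog (cis (a * v))) / a =
     - (pi\<^sup>2 / (6 * a * (a + 1))) + v\<^sup>2 / 4 - pi * v * (m - n) + (pi\<^sup>2 * m * (m + 1) / (a + 1) - pi\<^sup>2 * n * (n + 1) / a)" .
  have "L \<le> V - X" if "L = - X + V - R + K" "K \<le> R" for L V X R K :: real using that by linarith
  from this[OF E key] show ?thesis unfolding a_def[symmetric] of_nat_add of_nat_1 .
qed

section \<open>Pochhammer logarithms near the unit circle\<close>

text \<open>Logarithm of \<open>1 / (z ^ a; q ^ a)\<^sub>\<infinity>\<close>; the term \<open>m = 0\<close> vanishes because \<open>1 / 0 = 0\<close>.\<close>
definition log_poch :: "nat \<Rightarrow> real \<Rightarrow> complex \<Rightarrow> complex" where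
  "log_poch a q z = (\<Sum>m. z ^ (a * m) / (of_nat m * (1 - of_real q ^ (a * m))))"

lemma log_poch_sums:
  assumes q: "0 < q" "q < 1" and a: "a \<ge> 1" and z: "norm z < 1"
  shows "(\<lambda>m. z ^ (a * m) / (of_nat m * (1 - of_real q ^ (a * m)))) sums log_poch a q z"
    "norm (log_poch a q z) \<le> norm z / ((1 - q) * (1 - norm z))"
proof -
  let ?t = "\<lambda>m. z ^ (a * m) / (of_nat m * (1 - of_real q ^ (a * m)) :: complex)"
  let ?g = "\<lambda>m. (1 / (1 - q) * norm z) * norm z ^ m"
  have bd: "norm (?t (Suc m)) \<le> ?g m" for m
  proof -
    have qa: "q ^ (a * Suc m) \<le> q" using power_decreasing[of 1 "a * Suc m" q] a q by simp
    have "norm (1 - complex_of_real q ^ (a * Suc m)) = 1 - q ^ (a * Suc m)"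
    proof -
      have "1 - complex_of_real q ^ (a * Suc m) = of_real (1 - q ^ (a * Suc m))" by simp
      then show ?thesis using qa q by (simp only: norm_of_real)
    qed
    then have "norm (?t (Suc m)) = norm z ^ (a * Suc m) / (real (Suc m) * (1 - q ^ (a * Suc m)))"
      by (simp only: norm_divide norm_mult norm_power norm_of_nat)
    also have "\<dots> \<le> norm z ^ (a * Suc m) / (1 * (1 - q))"
      using qa q by (intro divide_left_mono mult_mono) (auto intro!: mult_pos_pos simp del: mult_Suc_right power_mult)
    also have "\<dots> \<le> norm z ^ (Suc m) / (1 * (1 - q))"
      using q z mult_le_mono1[OF a, of "Suc m"] by (intro divide_right_mono power_decreasing) auto
    finally show ?thesis by simp
  qed
  have g: "?g sums (1 / (1 - q) * norm z * (1 / (1 - norm z)))"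
    using z by (intro sums_mult geometric_sums) auto
  have "summable (\<lambda>m. ?t (Suc m))"
    using bd by (intro summable_comparison_test'[OF sums_summable[OF g], where N=0]) auto
  then have sm: "summable ?t" by (subst (asm) summable_Suc_iff)
  show "?t sums log_poch a q z" unfolding log_poch_def using sm by (rule summable_sums)
  have "log_poch a q z = (\<Sum>m. ?t (Suc m))"
    unfolding log_poch_def using suminf_split_head[OF sm] by simp
  also have "norm \<dots> \<le> (\<Sum>m. ?g m)" by (rule norm_suminf_le[OF bd sums_summable[OF g]])
  also have "\<dots> = norm z / ((1 - q) * (1 - norm z))" using g by (simp add: sums_iff)
  finally show "norm (log_poch a q z) \<le> norm z / ((1 - q) * (1 - norm z))" .
qed

text \<open>In the difference of the series at z and q z the denominators 1 - q^(a m) cancel,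
  leaving the series of - Ln (1 - z^a).\<close>

lemma log_poch_shift:
  assumes q: "0 < q" "q < 1" and a: "a \<ge> 1" and z: "norm z < 1"
  shows "exp (log_poch a q z) * (1 - z ^ a) = exp (log_poch a q (of_real q * z))"
proof -
  have qz: "norm (of_real q * z) < 1" using q z mult_strict_mono[of q 1 "norm z" 1] by (simp add: norm_mult)
  have za: "norm (z ^ a) < 1" using z a by (simp add: norm_power power_less_one_iff)
  then have nz: "1 - z ^ a \<noteq> 0" by auto
  have qm: "1 - complex_of_real q ^ (a * m) \<noteq> 0" if "m > 0" for m
  proof -
    have "q ^ (a * m) < 1" using q a that by (simp add: power_less_one_iff)
    then have "1 - q ^ (a * m) \<noteq> 0" by simp
    then show ?thesis by (metis of_real_1 of_real_diff of_real_eq_0_iff of_real_power)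
  qed
  have "(\<lambda>m. z ^ (a * m) / (of_nat m * (1 - of_real q ^ (a * m))) - (of_real q * z) ^ (a * m) / (of_nat m * (1 - of_real q ^ (a * m))))
     sums (log_poch a q z - log_poch a q (of_real q * z))"
    using log_poch_sums(1)[OF q a z] log_poch_sums(1)[OF q a qz] by (rule sums_diff)
  also have "(\<lambda>m. z ^ (a * m) / (of_nat m * (1 - of_real q ^ (a * m))) - (of_real q * z) ^ (a * m) / (of_nat m * (1 - of_real q ^ (a * m))))
     = (\<lambda>m. (z ^ a) ^ m / of_nat m)"
  proof
    fix m
    show "z ^ (a * m) / (of_nat m * (1 - of_real q ^ (a * m))) - (of_real q * z) ^ (a * m) / (of_nat m * (1 - of_real q ^ (a * m)))
       = (z ^ a) ^ m / of_nat m"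
    proof (cases "m = 0")
      case False
      then have "1 - complex_of_real q ^ (a * m) \<noteq> 0" using qm by simp
      moreover have "z ^ (a * m) - (of_real q * z) ^ (a * m) = z ^ (a * m) * (1 - of_real q ^ (a * m))"
        by (simp add: power_mult_distrib algebra_simps)
      ultimately show ?thesis by (simp add: diff_divide_distrib[symmetric] power_mult)
    qed simp
  qed
  finally have "(\<lambda>m. (z ^ a) ^ m / of_nat m) sums (log_poch a q z - log_poch a q (of_real q * z))" .
  moreover have "(\<lambda>m. (z ^ a) ^ m / of_nat m) sums (- Ln (1 - z ^ a))"
    using sums_minus[OF Ln_series'[of "- (z ^ a)"]] za by simp
  ultimately have "log_poch a q z - log_poch a q (of_real q * z) = - Ln (1 - z ^ a)" by (rule sums_unique2)
  then have "log_poch a q (of_real q * z) = log_poch a q z + Ln (1 - z ^ a)" by (simp add: algebra_simps)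
  then show ?thesis using nz by (simp add: exp_add)
qed

text \<open>The product formula (z^k; q^k) / (z^(k+1); q^(k+1)). The quotient of both sides is
  invariant under z -> q z, and iterating drives the argument to 0, where the quotient tends to
  1.\<close>

lemma gap_fun_eq_exp:
  assumes q: "0 < q" "q < 1" and k: "k \<ge> 1" and z: "norm z < 1"
  shows "gap_fun k q z = exp (log_poch (k + 1) q z - log_poch k q z)"
proof -
  define H where "H = (\<lambda>z. gap_fun k q z * exp (log_poch k q z - log_poch (k + 1) q z))"
  define zN where "zN = (\<lambda>N. of_real q ^ N * z)"
  have zN: "norm (zN N) < 1" for N
  proof -
    have "q ^ N * norm z \<le> 1 * norm z" using q by (intro mult_right_mono power_le_one) auto
    then show ?thesis using z q by (simp add: zN_def norm_mult norm_power)
  qed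
  have step: "H (of_real q * u) = H u" if u: "norm u < 1" for u
  proof -
    have nz: "1 - u ^ n \<noteq> 0" if "n \<ge> 1" for n
    proof -
      have "norm (u ^ n) < 1" using u that by (simp add: norm_power power_less_one_iff)
      then show ?thesis by auto
    qed
    have "gap_fun k q u * (1 - u ^ (k + 1)) = (1 - u ^ k) * gap_fun k q (of_real q * u)" by (rule gap_fun_eq[OF q k u])
    moreover have "1 - u ^ k \<noteq> 0" using nz[of k] k by simp
    ultimately have B: "gap_fun k q (of_real q * u) = gap_fun k q u * (1 - u ^ (k + 1)) / (1 - u ^ k)"
      by (metis nonzero_mult_div_cancel_left)
    have e1: "exp (log_poch k q (of_real q * u)) = exp (log_poch k q u) * (1 - u ^ k)"
      and e2: "exp (log_poch (k + 1) q (of_real q * u)) = exp (log_poch (k + 1) q u) * (1 - u ^ (k + 1))"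
      using log_poch_shift[OF q _ u, of k] log_poch_shift[OF q _ u, of "k + 1"] k by simp_all
    have "1 - u ^ (k + 1) \<noteq> 0" "1 - u ^ k \<noteq> 0" using nz[of k] nz[of "k+1"] k by auto
    then show ?thesis unfolding H_def exp_diff B e1 e2 by simp
  qed
  have HN: "H (zN N) = H z" for N
  proof (induction N)
    case (Suc N)
    have "zN (Suc N) = of_real q * zN N" by (simp add: zN_def)
    then show ?case using step[OF zN[of N]] Suc by simp
  qed (simp add: zN_def)
  have "(\<lambda>N. complex_of_real q ^ N) \<longlonglongrightarrow> 0" using q by (intro LIMSEQ_power_zero) simp
  then have z0: "zN \<longlonglongrightarrow> 0" unfolding zN_def by (rule tendsto_mult_left_zero)
  have lp: "(\<lambda>N. log_poch a q (zN N)) \<longlonglongrightarrow> 0" if a: "a \<ge> 1" for a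
  proof (rule Lim_null_comparison)
    show "\<forall>\<^sub>F N in sequentially. norm (log_poch a q (zN N)) \<le> norm (zN N) / ((1 - q) * (1 - norm (zN N)))"
      by (intro always_eventually allI log_poch_sums(2) q a zN)
    have "(\<lambda>N. norm (zN N) / ((1 - q) * (1 - norm (zN N)))) \<longlonglongrightarrow> norm (0::complex) / ((1 - q) * (1 - norm (0::complex)))"
      using q by (intro tendsto_intros z0) auto
    then show "(\<lambda>N. norm (zN N) / ((1 - q) * (1 - norm (zN N)))) \<longlonglongrightarrow> 0" by simp
  qed
  have "isCont (gap_fun k q) 0"
    using continuous_on_interior[OF holomorphic_on_imp_continuous_on[OF gap_fun_holomorphic[OF q k]]] by simp
  then have B1: "(\<lambda>N. gap_fun k q (zN N)) \<longlonglongrightarrow> 1"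
    using isCont_tendsto_compose[OF _ z0, of "gap_fun k q"] by simp
  have "(\<lambda>N. H (zN N)) \<longlonglongrightarrow> 1 * exp (0 - 0)"
    unfolding H_def using k by (intro tendsto_mult B1 tendsto_exp tendsto_diff lp) auto
  then have "H z = 1" unfolding HN by (simp add: tendsto_const_iff)
  then show ?thesis by (simp add: H_def exp_diff field_simps)
qed

text \<open>The error is at most 1/2 and at most 1 / y; the intermediate bound 1 / sqrt y serves
  both needs. The bound 1/2 would leave a divergent sum of 1 / m, and 1 / y an error as large as the
  main term.\<close>

lemma inverse_sinh_approx:
  fixes y :: real
  assumes "y > 0"
  shows "\<bar>1 / (exp (y / 2) - exp (- (y / 2))) - 1 / y\<bar> \<le> 1 / sqrt y"
proof -
  let ?D = "exp (y / 2) - exp (- (y / 2))"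
  have lo: "y \<le> ?D"
  proof -
    have "exp 0 - exp (- 0) - 2 * 0 \<le> exp (y/2) - exp (- (y/2)) - 2 * (y/2)"
    proof (rule DERIV_nonneg_imp_nondecreasing[of 0 "y/2" "\<lambda>u. exp u - exp (- u) - 2 * u"])
      fix u :: real assume "0 \<le> u"
      have "0 \<le> (exp (u/2) - exp (- (u/2)))\<^sup>2" by simp
      also have "\<dots> = exp u + exp (- u) - 2"
        by (simp add: power2_eq_square algebra_simps exp_add[symmetric])
      finally show "\<exists>z. ((\<lambda>u. exp u - exp (- u) - 2 * u) has_real_derivative z) (at u) \<and> 0 \<le> z"
        by (intro exI[of _ "exp u + exp (- u) - 2"]) (auto intro!: derivative_eq_intros)
    qed (use assms in simp)
    then show ?thesis by simp
  qed
  have Dp: "?D > 0" using lo assms by linarith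
  have up: "?D \<le> y * exp (y / 2)"
  proof -
    have "1 + (- y) \<le> exp (- y)" by (rule exp_ge_add_one_self)
    then have "exp (y / 2) * (1 - exp (- y)) \<le> exp (y / 2) * y" by (intro mult_left_mono) auto
    moreover have "exp (y / 2) * (1 - exp (- y)) = ?D" by (simp add: right_diff_distrib exp_add[symmetric])
    ultimately have "?D \<le> exp (y / 2) * y" by simp
    then show ?thesis by (simp only: mult.commute)
  qed
  have 1: "1 / ?D \<le> 1 / y" using lo assms by (intro divide_left_mono) (auto intro!: mult_pos_pos Dp)
  have "1 / (y * exp (y / 2)) \<le> 1 / ?D" using up Dp assms by (intro divide_left_mono mult_pos_pos) auto
  moreover have "1 / (y * exp (y / 2)) = exp (- (y / 2)) / y" by (simp add: exp_minus field_simps)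
  moreover have "(1 + - (y / 2)) / y \<le> exp (- (y / 2)) / y"
    using assms exp_ge_add_one_self[of "- (y/2)"] by (intro divide_right_mono) auto
  moreover have "(1 + - (y / 2)) / y = 1 / y - 1 / 2" using assms by (simp add: field_simps)
  ultimately have 2: "1 / y - 1 / ?D \<le> 1 / 2" by linarith
  have 3: "1 / y - 1 / ?D \<le> 1 / y" using Dp by simp
  have "min (1 / 2) (1 / y) \<le> 1 / sqrt y"
  proof (cases "y \<le> 1")
    case True
    then have "1 \<le> 1 / sqrt y" using assms by simp
    then show ?thesis by linarith
  next
    case False
    then have "sqrt y * 1 \<le> sqrt y * sqrt y" by (intro mult_left_mono) auto
    then have "sqrt y \<le> y" using assms by simp
    then have "1 / y \<le> 1 / sqrt y" using assms by (intro divide_left_mono) auto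
    then show ?thesis by linarith
  qed
  moreover have "1 / y - 1 / ?D \<le> min (1 / 2) (1 / y)" using 2 3 by (rule min.boundedI)
  ultimately have "1 / y - 1 / ?D \<le> 1 / sqrt y" by (rule order_trans[rotated])
  moreover have "\<bar>A - B\<bar> \<le> C" if "A \<le> B" "B - A \<le> C" for A B C :: real using that by linarith
  ultimately show ?thesis using 1 by blast
qed

text \<open>At radius exp (- s / 2) the factor of the m-th term is exactly 1 / (2 sinh (a m s / 2)),
  close to 1 / (a m s); the latter gives the dilogarithm. The error terms are of order m powr (-3/2)
  / sqrt s.\<close>

lemma Re_log_poch_approx:
  obtains Z where "Z \<ge> 0" "\<And>a s v. a \<ge> 1 \<Longrightarrow> 0 < s \<Longrightarrow>
    \<bar>Re (log_poch a (exp (- s)) (of_real (exp (- s / 2)) * cis v)) - Re (dilog (cis (real a * v))) / (real a * s)\<bar> \<le> Z / sqrt s"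
proof
  define Z where "Z = (\<Sum>m. real m powr (-3/2))"
  have smZ: "summable (\<lambda>m. real m powr (-3/2))" by (subst summable_real_powr_iff) simp
  show "Z \<ge> 0" unfolding Z_def by (intro suminf_nonneg smZ) simp
  fix a :: nat and s v :: real assume a: "a \<ge> 1" and s: "0 < s"
  let ?q = "exp (- s)" and ?z = "of_real (exp (- s / 2)) * cis v"
  define y where "y = (\<lambda>m. real a * real m * s)"
  have z: "norm ?z < 1" using s by (simp add: norm_mult)
  have q: "0 < ?q" "?q < 1" using s by auto
  have t: "Re (?z ^ (a * m) / (of_nat m * (1 - of_real ?q ^ (a * m)))) = cos (real (a * m) * v) / real m * (1 / (exp (y m / 2) - exp (- (y m / 2))))" for m
  proof (cases "m = 0")
    case False
    then have ym: "y m > 0" using a s by (simp add: y_def)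
    have "?z ^ (a * m) = of_real (exp (- (y m / 2))) * cis (real (a * m) * v)"
      by (simp add: power_mult_distrib Complex.DeMoivre y_def exp_of_nat_mult[symmetric] mult_ac flip: of_real_power)
    moreover have "1 - complex_of_real ?q ^ (a * m) = of_real (1 - exp (- y m))"
      by (simp add: y_def exp_of_nat_mult[symmetric] mult_ac flip: of_real_power)
    ultimately have "?z ^ (a * m) / (of_nat m * (1 - of_real ?q ^ (a * m))) =
       of_real (exp (- (y m / 2)) / (real m * (1 - exp (- y m)))) * cis (real (a * m) * v)" by simp
    moreover have "Re (of_real r * cis t) = r * cos t" for r t by simp
    ultimately have "Re (?z ^ (a * m) / (of_nat m * (1 - of_real ?q ^ (a * m)))) = exp (- (y m / 2)) / (real m * (1 - exp (- y m))) * cos (real (a * m) * v)"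
      by (simp only:)
    also have "1 - exp (- y m) = exp (- (y m / 2)) * (exp (y m / 2) - exp (- (y m / 2)))"
      by (simp add: right_diff_distrib exp_add[symmetric])
    finally show ?thesis by simp
  qed simp
  have 1: "(\<lambda>m. cos (real (a * m) * v) / real m * (1 / (exp (y m / 2) - exp (- (y m / 2))))) sums Re (log_poch a ?q ?z)"
    using sums_Re[OF log_poch_sums(1)[OF q a z]] unfolding t .
  have "(\<lambda>m. Re (cis (real a * v) ^ m / of_nat m ^ 2) * (1 / (real a * s))) sums (Re (dilog (cis (real a * v))) * (1 / (real a * s)))"
    by (intro sums_mult2 sums_Re dilog_sums) simp
  also have "(\<lambda>m. Re (cis (real a * v) ^ m / of_nat m ^ 2) * (1 / (real a * s))) = (\<lambda>m. cos (real (a * m) * v) / real m * (1 / y m))"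
  proof
    fix m
    have "Re (cis (real a * v) ^ m / of_nat m ^ 2) = cos (real m * (real a * v)) / (real m)\<^sup>2"
      unfolding Complex.DeMoivre by (simp add: Re_divide_of_nat flip: of_nat_power)
    then show "Re (cis (real a * v) ^ m / of_nat m ^ 2) * (1 / (real a * s)) = cos (real (a * m) * v) / real m * (1 / y m)"
      by (simp add: y_def power2_eq_square mult_ac)
  qed
  finally have 2: "(\<lambda>m. cos (real (a * m) * v) / real m * (1 / y m)) sums (Re (dilog (cis (real a * v))) / (real a * s))" by simp
  have d: "(\<lambda>m. cos (real (a * m) * v) / real m * (1 / (exp (y m / 2) - exp (- (y m / 2)))) - cos (real (a * m) * v) / real m * (1 / y m))
     sums (Re (log_poch a ?q ?z) - Re (dilog (cis (real a * v))) / (real a * s))"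
    by (rule sums_diff[OF 1 2])
  have bd: "norm (cos (real (a * m) * v) / real m * (1 / (exp (y m / 2) - exp (- (y m / 2)))) - cos (real (a * m) * v) / real m * (1 / y m))
     \<le> real m powr (-3/2) * (1 / sqrt s)" for m
  proof (cases "m = 0")
    case False
    then have ym: "y m > 0" "real m * s \<le> y m" using a s by (auto simp: y_def)
    let ?e = "1 / (exp (y m / 2) - exp (- (y m / 2))) - 1 / y m"
    have "norm (cos (real (a * m) * v) / real m * (1 / (exp (y m / 2) - exp (- (y m / 2)))) - cos (real (a * m) * v) / real m * (1 / y m))
       = \<bar>cos (real (a * m) * v)\<bar> * (1 / real m) * \<bar>?e\<bar>"
      by (simp only: right_diff_distrib[symmetric] real_norm_def abs_mult abs_divide) simp
    also have "\<dots> \<le> 1 * (1 / real m) * (1 / sqrt (real m * s))"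
    proof (intro mult_mono)
      have "\<bar>?e\<bar> \<le> 1 / sqrt (y m)" by (rule inverse_sinh_approx[OF ym(1)])
      also have "\<dots> \<le> 1 / sqrt (real m * s)"
        using ym s False by (intro divide_left_mono) (auto intro!: mult_pos_pos)
      finally show "\<bar>?e\<bar> \<le> 1 / sqrt (real m * s)" .
    qed (use s in auto)
    also have "\<dots> = real m powr (-3/2) * (1 / sqrt s)"
    proof -
      have "real m powr (3/2) = real m powr (1 + 1/2)" by simp
      also have "\<dots> = real m * sqrt (real m)" using False by (subst powr_add) (simp add: powr_half_sqrt)
      finally have p: "real m powr (3/2) = real m * sqrt (real m)" .
      have "- 3 / 2 = - (3 / 2 :: real)" by simp
      then have "real m powr (-3/2) = inverse (real m * sqrt (real m))"
        unfolding p[symmetric] powr_minus[symmetric] by (rule arg_cong)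
      then show ?thesis unfolding real_sqrt_mult mult_1_left divide_inverse
        by (simp only: inverse_mult_distrib mult_1_left mult.assoc)
    qed
    finally show ?thesis .
  qed simp
  have "norm (\<Sum>m. cos (real (a * m) * v) / real m * (1 / (exp (y m / 2) - exp (- (y m / 2)))) - cos (real (a * m) * v) / real m * (1 / y m))
      \<le> (\<Sum>m. real m powr (-3/2) * (1 / sqrt s))"
    by (rule norm_suminf_le[OF bd]) (intro summable_mult2 smZ)
  also have "\<dots> = Z * (1 / sqrt s)" unfolding Z_def by (rule suminf_mult2[OF smZ, symmetric])
  finally show "\<bar>Re (log_poch a ?q ?z) - Re (dilog (cis (real a * v))) / (real a * s)\<bar> \<le> Z / sqrt s"
    using d by (simp add: sums_iff)
qed

text \<open>Near v = 0 this exceeds the true size of the integral exponentially, so it is used only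
  for the tail, where v^2 / 4 compensates.\<close>

theorem gap_int_imag_bound:
  assumes k: "k \<ge> 1"
  obtains Z where "Z \<ge> 0" "\<And>s v. 0 < s \<Longrightarrow>
    norm (gap_int k s (\<i> * of_real v)) \<le> exp (Z / sqrt s - (v\<^sup>2 / 4 + pi\<^sup>2 / (6 * real k * (real k + 1))) / s)"
proof -
  obtain Z where Z: "Z \<ge> 0" "\<And>a s v. a \<ge> 1 \<Longrightarrow> 0 < s \<Longrightarrow>
    \<bar>Re (log_poch a (exp (- s)) (of_real (exp (- s / 2)) * cis v)) - Re (dilog (cis (real a * v))) / (real a * s)\<bar> \<le> Z / sqrt s"
    using Re_log_poch_approx by blast
  have cnj: "Re (dilog (cis (- x))) = Re (dilog (cis x))" for x
  proof -
    have "(\<lambda>n. cnj (cis x ^ n / of_nat n ^ 2)) sums cnj (dilog (cis x))"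
      by (subst sums_cnj) (rule dilog_sums, simp)
    moreover have "(\<lambda>n. cnj (cis x ^ n / of_nat n ^ 2)) = (\<lambda>n. cis (- x) ^ n / of_nat n ^ 2)"
      by (simp add: cis_cnj)
    ultimately have "cnj (dilog (cis x)) = dilog (cis (- x))"
      using dilog_sums[of "cis (- x)"] by (simp add: sums_unique2)
    then have "Re (cnj (dilog (cis x))) = Re (dilog (cis (- x)))" by (simp only:)
    then show ?thesis by simp
  qed
  show ?thesis
  proof (rule that[of "2 * Z"])
    show "2 * Z \<ge> 0" using Z by simp
    fix s v :: real assume s: "0 < s"
    let ?q = "exp (- s)" and ?z = "of_real (exp (- s / 2)) * cis (- v)"
    have z: "norm ?z < 1" using s by (simp add: norm_mult)
    have zz: "exp (- (\<i> * of_real v) - of_real (s / 2)) = ?z"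
      by (simp add: cis_conv_exp exp_of_real[symmetric] exp_add[symmetric] exp_diff exp_minus field_simps)
    have e: "norm (exp ((\<i> * of_real v)\<^sup>2 / of_real (2 * s))) = exp (- v\<^sup>2 / (2 * s))"
    proof -
      have "(\<i> * of_real v)\<^sup>2 / of_real (2 * s) = complex_of_real (- v\<^sup>2 / (2 * s))" by (simp add: power_mult_distrib)
      then show ?thesis by (simp only: norm_exp_eq_Re Re_complex_of_real)
    qed
    have "Re (log_poch (k+1) ?q ?z - log_poch k ?q ?z) \<le>
        Re (dilog (cis (real (k+1) * (- v)))) / (real (k+1) * s) - Re (dilog (cis (real k * (- v)))) / (real k * s) + 2 * Z / sqrt s"
      using Z(2)[of "k+1" s "- v"] Z(2)[of k s "- v"] k s by (simp add: abs_le_iff)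
    also have "Re (dilog (cis (real (k+1) * (- v)))) / (real (k+1) * s) - Re (dilog (cis (real k * (- v)))) / (real k * s)
       = (Re (dilog (cis (real (k+1) * \<bar>v\<bar>))) / real (k+1) - Re (dilog (cis (real k * \<bar>v\<bar>))) / real k) / s"
    proof -
      have "Re (dilog (cis (real n * (- v)))) = Re (dilog (cis (real n * \<bar>v\<bar>)))" for n
        using cnj[of "real n * v"] by (cases "v \<ge> 0") auto
      then show ?thesis by (simp only: diff_divide_distrib divide_divide_eq_left)
    qed
    also have "\<dots> \<le> (\<bar>v\<bar>\<^sup>2 / 4 - pi\<^sup>2 / (6 * real k * (real k + 1))) / s"
      using s by (intro divide_right_mono dilog_cis_combination_le k) auto
    finally have L: "Re (log_poch (k+1) ?q ?z - log_poch k ?q ?z) \<le> (v\<^sup>2 / 4 - pi\<^sup>2 / (6 * real k * (real k + 1))) / s + 2 * Z / sqrt s" by simp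
    have "norm (gap_int k s (\<i> * of_real v)) = exp (- v\<^sup>2 / (2 * s)) * exp (Re (log_poch (k+1) ?q ?z - log_poch k ?q ?z))"
      unfolding gap_int_def norm_mult e zz using gap_fun_eq_exp[of ?q k ?z] s k z by simp
    also have "\<dots> \<le> exp (- v\<^sup>2 / (2 * s)) * exp ((v\<^sup>2 / 4 - pi\<^sup>2 / (6 * real k * (real k + 1))) / s + 2 * Z / sqrt s)"
      using L by simp
    also have "\<dots> = exp (2 * Z / sqrt s - (v\<^sup>2 / 4 + pi\<^sup>2 / (6 * real k * (real k + 1))) / s)"
    proof -
      have "- a / (2 * s) + ((a / 4 - p) / s + r) = r - (a / 4 + p) / s" for a p r :: real
        using s by (simp add: field_simps)
      then show ?thesis unfolding exp_add[symmetric] by (simp only:)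
    qed
    finally show "norm (gap_int k s (\<i> * of_real v)) \<le> exp (2 * Z / sqrt s - (v\<^sup>2 / 4 + pi\<^sup>2 / (6 * real k * (real k + 1))) / s)" .
  qed
qed

section \<open>Asymptotics of the gap series\<close>

text \<open>Far to the left the phase is exp (k w) / k to leading order: the next terms of both
  dilogarithms are smaller by a factor exp (Re w).\<close>

lemma phase_left_estimates:
  assumes k: "k \<ge> 1" and w: "Re w < 0"
  shows "norm (phase_left k w - exp (of_nat k * w) / of_nat k) \<le> 6 * exp (real k * Re w) * exp (Re w) / real k"
    "norm (phase_left k w) \<le> 6 * exp (real k * Re w)"
proof -
  let ?z = "exp (of_real (real k) * w)" and ?u = "exp (of_real (real k + 1) * w)"
  have nz: "norm ?z = exp (real k * Re w)" and nu: "norm ?u = exp ((real k + 1) * Re w)" by simp_all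
  have neg: "real k * Re w \<le> 0" "(real k + 1) * Re w \<le> 0" using w k by (auto intro: mult_nonneg_nonpos)
  have z1: "norm ?z \<le> 1" "norm ?u \<le> 1" unfolding nz nu using neg by simp_all
  have kp: "real k > 0" "real k + 1 > 0" using k by auto
  have uz: "norm ?u = exp (real k * Re w) * exp (Re w)" unfolding nu by (simp add: exp_add[symmetric] algebra_simps)
  have zz: "norm ?z ^ 2 \<le> exp (real k * Re w) * exp (Re w)"
  proof -
    have "real k * Re w \<le> 1 * Re w" using k w by (intro mult_right_mono_neg) auto
    then show ?thesis unfolding nz power2_eq_square by (intro mult_left_mono) auto
  qed
  have d1: "norm (dilog ?u / of_real (real k + 1)) \<le> 3 * (exp (real k * Re w) * exp (Re w)) / real k"
  proof -
    have "norm (dilog ?u / of_real (real k + 1)) = norm (dilog ?u) / (real k + 1)"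
      unfolding norm_divide norm_of_real using kp by simp
    also have "\<dots> \<le> 3 * (exp (real k * Re w) * exp (Re w)) / real k"
      using norm_dilog_le(1)[OF z1(2)] kp unfolding uz by (intro frac_le) auto
    finally show ?thesis .
  qed
  have d2: "norm ((dilog ?z - ?z) / of_real (real k)) \<le> 3 * (exp (real k * Re w) * exp (Re w)) / real k"
  proof -
    have "norm ((dilog ?z - ?z) / of_real (real k)) = norm (dilog ?z - ?z) / real k"
      unfolding norm_divide norm_of_real using kp by simp
    also have "\<dots> \<le> 3 * (exp (real k * Re w) * exp (Re w)) / real k"
      using norm_dilog_le(2)[OF z1(1)] zz kp by (intro divide_right_mono) auto
    finally show ?thesis .
  qed
  have "phase_left k w - exp (of_nat k * w) / of_nat k = (dilog ?z - ?z) / of_real (real k) - dilog ?u / of_real (real k + 1)"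
    unfolding phase_left_def by (simp add: diff_divide_distrib)
  also have "norm \<dots> \<le> 3 * (exp (real k * Re w) * exp (Re w)) / real k + 3 * (exp (real k * Re w) * exp (Re w)) / real k"
    by (rule order_trans[OF norm_triangle_ineq4 add_mono[OF d2 d1]])
  finally show "norm (phase_left k w - exp (of_nat k * w) / of_nat k) \<le> 6 * exp (real k * Re w) * exp (Re w) / real k"
    by (simp add: mult_ac)
  have d3: "norm (dilog ?z / of_real (real k)) \<le> 3 * exp (real k * Re w)"
  proof -
    have "norm (dilog ?z / of_real (real k)) = norm (dilog ?z) / real k"
      unfolding norm_divide norm_of_real using kp by simp
    also have "\<dots> \<le> 3 * exp (real k * Re w) / 1"
      using norm_dilog_le(1)[OF z1(1)] k unfolding nz by (intro frac_le) auto
    finally show ?thesis by simp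
  qed
  have "3 * (exp (real k * Re w) * exp (Re w)) / real k \<le> 3 * (exp (real k * Re w) * 1) / 1"
    using k w by (intro frac_le mult_left_mono) auto
  then have "norm (dilog ?u / of_real (real k + 1)) \<le> 3 * exp (real k * Re w)" using d1 by simp
  then show "norm (phase_left k w) \<le> 6 * exp (real k * Re w)"
    unfolding phase_left_def using order_trans[OF norm_triangle_ineq4 add_mono[OF d3]] by fastforce
qed

section \<open>The shifted contour\<close>

text \<open>The contour runs at the heights \<open>y\<close> and \<open>- y\<close>, next to the steepest descent lines at \<open>pi / k\<close> and
  \<open>- pi / k\<close>, where \<open>phase_left\<close> is nearly real and negative. For \<open>k = 1\<close> these lines bound the strip,
  hence the offset \<open>\<epsilon>\<close>.\<close>
locale contour =
  fixes k :: nat and \<epsilon> y :: real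
  assumes k: "k \<ge> 1" and \<epsilon>: "0 < \<epsilon>" "\<epsilon> \<le> 1 / 24" "(2 * real k + 1) * \<epsilon> < pi / real k"
    and y_def: "y = pi / real k - \<epsilon>"
begin

lemma k\<epsilon>: "real k * \<epsilon> \<le> pi / 3" "0 < real k * \<epsilon>"
proof -
  have "2 * real k * \<epsilon> + \<epsilon> < pi / real k" using \<epsilon> by (simp add: algebra_simps)
  also have "pi / real k \<le> pi / 1" using k by (intro divide_left_mono) auto
  finally have 1: "2 * (real k * \<epsilon>) + \<epsilon> < pi" by simp
  have "real k * (2 * (real k * \<epsilon>) + \<epsilon>) < pi"
    using \<epsilon>(3) k by (simp add: pos_less_divide_eq algebra_simps)
  moreover have "1 * (2 * (real k * \<epsilon>) + \<epsilon>) \<le> real k * (2 * (real k * \<epsilon>) + \<epsilon>)"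
    using k \<epsilon> by (intro mult_right_mono) auto
  moreover have "real k * (2 * (real k * \<epsilon>) + \<epsilon>) = real k * \<epsilon> * (2 * real k + 1)" by (simp add: algebra_simps)
  moreover have "real k * \<epsilon> * 3 \<le> real k * \<epsilon> * (2 * real k + 1)" using k \<epsilon> by (intro mult_left_mono) auto
  ultimately show "real k * \<epsilon> \<le> pi / 3" by linarith
  show "0 < real k * \<epsilon>" using k \<epsilon> by simp
qed

lemma cos_k\<epsilon>: "1 / 2 \<le> cos (real k * \<epsilon>)"
  using cos_monotone_0_pi_le[of "real k * \<epsilon>" "pi / 3"] k\<epsilon> by (simp add: cos_60)

text \<open>At height 2 pi / (2 k + 1) the angles k y and (k + 1) y are symmetric about pi. Staying
  above it makes k y the closer one to pi, which yields the sign of Re \<open>log_left\<close>, and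
  also suffices for \<open>phase_gap\<close>.\<close>

lemma y_bounds: "2 * pi / (2 * real k + 1) \<le> y" "y < 2 * pi / (real k + 1)" "0 < y"
proof -
  have cp: "0 < 2 * real k + 1" by simp
  have "\<epsilon> < pi / real k / (2 * real k + 1)"
    unfolding pos_less_divide_eq[OF cp] using \<epsilon>(3) by (simp only: mult.commute)
  moreover have "pi / real k - pi / real k / (2 * real k + 1) = 2 * pi / (2 * real k + 1)"
  proof -
    have "p / a - p / a / b = 2 * p / b" if "b = 2 * a + 1" "a > 0" for p a b :: real
    proof -
      have "p / a / b * b = p / a" using that by simp
      then have "p / a - p / a / b = p / a / b * (b - 1)" by (simp only: right_diff_distrib mult_1_right)
      then show ?thesis using that by simp
    qed
    then show ?thesis using k by simp
  qed
  ultimately show 1: "2 * pi / (2 * real k + 1) \<le> y" unfolding y_def by linarith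
  have "pi / real k \<le> 2 * pi / (real k + 1)" using k by (simp add: field_simps)
  then show "y < 2 * pi / (real k + 1)" using \<epsilon> unfolding y_def by linarith
  have "0 < 2 * pi / (2 * real k + 1)" by (intro divide_pos_pos) auto
  then show "0 < y" using 1 by linarith
qed

lemma ky: "real k * y = pi - real k * \<epsilon>" "(real k + 1) * y = pi + (pi / real k - (real k + 1) * \<epsilon>)"
  using k by (auto simp: y_def field_simps)

text \<open>The claim is norm (1 - exp ((k + 1) w)) <= norm (1 - exp (k w)). With t = exp (Re w) the
  squares are 1 + t^(2n) - 2 t^n cos (n y). For n = k the cosine is at most - 1/2 and no larger than
  for n = k + 1, and the powers of t are larger.\<close>

lemma Re_log_left_nonpos:
  assumes w: "Re w < 0" "\<bar>Im w\<bar> = y"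
  shows "Re (log_left k w) \<le> 0"
proof -
  define t where "t = exp (Re w)"
  have t: "0 < t" "t < 1" using w by (auto simp: t_def)
  have sq: "norm (1 - exp (of_real (real n) * w)) ^ 2 = 1 + (t ^ n)\<^sup>2 - 2 * t ^ n * cos (real n * y)" for n
  proof -
    have "exp (of_real (real n) * w) = of_real (t ^ n) * cis (real n * Im w)"
      by (simp add: exp_eq_polar t_def exp_of_nat_mult[symmetric])
    moreover have "cos (real n * Im w) = cos (real n * y)"
      using w(2) by (cases "Im w \<ge> 0") (auto simp: abs_if split: if_splits)
    ultimately show ?thesis
      by (simp only: norm_one_minus_power_sq) (simp add: power2_eq_square algebra_simps)
  qed
  have n1: "real (k + 1) = real k + 1" by simp
  have c1: "cos (real k * y) = - cos (real k * \<epsilon>)" unfolding ky by (simp add: cos_diff)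
  have c2: "cos (real (k + 1) * y) = - cos (pi / real k - (real k + 1) * \<epsilon>)" unfolding n1 ky by (simp add: cos_add)
  have c3: "cos (pi / real k - (real k + 1) * \<epsilon>) \<le> cos (real k * \<epsilon>)"
  proof (rule cos_monotone_0_pi_le)
    show "0 \<le> real k * \<epsilon>" using k\<epsilon> by simp
    show "real k * \<epsilon> \<le> pi / real k - (real k + 1) * \<epsilon>" using \<epsilon>(3) by (simp add: algebra_simps)
    have "pi / real k \<le> pi / 1" using k by (intro divide_left_mono) auto
    moreover have "0 \<le> (real k + 1) * \<epsilon>" using \<epsilon> by simp
    ultimately show "pi / real k - (real k + 1) * \<epsilon> \<le> pi" by simp
  qed
  have tk: "t ^ (k + 1) \<le> t ^ k" "0 \<le> t ^ (k+1)" using t by (auto simp: mult_left_le_one_le)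
  have "t ^ (k + 1) * cos (pi / real k - (real k + 1) * \<epsilon>) \<le> t ^ (k + 1) * cos (real k * \<epsilon>)"
    using c3 t by (intro mult_left_mono) auto
  also have "\<dots> \<le> t ^ k * cos (real k * \<epsilon>)" using tk cos_k\<epsilon> by (intro mult_right_mono) auto
  finally have "- (t ^ k * cos (real k * y)) \<ge> - (t ^ (k+1) * cos (real (k+1) * y))" unfolding c1 c2 by simp
  moreover have "(t ^ (k+1))\<^sup>2 \<le> (t ^ k)\<^sup>2" using tk by (intro power_mono) auto
  ultimately have "norm (1 - exp (of_real (real (k + 1)) * w)) ^ 2 \<le> norm (1 - exp (of_real (real k) * w)) ^ 2"
    unfolding sq by linarith
  then have le: "norm (1 - exp (of_real (real k + 1) * w)) \<le> norm (1 - exp (of_real (real k) * w))"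
    unfolding n1 by (rule power2_le_imp_le) simp
  have nz: "1 - exp (of_real (real k + 1) * w) \<noteq> 0" "1 - exp (of_real (real k) * w) \<noteq> 0"
    using w k by (intro one_minus_exp_notin; simp)+
  have "ln (norm (1 - exp (of_real (real k + 1) * w))) \<le> ln (norm (1 - exp (of_real (real k) * w)))"
    using le nz by (subst ln_le_cancel_iff) auto
  then show ?thesis unfolding log_left_def minus_complex.sel Re_Ln[OF nz(1)] Re_Ln[OF nz(2)] by simp
qed

text \<open>At this height the leading term exp (k w) / k has argument pi up to k \<epsilon>: it is
  negative up to an imaginary part of relative size O(\<epsilon>). For Re w <= ln \<epsilon> the
  correction has relative size \<epsilon> as well.\<close>

lemma phase_left_small:
  assumes w: "\<bar>Im w\<bar> = y" "Re w \<le> ln \<epsilon>"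
  shows "Re (phase_left k w) \<le> - exp (real k * Re w) / (4 * real k)"
    "\<bar>Im (phase_left k w)\<bar> \<le> 7 * \<epsilon> * exp (real k * Re w)"
proof -
  have "exp (Re w) \<le> exp (ln \<epsilon>)" using w by (simp only: exp_le_cancel_iff)
  then have e: "exp (Re w) \<le> \<epsilon>" using \<epsilon> by simp
  have "ln \<epsilon> < 0" using \<epsilon> by (intro ln_less_zero) auto
  then have neg: "Re w < 0" using w by linarith
  define E where "E = exp (real k * Re w)"
  have E: "E > 0" by (simp add: E_def)
  have kr: "real k \<ge> 1" using k by simp
  have ek: "exp (of_nat k * w) / of_nat k = of_real (E / real k) * cis (real k * Im w)"
    by (simp add: exp_eq_polar E_def)
  have cs: "cos (real k * Im w) = - cos (real k * \<epsilon>)" "\<bar>sin (real k * Im w)\<bar> = \<bar>sin (real k * \<epsilon>)\<bar>"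
  proof -
    have "cos (real k * Im w) = cos (real k * y)" "\<bar>sin (real k * Im w)\<bar> = \<bar>sin (real k * y)\<bar>"
      using w(1) by (cases "Im w \<ge> 0"; auto simp: abs_if split: if_splits)+
    then show "cos (real k * Im w) = - cos (real k * \<epsilon>)" "\<bar>sin (real k * Im w)\<bar> = \<bar>sin (real k * \<epsilon>)\<bar>"
      unfolding ky by (simp_all add: cos_diff sin_diff)
  qed
  have d: "norm (phase_left k w - of_real (E / real k) * cis (real k * Im w)) \<le> 6 * E * \<epsilon> / real k"
  proof -
    have "norm (phase_left k w - exp (of_nat k * w) / of_nat k) \<le> 6 * E * exp (Re w) / real k"
      unfolding E_def by (rule phase_left_estimates(1)[OF k neg])
    also have "\<dots> \<le> 6 * E * \<epsilon> / real k" using e E kr by (intro divide_right_mono mult_left_mono) auto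
    finally show ?thesis unfolding ek .
  qed
  have "Re (phase_left k w) \<le> Re (of_real (E / real k) * cis (real k * Im w)) + 6 * E * \<epsilon> / real k"
    using order_trans[OF abs_Re_le_cmod d] by (simp add: abs_le_iff)
  also have "Re (of_real (E / real k) * cis (real k * Im w)) + 6 * E * \<epsilon> / real k
      = - (E / real k * (cos (real k * \<epsilon>) - 6 * \<epsilon>))"
    using cs(1) by (simp add: right_diff_distrib mult_ac)
  \<comment> \<open>Here \<epsilon> <= 1/24 enters: cos (k \<epsilon>) - 6 \<epsilon> >= 1/2 -
    1/4.\<close>
  also have "\<dots> \<le> - (E / real k * (1 / 4))"
    using cos_k\<epsilon> \<epsilon> E kr by (intro le_imp_neg_le mult_left_mono) auto
  finally show "Re (phase_left k w) \<le> - exp (real k * Re w) / (4 * real k)" by (simp add: E_def)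
  have "\<bar>Im (phase_left k w)\<bar> \<le> \<bar>Im (of_real (E / real k) * cis (real k * Im w))\<bar> + 6 * E * \<epsilon> / real k"
    using order_trans[OF abs_Im_le_cmod d] unfolding minus_complex.sel by linarith
  also have "\<bar>Im (of_real (E / real k) * cis (real k * Im w))\<bar> = E / real k * \<bar>sin (real k * \<epsilon>)\<bar>"
    using cs(2) E by (simp add: abs_mult)
  also have "\<dots> \<le> E / real k * (real k * \<epsilon>)"
    using abs_sin_x_le_abs_x[of "real k * \<epsilon>"] k\<epsilon>(2) E by (intro mult_left_mono) auto
  also have "\<dots> = E * \<epsilon>" using kr by simp
  also have "6 * E * \<epsilon> / real k \<le> 6 * E * \<epsilon> / 1" using E \<epsilon> kr by (intro divide_left_mono) auto
  finally show "\<bar>Im (phase_left k w)\<bar> \<le> 7 * \<epsilon> * exp (real k * Re w)" by (simp add: E_def)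
qed

lemma Re_phase_left_decreasing:
  assumes "a \<le> b" "b < 0" "\<bar>\<eta>\<bar> = y"
  shows "Re (phase_left k (Complex b \<eta>)) \<le> Re (phase_left k (Complex a \<eta>))"
proof (rule DERIV_nonpos_imp_nonincreasing[OF assms(1)])
  fix x assume x: "a \<le> x" "x \<le> b"
  let ?w = "Complex x \<eta>"
  have neg: "Re ?w < 0" using x assms by simp
  have eq: "Complex u \<eta> = of_real u + \<i> * of_real \<eta>" for u by (simp add: complex_eq_iff)
  have "((\<lambda>u. phase_left k (of_real u + \<i> * of_real \<eta>)) has_vector_derivative log_left k ?w) (at x)"
  proof (rule has_vector_derivative_real_field)
    have d: "(phase_left k has_field_derivative log_left k ?w) (at (of_real x + \<i> * of_real \<eta>))"
      using phase_left_has_derivative[OF k neg] unfolding eq .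
    have "((\<lambda>z. phase_left k (z + \<i> * of_real \<eta>)) has_field_derivative log_left k ?w * 1) (at (of_real x))"
      by (rule DERIV_chain2[where g="\<lambda>z. z + \<i> * of_real \<eta>" and x="of_real x", OF d]) (auto intro!: derivative_eq_intros)
    then show "((\<lambda>z. phase_left k (z + \<i> * of_real \<eta>)) has_field_derivative log_left k ?w) (at (of_real x))" by simp
  qed
  then have "((\<lambda>u. Re (phase_left k (Complex u \<eta>))) has_vector_derivative Re (log_left k ?w)) (at x)"
    unfolding eq by (rule bounded_linear.has_vector_derivative[OF bounded_linear_Re])
  then show "\<exists>z. ((\<lambda>x. Re (phase_left k (Complex x \<eta>))) has_real_derivative z) (at x) \<and> z \<le> 0"
    using Re_log_left_nonpos[OF neg] assms(3) by (auto simp: has_real_derivative_iff_has_vector_derivative)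
qed

text \<open>Beyond ln \<epsilon> the leading-term estimate fails, but Re \<open>phase_left\<close>
  keeps decreasing towards the axis, so its value at ln \<epsilon> is an upper bound.\<close>

lemma Re_phase_left_far:
  assumes "ln \<epsilon> \<le> b" "b < 0" "\<bar>\<eta>\<bar> = y"
  shows "Re (phase_left k (Complex b \<eta>)) \<le> - (\<epsilon> ^ k) / (4 * real k)"
proof -
  have "Re (phase_left k (Complex b \<eta>)) \<le> Re (phase_left k (Complex (ln \<epsilon>) \<eta>))"
    by (rule Re_phase_left_decreasing[OF assms])
  also have "\<dots> \<le> - exp (real k * ln \<epsilon>) / (4 * real k)"
    using phase_left_small(1)[of "Complex (ln \<epsilon>) \<eta>"] assms by simp
  also have "exp (real k * ln \<epsilon>) = \<epsilon> ^ k" using \<epsilon> by (simp add: exp_of_nat_mult)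
  finally show ?thesis .
qed

text \<open>Left of ln \<epsilon> the modulus is comparable to exp (c / s), and only the imaginary
  part gains a factor \<epsilon>, from sin x <= x. Right of ln \<epsilon> the modulus itself is
  exponentially smaller.\<close>

lemma horizontal_integrand_bounds:
  assumes K: "K \<ge> 0" and s: "0 < s" "s \<le> 1" and \<eta>: "\<bar>\<eta>\<bar> = y" and x: "x < 0"
    and f: "norm (f * exp (- (of_real c + phase_left k (Complex x \<eta>)) / of_real s) - 1) \<le> K * s"
  shows "x \<le> ln \<epsilon> \<Longrightarrow> \<bar>Im f\<bar> \<le> exp (c / s) * (7 * \<epsilon> * (exp (real k * x) / s * exp (- exp (real k * x) / (4 * real k * s))) + K * s)"
    "ln \<epsilon> \<le> x \<Longrightarrow> \<bar>Im f\<bar> \<le> exp (c / s) * ((1 + K) * exp (- (\<epsilon> ^ k) / (4 * real k * s)))"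
proof -
  define \<phi> where "\<phi> = phase_left k (Complex x \<eta>)"
  define \<rho> where "\<rho> = f * exp (- (of_real c + \<phi>) / of_real s) - 1"
  have \<rho>: "norm \<rho> \<le> K * s" using f by (simp add: \<rho>_def \<phi>_def)
  have "exp ((of_real c + \<phi>) / of_real s) * exp (- (of_real c + \<phi>) / of_real s) = 1"
    by (simp only: minus_divide_left[symmetric] exp_minus_inverse)
  then have "f = exp ((of_real c + \<phi>) / of_real s) * (1 + \<rho>)" unfolding \<rho>_def by (simp add: mult_ac)
  also have "exp ((of_real c + \<phi>) / of_real s) = of_real (exp (c / s)) * exp (\<phi> / of_real s)"
    by (simp add: exp_add[symmetric] exp_of_real[symmetric] add_divide_distrib)
  finally have fe: "f = of_real (exp (c / s)) * (exp (\<phi> / of_real s) * (1 + \<rho>))" by (simp only: mult.assoc)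
  have ne: "norm (exp (\<phi> / of_real s)) = exp (Re \<phi> / s)" by simp
  { assume xl: "x \<le> ln \<epsilon>"
    note b = phase_left_small[of "Complex x \<eta>", simplified, OF \<eta> xl, folded \<phi>_def]
    define E where "E = exp (real k * x)"
    have re: "exp (Re \<phi> / s) \<le> exp (- E / (4 * real k * s))"
    proof -
      have "Re \<phi> / s \<le> (- E / (4 * real k)) / s" using b(1) s by (intro divide_right_mono) (auto simp: E_def)
      then show ?thesis by simp
    qed
    have re1: "exp (Re \<phi> / s) \<le> 1"
    proof -
      have "- E / (4 * real k * s) \<le> 0" using s k by (simp add: E_def)
      then show ?thesis using re by (meson exp_le_one_iff order_trans)
    qed
    have "\<bar>Im (exp (\<phi> / of_real s))\<bar> = exp (Re \<phi> / s) * \<bar>sin (Im \<phi> / s)\<bar>"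
      by (simp add: Im_exp abs_mult)
    also have "\<dots> \<le> exp (Re \<phi> / s) * (\<bar>Im \<phi>\<bar> / s)"
      using abs_sin_x_le_abs_x[of "Im \<phi> / s"] s by (intro mult_left_mono) auto
    also have "\<dots> \<le> exp (- E / (4 * real k * s)) * (7 * \<epsilon> * E / s)"
      using re b(2) s \<epsilon> by (intro mult_mono divide_right_mono) (auto simp: E_def)
    finally have i1: "\<bar>Im (exp (\<phi> / of_real s))\<bar> \<le> 7 * \<epsilon> * (E / s * exp (- E / (4 * real k * s)))"
      by (simp add: mult_ac)
    have "\<bar>Im (exp (\<phi> / of_real s) * \<rho>)\<bar> \<le> norm (exp (\<phi> / of_real s) * \<rho>)" by (rule abs_Im_le_cmod)
    also have "\<dots> \<le> 1 * (K * s)" unfolding norm_mult ne using re1 \<rho> by (intro mult_mono) auto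
    finally have i2: "\<bar>Im (exp (\<phi> / of_real s) * \<rho>)\<bar> \<le> K * s" by simp
    have "exp (\<phi> / of_real s) * (1 + \<rho>) = exp (\<phi> / of_real s) + exp (\<phi> / of_real s) * \<rho>" by (simp add: algebra_simps)
    then have "\<bar>Im (exp (\<phi> / of_real s) * (1 + \<rho>))\<bar> \<le> 7 * \<epsilon> * (E / s * exp (- E / (4 * real k * s))) + K * s"
      using i1 i2 by simp
    then show "\<bar>Im f\<bar> \<le> exp (c / s) * (7 * \<epsilon> * (exp (real k * x) / s * exp (- exp (real k * x) / (4 * real k * s))) + K * s)"
      unfolding fe E_def[symmetric] by (simp add: abs_mult)
  }
  { assume xl: "ln \<epsilon> \<le> x"
    have "Re \<phi> \<le> - (\<epsilon> ^ k) / (4 * real k)" unfolding \<phi>_def by (rule Re_phase_left_far[OF xl x \<eta>])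
    then have "Re \<phi> / s \<le> - (\<epsilon> ^ k) / (4 * real k) / s" using s by (intro divide_right_mono) auto
    then have re: "exp (Re \<phi> / s) \<le> exp (- (\<epsilon> ^ k) / (4 * real k * s))" by simp
    have "K * s \<le> K" using K s by (simp add: mult_left_le)
    then have "norm (1 + \<rho>) \<le> 1 + K" using \<rho> norm_triangle_ineq[of 1 \<rho>] by simp
    then have "norm (exp (\<phi> / of_real s) * (1 + \<rho>)) \<le> exp (- (\<epsilon> ^ k) / (4 * real k * s)) * (1 + K)"
      unfolding norm_mult ne using re by (intro mult_mono) auto
    then have "norm f \<le> exp (c / s) * ((1 + K) * exp (- (\<epsilon> ^ k) / (4 * real k * s)))"
      unfolding fe norm_mult norm_of_real by (simp add: mult_ac)
    then show "\<bar>Im f\<bar> \<le> exp (c / s) * ((1 + K) * exp (- (\<epsilon> ^ k) / (4 * real k * s)))"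
      using abs_Im_le_cmod[of f] by linarith
  }
qed

text \<open>At Re w = - L the phase differs from c by O(s^2), so division by s still leaves an error
  O(s).\<close>

lemma vertical_integrand_bound:
  assumes K: "K \<ge> 0" and s: "0 < s" "s \<le> 1" and L: "exp (- real k * L) = s\<^sup>2" "L > 0"
    and f: "norm (f * exp (- (of_real c + phase_left k (Complex (- L) v)) / of_real s) - 1) \<le> K * s"
  shows "norm (f - of_real (exp (c / s))) \<le> exp (c / s) * ((6 + K) * exp 6 * s)"
proof -
  define \<phi> where "\<phi> = phase_left k (Complex (- L) v)"
  define \<rho> where "\<rho> = f * exp (- (of_real c + \<phi>) / of_real s) - 1"
  have \<rho>: "norm \<rho> \<le> K * s" using f by (simp add: \<rho>_def \<phi>_def)
  have "exp ((of_real c + \<phi>) / of_real s) * exp (- (of_real c + \<phi>) / of_real s) = 1"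
    by (simp only: minus_divide_left[symmetric] exp_minus_inverse)
  then have "f = exp ((of_real c + \<phi>) / of_real s) * (1 + \<rho>)" unfolding \<rho>_def by (simp add: mult_ac)
  also have "exp ((of_real c + \<phi>) / of_real s) = of_real (exp (c / s)) * exp (\<phi> / of_real s)"
    by (simp add: exp_add[symmetric] exp_of_real[symmetric] add_divide_distrib)
  finally have fe: "f - of_real (exp (c / s)) = of_real (exp (c / s)) * ((exp (\<phi> / of_real s) - 1) + exp (\<phi> / of_real s) * \<rho>)"
    by (simp add: algebra_simps)
  have "norm \<phi> \<le> 6 * exp (real k * (- L))"
    using phase_left_estimates(2)[OF k, of "Complex (- L) v"] L(2) by (simp add: \<phi>_def)
  then have "norm \<phi> \<le> 6 * s\<^sup>2" using L(1) by simp
  then have n: "norm (\<phi> / of_real s) \<le> 6 * s"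
    using s by (simp add: norm_divide pos_divide_le_eq power2_eq_square)
  then have n6: "norm (\<phi> / of_real s) \<le> 6" using s by simp
  have e6: "norm (exp (\<phi> / of_real s)) \<le> exp 6"
    using norm_exp[of "\<phi> / of_real s"] n6 by (meson exp_le_cancel_iff order_trans)
  have "norm (exp (\<phi> / of_real s) - 1) \<le> (6 * s) * exp 6"
  proof -
    have "norm (\<phi> / of_real s) * exp (norm (\<phi> / of_real s)) \<le> (6 * s) * exp 6"
      using n n6 s by (intro mult_mono) auto
    then show ?thesis using norm_exp_minus_1_le by (rule order_trans[rotated])
  qed
  moreover have "norm (exp (\<phi> / of_real s) * \<rho>) \<le> exp 6 * (K * s)"
    unfolding norm_mult using e6 \<rho> by (intro mult_mono) auto
  ultimately have "norm ((exp (\<phi> / of_real s) - 1) + exp (\<phi> / of_real s) * \<rho>) \<le> (6 + K) * exp 6 * s"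
    by (intro order_trans[OF norm_triangle_ineq]) (simp add: algebra_simps)
  then show ?thesis unfolding fe norm_mult norm_of_real by (simp add: mult_left_mono)
qed

end

section \<open>Increments along the contour and the tail\<close>

lemma increment_bound:
  fixes u \<phi> :: "real \<Rightarrow> real"
  assumes "a \<le> b" "continuous_on {a..b} u" "continuous_on {a..b} \<phi>"
    and "\<And>x. a < x \<Longrightarrow> x < b \<Longrightarrow> (u has_real_derivative u' x) (at x)"
    and "\<And>x. a < x \<Longrightarrow> x < b \<Longrightarrow> (\<phi> has_real_derivative \<phi>' x) (at x)"
    and "\<And>x. a < x \<Longrightarrow> x < b \<Longrightarrow> \<bar>u' x\<bar> \<le> \<phi>' x"
  shows "\<bar>u b - u a\<bar> \<le> \<phi> b - \<phi> a"
proof -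
  have "\<phi> a - u a \<le> \<phi> b - u b"
  proof (rule DERIV_nonneg_imp_increasing_open[OF assms(1)])
    fix x assume x: "a < x" "x < b"
    show "\<exists>y. ((\<lambda>x. \<phi> x - u x) has_real_derivative y) (at x) \<and> 0 \<le> y"
      using DERIV_diff[OF assms(5)[OF x] assms(4)[OF x]] assms(6)[OF x] by (intro exI[of _ "\<phi>' x - u' x"]) auto
  qed (intro continuous_intros assms)
  moreover have "\<phi> a + u a \<le> \<phi> b + u b"
  proof (rule DERIV_nonneg_imp_increasing_open[OF assms(1)])
    fix x assume x: "a < x" "x < b"
    show "\<exists>y. ((\<lambda>x. \<phi> x + u x) has_real_derivative y) (at x) \<and> 0 \<le> y"
      using DERIV_add[OF assms(5)[OF x] assms(4)[OF x]] assms(6)[OF x] by (intro exI[of _ "\<phi>' x + u' x"]) auto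
  qed (intro continuous_intros assms)
  ultimately show ?thesis by linarith
qed

lemma integrable_gauss4: "integrable lborel (\<lambda>v::real. exp (- (v\<^sup>2 / 4)))"
proof -
  have "integrable lborel (\<lambda>v. sqrt (2 * pi * (sqrt 2)\<^sup>2) * normal_density 0 (sqrt 2) v)"
    by (intro integrable_mult_right integrable_normal_density) simp
  then show ?thesis by (simp add: normal_density_def)
qed

text \<open>For s <= 1 the excess (v^2 - y^2) / s may be replaced by v^2 - y^2, which leaves an
  integral free of s.\<close>

lemma gap_int_tail:
  assumes k: "k \<ge> 1" and s: "0 < s" "s \<le> 1" and y: "y > 0"
    and Z: "\<And>v. norm (gap_int k s (\<i> * of_real v)) \<le> exp (Z / sqrt s - (v\<^sup>2 / 4 + P) / s)"
  shows "norm (\<integral>v. indicator (- {-y..y}) v *\<^sub>R gap_int k s (\<i> * of_real v) \<partial>lborel) \<le>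
     exp (Z / sqrt s - (y\<^sup>2 / 4 + P) / s) * (\<integral>v. exp (- ((v\<^sup>2 - y\<^sup>2) / 4)) \<partial>lborel)"
proof -
  have "integrable lborel (\<lambda>v. exp (y\<^sup>2 / 4) * exp (- (v\<^sup>2 / 4)))"
    by (intro integrable_mult_right integrable_gauss4)
  also have "(\<lambda>v. exp (y\<^sup>2 / 4) * exp (- (v\<^sup>2 / 4))) = (\<lambda>v. exp (- ((v\<^sup>2 - y\<^sup>2) / 4)))"
    by (simp add: exp_add[symmetric] diff_divide_distrib)
  finally have int: "integrable lborel (\<lambda>v. exp (- ((v\<^sup>2 - y\<^sup>2) / 4)))" .
  let ?A = "exp (Z / sqrt s - (y\<^sup>2 / 4 + P) / s)"
  have "norm (\<integral>v. indicator (- {-y..y}) v *\<^sub>R gap_int k s (\<i> * of_real v) \<partial>lborel) \<le>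
     (\<integral>v. norm (indicator (- {-y..y}) v *\<^sub>R gap_int k s (\<i> * of_real v)) \<partial>lborel)"
    by (rule integral_norm_bound)
  also have "\<dots> \<le> (\<integral>v. ?A * exp (- ((v\<^sup>2 - y\<^sup>2) / 4)) \<partial>lborel)"
  proof (rule integral_mono)
    have "integrable lborel (\<lambda>v. indicator (- {-y..y}) v *\<^sub>R gap_int k s (\<i> * of_real v))"
      using gap_series_eq_integral(1)[OF s(1) k] by (rule integrable_mult_indicator[rotated]) auto
    then show "integrable lborel (\<lambda>v. norm (indicator (- {-y..y}) v *\<^sub>R gap_int k s (\<i> * of_real v)))"
      by (rule integrable_norm)
    show "integrable lborel (\<lambda>v. ?A * exp (- ((v\<^sup>2 - y\<^sup>2) / 4)))" using int by (rule integrable_mult_right)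
    fix v :: real
    show "norm (indicator (- {-y..y}) v *\<^sub>R gap_int k s (\<i> * of_real v)) \<le> ?A * exp (- ((v\<^sup>2 - y\<^sup>2) / 4))"
    proof (cases "v \<in> {-y..y}")
      case False
      then have "y \<le> \<bar>v\<bar>" by auto
      then have "y\<^sup>2 \<le> v\<^sup>2" using y by (simp add: abs_le_square_iff[symmetric])
      then have "(v\<^sup>2 - y\<^sup>2) / 4 * 1 \<le> (v\<^sup>2 - y\<^sup>2) / 4 * (1 / s)" using s by (intro mult_left_mono) auto
      moreover have "Z / sqrt s - (v\<^sup>2 / 4 + P) / s = Z / sqrt s - (y\<^sup>2 / 4 + P) / s - (v\<^sup>2 - y\<^sup>2) / 4 * (1 / s)"
        using s by (simp add: diff_divide_distrib add_divide_distrib)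
      ultimately have "exp (Z / sqrt s - (v\<^sup>2 / 4 + P) / s) \<le> exp (Z / sqrt s - (y\<^sup>2 / 4 + P) / s - (v\<^sup>2 - y\<^sup>2) / 4)"
        by simp
      also have "\<dots> = ?A * exp (- ((v\<^sup>2 - y\<^sup>2) / 4))" by (simp add: exp_add[symmetric])
      finally show ?thesis using Z[of v] False by (simp add: indicator_def)
    qed simp
  qed
  also have "\<dots> = ?A * (\<integral>v. exp (- ((v\<^sup>2 - y\<^sup>2) / 4)) \<partial>lborel)" by simp
  finally show ?thesis .
qed

context contour
begin

text \<open>The tail has exponent y^2 / 4 + P and the main term 2 P, where P is the subtracted
  fraction; the difference must be positive. With y >= 2 pi / (2 k + 1) it reduces to (2 k + 1)^2 <
  6 k (k + 1).\<close>

lemma phase_gap: "0 < y\<^sup>2 / 4 - pi\<^sup>2 / (6 * real k * (real k + 1))"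
proof -
  have "(2 * pi / (2 * real k + 1))\<^sup>2 \<le> y\<^sup>2" using y_bounds(1) by (intro power_mono) auto
  then have "pi\<^sup>2 / (2 * real k + 1)\<^sup>2 \<le> y\<^sup>2 / 4" by (simp add: power_divide power_mult_distrib mult.commute)
  moreover have "pi\<^sup>2 / (6 * real k * (real k + 1)) < pi\<^sup>2 / (2 * real k + 1)\<^sup>2"
  proof (rule divide_strict_left_mono)
    have "1 \<le> real k" using k by simp
    then have "1 * 1 \<le> real k * real k" by (intro mult_mono) auto
    then show "(2 * real k + 1)\<^sup>2 < 6 * real k * (real k + 1)"
      using k by (simp add: power2_eq_square algebra_simps)
  qed (use k in \<open>auto intro!: mult_pos_pos add_pos_pos\<close>)
  ultimately show ?thesis by linarith
qed

lemma horizontal_bound: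
  assumes K: "K \<ge> 0" and s: "0 < s" "s \<le> 1" and \<eta>: "\<bar>\<eta>\<bar> = y" and L: "- L \<le> ln \<epsilon>"
    and F: "\<And>x. - L \<le> x \<Longrightarrow> x \<le> 0 \<Longrightarrow> (F has_field_derivative f (Complex x \<eta>)) (at (Complex x \<eta>))"
    and f: "\<And>x. - L \<le> x \<Longrightarrow> x < 0 \<Longrightarrow>
       norm (f (Complex x \<eta>) * exp (- (of_real c + phase_left k (Complex x \<eta>)) / of_real s) - 1) \<le> K * s"
  shows "\<bar>Im (F (Complex 0 \<eta>)) - Im (F (Complex (- L) \<eta>))\<bar> \<le>
     exp (c / s) * (28 * \<epsilon> + K * s * L + (1 + K) * exp (- (\<epsilon> ^ k) / (4 * real k * s)) * \<bar>ln \<epsilon>\<bar>)"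
proof -
  define u where "u = (\<lambda>x. Im (F (Complex x \<eta>)))"
  have eq: "Complex x \<eta> = of_real x + \<i> * of_real \<eta>" for x by (simp add: complex_eq_iff)
  have du: "(u has_real_derivative Im (f (Complex x \<eta>))) (at x)" if "- L \<le> x" "x \<le> 0" for x
  proof -
    have "((\<lambda>x. F (of_real x + \<i> * of_real \<eta>)) has_vector_derivative f (Complex x \<eta>)) (at x)"
    proof (rule has_vector_derivative_real_field)
      have d: "(F has_field_derivative f (Complex x \<eta>)) (at (of_real x + \<i> * of_real \<eta>))"
        using F[OF that] unfolding eq .
      have "((\<lambda>z. F (z + \<i> * of_real \<eta>)) has_field_derivative f (Complex x \<eta>) * 1) (at (of_real x))"
        by (rule DERIV_chain2[where g="\<lambda>z. z + \<i> * of_real \<eta>" and x="of_real x", OF d]) (auto intro!: derivative_eq_intros)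
      then show "((\<lambda>z. F (z + \<i> * of_real \<eta>)) has_field_derivative f (Complex x \<eta>)) (at (of_real x))" by simp
    qed
    then have "((\<lambda>x. Im (F (Complex x \<eta>))) has_vector_derivative Im (f (Complex x \<eta>))) (at x)"
      unfolding eq by (rule bounded_linear.has_vector_derivative[OF bounded_linear_Im])
    then show ?thesis by (simp add: u_def has_real_derivative_iff_has_vector_derivative)
  qed
  have cu: "continuous_on {a..b} u" if "- L \<le> a" "b \<le> 0" for a b
    by (rule DERIV_continuous_on, rule has_field_derivative_at_within, rule du) (use that in auto)
  have le0: "ln \<epsilon> < 0" using \<epsilon> by (intro ln_less_zero) auto
  define X where "X = exp (c / s)"
  have X: "X > 0" by (simp add: X_def)
  have kp: "real k > 0" using k by simp
  define g where "g = (\<lambda>x. exp (- exp (real k * x) / (4 * real k * s)))"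
  \<comment> \<open>An explicit primitive of the bound: the derivative of - g is g exp (k x) / (4
    s), so 28 = 7 * 4. The increment of g is at most 1, which makes this contribution O(\<epsilon>)
    uniformly in s although the contour grows.\<close>
  define \<phi> where "\<phi> = (\<lambda>x. X * (28 * \<epsilon> * (- g x) + K * s * x))"
  define \<phi>' where "\<phi>' = (\<lambda>x. X * (7 * \<epsilon> * (exp (real k * x) / s * g x) + K * s))"
  have d\<phi>: "(\<phi> has_real_derivative \<phi>' x) (at x)" for x
    unfolding \<phi>_def \<phi>'_def g_def using kp s by (auto intro!: derivative_eq_intros simp: field_simps)
  have "\<bar>u (ln \<epsilon>) - u (- L)\<bar> \<le> \<phi> (ln \<epsilon>) - \<phi> (- L)"
  proof (rule increment_bound[OF L, where u'="\<lambda>x. Im (f (Complex x \<eta>))" and \<phi>'=\<phi>'])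
    show "continuous_on {- L..ln \<epsilon>} u" using le0 by (intro cu) auto
    show "continuous_on {- L..ln \<epsilon>} \<phi>" by (rule DERIV_continuous_on, rule has_field_derivative_at_within, rule d\<phi>)
    fix x assume x: "- L < x" "x < ln \<epsilon>"
    show "(u has_real_derivative Im (f (Complex x \<eta>))) (at x)" using x le0 by (intro du) auto
    show "(\<phi> has_real_derivative \<phi>' x) (at x)" by (rule d\<phi>)
    have x0: "x < 0" using x le0 by simp
    show "\<bar>Im (f (Complex x \<eta>))\<bar> \<le> \<phi>' x"
      unfolding \<phi>'_def X_def g_def
      by (rule horizontal_integrand_bounds(1)[OF K s \<eta> x0 f]) (use x x0 in auto)
  qed
  also have "\<phi> (ln \<epsilon>) - \<phi> (- L) = X * (28 * \<epsilon> * (g (- L) - g (ln \<epsilon>)) + K * s * (ln \<epsilon> + L))"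
    by (simp add: \<phi>_def algebra_simps)
  also have "\<dots> \<le> X * (28 * \<epsilon> * 1 + K * s * L)"
  proof (intro mult_left_mono add_mono)
    have "- exp (real k * - L) / (4 * real k * s) \<le> 0" using kp s by simp
    then have "g (- L) \<le> 1" unfolding g_def by simp
    moreover have "0 \<le> g (ln \<epsilon>)" by (simp add: g_def)
    ultimately show "g (- L) - g (ln \<epsilon>) \<le> 1" by simp
  qed (use \<epsilon> K s X le0 in auto)
  finally have 1: "\<bar>u (ln \<epsilon>) - u (- L)\<bar> \<le> X * (28 * \<epsilon> + K * s * L)" by simp
  define M where "M = X * ((1 + K) * exp (- (\<epsilon> ^ k) / (4 * real k * s)))"
  have "\<bar>u 0 - u (ln \<epsilon>)\<bar> \<le> M * 0 - M * ln \<epsilon>"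
  proof (rule increment_bound[where u'="\<lambda>x. Im (f (Complex x \<eta>))" and \<phi>'="\<lambda>_. M"])
    show "ln \<epsilon> \<le> 0" using le0 by simp
    show "continuous_on {ln \<epsilon>..0} u" using L by (intro cu) auto
    show "continuous_on {ln \<epsilon>..0} (\<lambda>x. M * x)" by (intro continuous_intros)
    fix x assume x: "ln \<epsilon> < x" "x < 0"
    show "(u has_real_derivative Im (f (Complex x \<eta>))) (at x)" using x L by (intro du) auto
    show "((\<lambda>x. M * x) has_real_derivative M) (at x)" by (auto intro!: derivative_eq_intros)
    show "\<bar>Im (f (Complex x \<eta>))\<bar> \<le> M"
      unfolding M_def X_def
      by (rule horizontal_integrand_bounds(2)[OF K s \<eta> x(2) f]) (use x L in auto)
  qed
  also have "M * 0 - M * ln \<epsilon> = X * ((1 + K) * exp (- (\<epsilon> ^ k) / (4 * real k * s)) * \<bar>ln \<epsilon>\<bar>)"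
    using le0 by (simp add: M_def mult_ac)
  finally have 2: "\<bar>u 0 - u (ln \<epsilon>)\<bar> \<le> X * ((1 + K) * exp (- (\<epsilon> ^ k) / (4 * real k * s)) * \<bar>ln \<epsilon>\<bar>)" .
  have "\<bar>u 0 - u (- L)\<bar> \<le> X * (28 * \<epsilon> + K * s * L) + X * ((1 + K) * exp (- (\<epsilon> ^ k) / (4 * real k * s)) * \<bar>ln \<epsilon>\<bar>)"
    using 1 2 by linarith
  then show ?thesis unfolding u_def X_def by (simp add: distrib_left)
qed

text \<open>The main term: the increment of the primitive of the constant exp (c / s) over a segment
  of length 2 y.\<close>

lemma vertical_bound:
  assumes K: "K \<ge> 0" and s: "0 < s" "s \<le> 1" and L: "exp (- real k * L) = s\<^sup>2" "L > 0"
    and F: "\<And>v. \<bar>v\<bar> \<le> y \<Longrightarrow> (F has_field_derivative f (Complex (- L) v)) (at (Complex (- L) v))"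
    and f: "\<And>v. \<bar>v\<bar> \<le> y \<Longrightarrow>
       norm (f (Complex (- L) v) * exp (- (of_real c + phase_left k (Complex (- L) v)) / of_real s) - 1) \<le> K * s"
  shows "\<bar>Im (F (Complex (- L) y)) - Im (F (Complex (- L) (- y))) - 2 * y * exp (c / s)\<bar> \<le>
     exp (c / s) * ((6 + K) * exp 6 * s) * (2 * y)"
proof -
  define S where "S = cbox (Complex (- L) (- y)) (Complex (- L) y)"
  have S: "w \<in> S \<longleftrightarrow> w = Complex (- L) (Im w) \<and> \<bar>Im w\<bar> \<le> y" for w
    by (auto simp: S_def in_cbox_complex_iff complex_eq_iff abs_le_iff)
  let ?X = "complex_of_real (exp (c / s))" and ?a = "Complex (- L) y" and ?b = "Complex (- L) (- y)"
  have yp: "y > 0" by (rule y_bounds(3))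
  have "norm ((F ?a - ?X * ?a) - (F ?b - ?X * ?b)) \<le> (exp (c / s) * ((6 + K) * exp 6 * s)) * norm (?a - ?b)"
  proof (rule field_differentiable_bound[where S=S and f'="\<lambda>w. f w - ?X"])
    show "convex S" by (simp add: S_def)
    fix w assume "w \<in> S"
    then have w: "w = Complex (- L) (Im w)" "\<bar>Im w\<bar> \<le> y" using S by blast+
    have "(F has_field_derivative f w) (at w)" using F[OF w(2)] w(1) by simp
    then have "((\<lambda>w. F w - ?X * w) has_field_derivative f w - ?X) (at w)"
      by (auto intro!: derivative_eq_intros)
    then show "((\<lambda>w. F w - ?X * w) has_field_derivative f w - ?X) (at w within S)"
      by (rule has_field_derivative_at_within)
    show "norm (f w - ?X) \<le> exp (c / s) * ((6 + K) * exp 6 * s)"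
      using vertical_integrand_bound[OF K s L f[OF w(2)]] w(1) by simp
  qed (use yp in \<open>auto simp: S\<close>)
  also have ab: "?a - ?b = \<i> * of_real (2 * y)" by (simp add: complex_eq_iff)
  then have "norm (?a - ?b) = 2 * y" using yp by (simp add: norm_mult)
  finally have n: "norm ((F ?a - ?X * ?a) - (F ?b - ?X * ?b)) \<le> exp (c / s) * ((6 + K) * exp 6 * s) * (2 * y)" .
  have "(F ?a - ?X * ?a) - (F ?b - ?X * ?b) = F ?a - F ?b - ?X * (?a - ?b)" by (simp add: algebra_simps)
  then have "Im ((F ?a - ?X * ?a) - (F ?b - ?X * ?b)) = Im (F ?a) - Im (F ?b) - 2 * y * exp (c / s)"
    unfolding ab by simp
  then show ?thesis using order_trans[OF abs_Im_le_cmod n] by simp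
qed

text \<open>The segment of the axis between - y and y is replaced, through a primitive of the
  continued integrand, by three sides with corners - L + \<i> y and - L - \<i> y; the rest of the
  axis is the tail.\<close>

lemma gap_series_near:
  obtains K Z I :: real where
    "\<And>s. 0 < s \<Longrightarrow> s < 1 \<Longrightarrow> - (2 / real k * ln (1 / s)) \<le> ln \<epsilon> \<Longrightarrow>
      \<bar>gap_series k (exp (- s)) 0 * sqrt (2 * pi * s) * exp (- phase_const k / s) - 2 * y\<bar> \<le>
      exp (Z / sqrt s - (y\<^sup>2 / 4 - pi\<^sup>2 / (6 * real k * (real k + 1))) / s) * I
      + 2 * (28 * \<epsilon> + K * s * (2 / real k * ln (1 / s)) + (1 + K) * exp (- (\<epsilon> ^ k) / (4 * real k * s)) * \<bar>ln \<epsilon>\<bar>)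
      + (6 + K) * exp 6 * s * (2 * y)"
proof -
  obtain \<Phi> \<Lambda> where \<Lambda>: "\<Lambda> holomorphic_on strip k"
    and d\<Phi>: "\<And>w. w \<in> strip k \<Longrightarrow> (\<Phi> has_field_derivative \<Lambda> w) (at w)"
    and \<Lambda>l: "\<And>w. w \<in> strip k \<Longrightarrow> Re w < 0 \<Longrightarrow> \<Lambda> w = log_left k w"
    and \<Lambda>r: "\<And>w. w \<in> strip k \<Longrightarrow> Re w > 0 \<Longrightarrow> \<Lambda> w = w + log_left k (- w)"
    and \<Phi>l: "\<And>w. w \<in> strip k \<Longrightarrow> Re w < 0 \<Longrightarrow> \<Phi> w = of_real (phase_const k) + phase_left k w"
    and \<Phi>r: "\<And>w. w \<in> strip k \<Longrightarrow> Re w > 0 \<Longrightarrow> \<Phi> w = w\<^sup>2 / 2 - phase_left k (- w)"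
    by (rule phase_exists[OF k]) (rule that)
  have "\<exists>K\<ge>0. \<forall>s N w. 0 < s \<longrightarrow> s \<le> 1 \<longrightarrow> \<bar>Im w\<bar> \<le> y \<longrightarrow> Re w + real N * s > - s / 2 \<longrightarrow>
     norm (gap_ext k s \<Lambda> N w * exp (- \<Phi> w / of_real s) - 1) \<le> K * s"
    by (rule gap_ext_asymp[OF k \<Lambda> d\<Phi> \<Lambda>l \<Lambda>r \<Phi>r y_bounds(2)])
  then obtain K where K: "K \<ge> 0" and Kb': "\<forall>s N w. 0 < s \<longrightarrow> s \<le> 1 \<longrightarrow> \<bar>Im w\<bar> \<le> y \<longrightarrow> Re w + real N * s > - s / 2 \<longrightarrow>
     norm (gap_ext k s \<Lambda> N w * exp (- \<Phi> w / of_real s) - 1) \<le> K * s"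
    by (elim exE conjE) (rule that)
  note Kb = Kb'[rule_format]
  define P where "P = pi\<^sup>2 / (6 * real k * (real k + 1))"
  define c where "c = phase_const k"
  have cP: "c = - 2 * P" using k by (simp add: c_def P_def phase_const_def)
  obtain Z where Z': "\<And>s v. 0 < s \<Longrightarrow>
    norm (gap_int k s (\<i> * of_real v)) \<le> exp (Z / sqrt s - (v\<^sup>2 / 4 + pi\<^sup>2 / (6 * real k * (real k + 1))) / s)"
    by (rule gap_int_imag_bound[OF k]) (rule that)
  note Z = Z'[folded P_def]
  define I where "I = (\<integral>v. exp (- ((v\<^sup>2 - y\<^sup>2) / 4)) \<partial>lborel)"
  have yp: "y > 0" by (rule y_bounds(3))
  show ?thesis
  proof (rule that[of Z I K], fold c_def P_def)
    fix s :: real assume s: "0 < s" "s < 1" and Le: "- (2 / real k * ln (1 / s)) \<le> ln \<epsilon>"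
    have s1: "s \<le> 1" using s by simp
    \<comment> \<open>This makes exp (- k L) = s^2, far enough for an O(s) error on the vertical
      side while s L still tends to 0.\<close>
    define L where "L = 2 / real k * ln (1 / s)"
    have kp: "real k > 0" using k by simp
    have Lp: "L > 0" unfolding L_def using kp s by (intro mult_pos_pos) auto
    have Le: "- L \<le> ln \<epsilon>" using Le by (simp add: L_def)
    have eL: "exp (- real k * L) = s\<^sup>2"
    proof -
      have "- real k * L = ln s + ln s" using kp s by (simp add: L_def ln_div)
      then show ?thesis using s by (simp only: exp_add exp_ln power2_eq_square)
    qed
    \<comment> \<open>Enough steps for the continuation to cover Re w >= - L.\<close>
    define N where "N = nat \<lceil>L / s\<rceil>"
    have "L / s \<le> real N" unfolding N_def by (rule real_nat_ceiling_ge)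
    then have NL: "L \<le> real N * s" using s by (simp add: pos_divide_le_eq)
    define A where "A = strip k \<inter> {w. Re w > - s / 2 - real N * s}"
    have A: "convex A" "open A" unfolding A_def
      by (auto intro!: convex_Int open_Int strip_convex strip_open convex_halfplanes)
    define f where "f = gap_ext k s \<Lambda> N"
    have holf: "f holomorphic_on A" unfolding f_def A_def by (rule gap_ext_holomorphic[OF k s(1) \<Lambda>])
    obtain F where F': "\<And>w. w \<in> A \<Longrightarrow> (F has_field_derivative f w) (at w within A)"
      using holomorphic_convex_primitive'[OF A holf] by blast
    have F: "(F has_field_derivative f w) (at w)" if "w \<in> A" for w
      using F'[OF that] by (simp only: at_within_open[OF that A(2)])
    have inS: "w \<in> strip k" if "\<bar>Im w\<bar> \<le> y" for w
      using that y_bounds(2) by (simp add: strip_def)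
    have inA: "w \<in> A" if "\<bar>Im w\<bar> \<le> y" "- L \<le> Re w" for w
      using inS[OF that(1)] that(2) NL s by (simp add: A_def)
    have est: "norm (f w * exp (- (of_real c + phase_left k w) / of_real s) - 1) \<le> K * s"
      if "\<bar>Im w\<bar> \<le> y" "- L \<le> Re w" "Re w < 0" for w
    proof -
      have "Re w + real N * s > - s / 2" using that NL s by simp
      then show ?thesis
        using Kb[OF s(1) s1 that(1)] \<Phi>l[OF inS[OF that(1)] that(3)] by (simp add: f_def c_def)
    qed
    define X where "X = exp (c / s)"
    have X: "X > 0" by (simp add: X_def)
    define H where "H = 28 * \<epsilon> + K * s * L + (1 + K) * exp (- (\<epsilon> ^ k) / (4 * real k * s)) * \<bar>ln \<epsilon>\<bar>"
    define V where "V = (6 + K) * exp 6 * s"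
    have hor: "\<bar>Im (F (Complex 0 \<eta>)) - Im (F (Complex (- L) \<eta>))\<bar> \<le> X * H" if \<eta>: "\<bar>\<eta>\<bar> = y" for \<eta>
      unfolding X_def H_def
    proof (rule horizontal_bound[OF K s(1) s1 \<eta> Le, where f=f])
      show "(F has_field_derivative f (Complex x \<eta>)) (at (Complex x \<eta>))" if "- L \<le> x" "x \<le> 0" for x
        using that \<eta> by (intro F inA) auto
      show "norm (f (Complex x \<eta>) * exp (- (of_real c + phase_left k (Complex x \<eta>)) / of_real s) - 1) \<le> K * s" if "- L \<le> x" "x < 0" for x
        using that \<eta> by (intro est) auto
    qed
    have ver: "\<bar>Im (F (Complex (- L) y)) - Im (F (Complex (- L) (- y))) - 2 * y * X\<bar> \<le> X * V * (2 * y)"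
      unfolding X_def V_def
    proof (rule vertical_bound[OF K s(1) s1 eL Lp, where f=f])
      show "(F has_field_derivative f (Complex (- L) v)) (at (Complex (- L) v))" if "\<bar>v\<bar> \<le> y" for v
        using that Lp by (intro F inA) auto
      show "norm (f (Complex (- L) v) * exp (- (of_real c + phase_left k (Complex (- L) v)) / of_real s) - 1) \<le> K * s" if "\<bar>v\<bar> \<le> y" for v
        using that Lp by (intro est) auto
    qed
    have fg: "f (\<i> * of_real v) = gap_int k s (\<i> * of_real v)" if "\<bar>v\<bar> \<le> y" for v
      unfolding f_def using s inS[of "\<i> * of_real v"] that by (intro gap_ext_eq k \<Lambda>r) auto
    have mid: "(\<integral>v. indicator {-y..y} v *\<^sub>R gap_int k s (\<i> * of_real v) \<partial>lborel) = - \<i> * F (\<i> * of_real y) - - \<i> * F (\<i> * of_real (- y))"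
    proof (rule integral_FTC_atLeastAtMost)
      show "- y \<le> y" using yp by simp
      have "continuous_on {- y..y} (\<lambda>v. f (\<i> * of_real v))"
        using inA Lp
        by (intro continuous_on_compose2[OF holomorphic_on_imp_continuous_on[OF holf]] continuous_intros) auto
      then show "continuous_on {- y..y} (\<lambda>v. gap_int k s (\<i> * of_real v))"
        by (rule continuous_on_cong[THEN iffD1, rotated -1]) (auto simp: fg)
      fix v assume v: "- y \<le> v" "v \<le> y"
      then have va: "\<bar>v\<bar> \<le> y" by simp
      have "((\<lambda>v. - \<i> * F (\<i> * of_real v)) has_vector_derivative f (\<i> * of_real v)) (at v)"
      proof (rule has_vector_derivative_real_field)
        have d: "(F has_field_derivative f (\<i> * of_real v)) (at (\<i> * of_real v))"
          using va Lp by (intro F inA) auto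
        have "((\<lambda>z. - \<i> * F (\<i> * z)) has_field_derivative - \<i> * (f (\<i> * of_real v) * \<i>)) (at (of_real v))"
          by (intro DERIV_cmult DERIV_chain2[where g="\<lambda>z. \<i> * z" and x="of_real v", OF d]) (auto intro!: derivative_eq_intros)
        moreover have "- \<i> * (f (\<i> * of_real v) * \<i>) = f (\<i> * of_real v)" by (simp add: algebra_simps)
        ultimately show "((\<lambda>z. - \<i> * F (\<i> * z)) has_field_derivative f (\<i> * of_real v)) (at (of_real v))" by simp
      qed
      then show "((\<lambda>v. - \<i> * F (\<i> * of_real v)) has_vector_derivative gap_int k s (\<i> * of_real v)) (at v within {- y..y})"
        unfolding fg[OF va] by (rule has_vector_derivative_at_within)
    qed
    define G where "G = gap_series k (exp (- s)) 0 * sqrt (2 * pi * s)"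
    define T where "T = (\<integral>v. indicator (- {-y..y}) v *\<^sub>R gap_int k s (\<i> * of_real v) \<partial>lborel)"
    have int: "integrable lborel (\<lambda>v. gap_int k s (\<i> * of_real v))" by (rule gap_series_eq_integral(1)[OF s(1) k])
    have i1: "integrable lborel (\<lambda>v. indicator {-y..y} v *\<^sub>R gap_int k s (\<i> * of_real v))"
      and i2: "integrable lborel (\<lambda>v. indicator (- {-y..y}) v *\<^sub>R gap_int k s (\<i> * of_real v))"
      using int by (auto intro!: integrable_mult_indicator)
    have "of_real G = (\<integral>v. gap_int k s (\<i> * of_real v) \<partial>lborel)"
      unfolding G_def by (rule gap_series_eq_integral(2)[OF s(1) k])
    also have "\<dots> = (\<integral>v. indicator {-y..y} v *\<^sub>R gap_int k s (\<i> * of_real v) + indicator (- {-y..y}) v *\<^sub>R gap_int k s (\<i> * of_real v) \<partial>lborel)"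
      by (intro Bochner_Integration.integral_cong refl) (auto simp: indicator_def)
    also have "\<dots> = (- \<i> * F (\<i> * of_real y) - - \<i> * F (\<i> * of_real (- y))) + T"
      unfolding Bochner_Integration.integral_add[OF i1 i2] mid T_def ..
    finally have "Re (of_real G) = Re ((- \<i> * F (\<i> * of_real y) - - \<i> * F (\<i> * of_real (- y))) + T)" by (rule arg_cong)
    \<comment> \<open>The left side is real, so only imaginary parts of the primitive enter. Along
      the horizontal sides dw is real, so they are governed by the imaginary part of the
      integrand.\<close>
    then have G: "G = Im (F (\<i> * of_real y)) - Im (F (\<i> * of_real (- y))) + Re T" by simp
    have cx: "\<i> * of_real v = Complex 0 v" for v by (simp add: complex_eq_iff)
    have Tn: "norm T \<le> exp (Z / sqrt s - (y\<^sup>2 / 4 + P) / s) * I"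
      unfolding T_def I_def by (rule gap_int_tail[OF k s(1) s1 yp Z[OF s(1)]])
    have "\<bar>Re T\<bar> \<le> norm T" by (rule abs_Re_le_cmod)
    then have "\<bar>G - 2 * y * X\<bar> \<le> exp (Z / sqrt s - (y\<^sup>2 / 4 + P) / s) * I + X * (2 * H) + X * (V * (2 * y))"
      using hor[of y] hor[of "- y"] ver Tn yp unfolding G cx by (simp add: abs_le_iff)
    then have m1: "\<bar>G - 2 * y * X\<bar> * exp (- c / s) \<le> (exp (Z / sqrt s - (y\<^sup>2 / 4 + P) / s) * I + X * (2 * H) + X * (V * (2 * y))) * exp (- c / s)"
      by (intro mult_right_mono) auto
    have Xc: "X * exp (- c / s) = 1" unfolding X_def by (simp add: exp_minus)
    have m2: "\<bar>G - 2 * y * X\<bar> * exp (- c / s) = \<bar>G * exp (- c / s) - 2 * y\<bar>"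
    proof -
      have "\<bar>G - 2 * y * X\<bar> * exp (- c / s) = \<bar>(G - 2 * y * X) * exp (- c / s)\<bar>" by (simp add: abs_mult)
      also have "(G - 2 * y * X) * exp (- c / s) = G * exp (- c / s) - 2 * y * (X * exp (- c / s))" by (simp add: algebra_simps)
      also have "\<dots> = G * exp (- c / s) - 2 * y" unfolding Xc by simp
      finally show ?thesis .
    qed
    have m3: "(exp (Z / sqrt s - (y\<^sup>2 / 4 + P) / s) * I + X * (2 * H) + X * (V * (2 * y))) * exp (- c / s)
       = exp (Z / sqrt s - (y\<^sup>2 / 4 + P) / s) * exp (- c / s) * I + (X * exp (- c / s)) * (2 * H) + (X * exp (- c / s)) * (V * (2 * y))"
      by (simp add: algebra_simps)
    \<comment> \<open>Since c = - 2 P, normalising by exp (- c / s) turns the tail exponent into the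
      quantity of \<open>phase_gap\<close>.\<close>
    have m4: "exp (Z / sqrt s - (y\<^sup>2 / 4 + P) / s) * exp (- c / s) = exp (Z / sqrt s - (y\<^sup>2 / 4 - P) / s)"
    proof -
      have "Z / sqrt s - (y\<^sup>2 / 4 + P) / s + - c / s = Z / sqrt s - (y\<^sup>2 / 4 - P) / s"
        unfolding cP by (simp add: add_divide_distrib diff_divide_distrib)
      then show ?thesis by (simp only: exp_add[symmetric])
    qed
    show "\<bar>gap_series k (exp (- s)) 0 * sqrt (2 * pi * s) * exp (- c / s) - 2 * y\<bar> \<le>
      exp (Z / sqrt s - (y\<^sup>2 / 4 - P) / s) * I
      + 2 * (28 * \<epsilon> + K * s * (2 / real k * ln (1 / s)) + (1 + K) * exp (- (\<epsilon> ^ k) / (4 * real k * s)) * \<bar>ln \<epsilon>\<bar>)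
      + (6 + K) * exp 6 * s * (2 * y)"
      using m1[unfolded m2 m3 m4 Xc] unfolding G_def[symmetric] H_def V_def L_def by simp
  qed
qed

end

lemma exp_inverse_tendsto_0:
  fixes d :: real
  assumes "d > 0"
  shows "((\<lambda>s. exp (Z / sqrt s - d / s)) \<longlongrightarrow> 0) (at_right 0)" "((\<lambda>s. exp (- d / s)) \<longlongrightarrow> 0) (at_right 0)"
proof -
  have "((\<lambda>s. exp (\<bar>Z\<bar> / sqrt s - d / s)) \<longlongrightarrow> 0) (at_right 0)"
  proof (cases "Z = 0")
    case True
    then show ?thesis using assms by simp real_asymp
  next
    case False
    then have "\<bar>Z\<bar> > 0" by simp
    then show ?thesis using assms by real_asymp
  qed
  then show "((\<lambda>s. exp (Z / sqrt s - d / s)) \<longlongrightarrow> 0) (at_right 0)"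
    by (rule Lim_null_comparison[rotated])
       (rule eventually_at_right_less[THEN eventually_mono], auto intro!: divide_right_mono)
  show "((\<lambda>s. exp (- d / s)) \<longlongrightarrow> 0) (at_right 0)" using assms by real_asymp
qed

text \<open>For fixed \<epsilon> the error bound tends to 56 \<epsilon> as s tends to 0; \<epsilon>
  is chosen in advance in terms of the tolerance e.\<close>

theorem gap_series_asymp:
  assumes k: "k \<ge> 1"
  shows "((\<lambda>s. gap_series k (exp (- s)) 0 * sqrt (2 * pi * s) * exp (- phase_const k / s)) \<longlongrightarrow> 2 * pi / real k) (at_right 0)"
proof (rule tendstoI)
  fix e :: real assume e: "e > 0"
  \<comment> \<open>The first two entries meet the requirements of \<open>contour\<close>. The last
    one covers 57 \<epsilon> from the error bound and 2 \<epsilon> from replacing 2 y by 2 pi /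
    k.\<close>
  define \<epsilon> where "\<epsilon> = min (1 / 24) (min (pi / real k / (2 * real k + 1) / 2) (e / 120))"
  define y where "y = pi / real k - \<epsilon>"
  have kp: "real k > 0" using k by simp
  have e0: "\<epsilon> > 0" using e kp by (auto simp: \<epsilon>_def)
  have e1: "\<epsilon> \<le> 1 / 24" "\<epsilon> \<le> e / 120" "\<epsilon> \<le> pi / real k / (2 * real k + 1) / 2"
    unfolding \<epsilon>_def by (rule min.cobounded1, rule min.coboundedI2, rule min.cobounded2, rule min.coboundedI2, rule min.cobounded1)
  have e2: "(2 * real k + 1) * \<epsilon> < pi / real k"
  proof -
    have cp: "0 < 2 * real k + 1" using kp by simp
    have "0 < pi / real k / (2 * real k + 1)" using kp by (intro divide_pos_pos) auto
    moreover have "a < b" if "0 < b" "a \<le> b / 2" for a b :: real using that by linarith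
    ultimately have "\<epsilon> < pi / real k / (2 * real k + 1)" using e1(3) by blast
    then show ?thesis unfolding pos_less_divide_eq[OF cp] by (simp only: mult.commute)
  qed
  interpret contour k \<epsilon> y
    by standard (use k e0 e1 e2 in \<open>auto simp: y_def\<close>)
  obtain K Z I :: real where near: "\<And>s. 0 < s \<Longrightarrow> s < 1 \<Longrightarrow> - (2 / real k * ln (1 / s)) \<le> ln \<epsilon> \<Longrightarrow>
      \<bar>gap_series k (exp (- s)) 0 * sqrt (2 * pi * s) * exp (- phase_const k / s) - 2 * y\<bar> \<le>
      exp (Z / sqrt s - (y\<^sup>2 / 4 - pi\<^sup>2 / (6 * real k * (real k + 1))) / s) * I
      + 2 * (28 * \<epsilon> + K * s * (2 / real k * ln (1 / s)) + (1 + K) * exp (- (\<epsilon> ^ k) / (4 * real k * s)) * \<bar>ln \<epsilon>\<bar>)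
      + (6 + K) * exp 6 * s * (2 * y)"
    by (rule gap_series_near) (rule that)
  define g where "g = (\<lambda>s. exp (Z / sqrt s - (y\<^sup>2 / 4 - pi\<^sup>2 / (6 * real k * (real k + 1))) / s) * I
      + 2 * (28 * \<epsilon> + K * (2 / real k) * (s * ln (1 / s)) + (1 + K) * exp (- (\<epsilon> ^ k / (4 * real k)) / s) * \<bar>ln \<epsilon>\<bar>)
      + (6 + K) * exp 6 * s * (2 * y))"
  have sl: "((\<lambda>s::real. s * ln (1 / s)) \<longlongrightarrow> 0) (at_right 0)" by real_asymp
  have d: "\<epsilon> ^ k / (4 * real k) > 0" using e0 kp by simp
  have "(g \<longlongrightarrow> 0 * I + 2 * (28 * \<epsilon> + K * (2 / real k) * 0 + (1 + K) * 0 * \<bar>ln \<epsilon>\<bar>) + (6 + K) * exp 6 * 0 * (2 * y)) (at_right 0)"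
    unfolding g_def by (intro tendsto_intros exp_inverse_tendsto_0 phase_gap d sl)
  then have "(g \<longlongrightarrow> 56 * \<epsilon>) (at_right 0)" by simp
  moreover have "56 * \<epsilon> < 57 * \<epsilon>" using e0 by simp
  ultimately have ev1: "\<forall>\<^sub>F s in at_right 0. g s < 57 * \<epsilon>" by (rule order_tendstoD)
  have "filterlim (\<lambda>s::real. ln (1 / s)) at_top (at_right 0)" by real_asymp
  then have ev2: "\<forall>\<^sub>F s in at_right 0. - ln \<epsilon> * (real k / 2) \<le> ln (1 / s)"
    by (simp add: filterlim_at_top)
  have ev3: "\<forall>\<^sub>F s::real in at_right 0. 0 < s \<and> s < 1"
    using eventually_at_right_real[of 0 1] by simp
  show "\<forall>\<^sub>F s in at_right 0. dist (gap_series k (exp (- s)) 0 * sqrt (2 * pi * s) * exp (- phase_const k / s)) (2 * pi / real k) < e"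
    using ev1 ev2 ev3
  proof eventually_elim
    case (elim s)
    have "- (2 / real k * ln (1 / s)) \<le> ln \<epsilon>" using elim(2) kp by (simp add: field_simps)
    from near[OF _ _ this] elim(3)
    have "\<bar>gap_series k (exp (- s)) 0 * sqrt (2 * pi * s) * exp (- phase_const k / s) - 2 * y\<bar> \<le> g s"
      by (simp add: g_def mult_ac)
    moreover have "2 * pi / real k = 2 * y + 2 * \<epsilon>" by (simp add: y_def)
    ultimately have "\<bar>gap_series k (exp (- s)) 0 * sqrt (2 * pi * s) * exp (- phase_const k / s) - 2 * pi / real k\<bar> \<le> g s + 2 * \<epsilon>"
      using e0 by linarith
    also have "\<dots> < 59 * \<epsilon>" using elim(1) by simp
    also have "\<dots> \<le> e" using e1(2) e by simp
    finally show ?case by (simp add: dist_real_def)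
  qed
qed

section \<open>The local limit theorem\<close>

definition growth_const :: "nat \<Rightarrow> real" where
  "growth_const k = pi\<^sup>2 / 6 * (1 - 2 / (real k * (real k + 1)))"

lemma growth_const_pos:
  assumes "k \<ge> 2"
  shows "growth_const k > 0"
proof -
  have "2 * 3 \<le> real k * (real k + 1)" using assms by (intro mult_mono) auto
  then have "2 / (real k * (real k + 1)) < 1" by (subst divide_less_eq_1_pos) auto
  then show ?thesis unfolding growth_const_def by (intro mult_pos_pos) auto
qed

text \<open>In the quotient of the asymptotics for k and for 1 the square roots cancel, 2 pi / k
  over 2 pi gives 1 / k, and the difference of the two phase constants is
  \<open>growth_const k\<close>.\<close>

lemma no_seq_gf_asymp:
  assumes k: "k \<ge> 1"
  shows "((\<lambda>s. no_seq_gf k (exp (- s)) * exp (- growth_const k / s)) \<longlongrightarrow> 1 / real k) (at_right 0)"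
proof -
  let ?g = "\<lambda>k s. gap_series k (exp (- s)) 0 * sqrt (2 * pi * s) * exp (- phase_const k / s)"
  have g1: "(?g 1 \<longlongrightarrow> 2 * pi) (at_right 0)" using gap_series_asymp[of 1] by simp
  have "((\<lambda>s. ?g k s / ?g 1 s) \<longlongrightarrow> (2 * pi / real k) / (2 * pi)) (at_right 0)"
    by (intro tendsto_divide gap_series_asymp k g1) simp
  then have lim: "((\<lambda>s. ?g k s / ?g 1 s) \<longlongrightarrow> 1 / real k) (at_right 0)" by simp
  have ev: "\<forall>\<^sub>F s in at_right 0. ?g 1 s > 0" using order_tendstoD(1)[OF g1, of 0] by simp
  have c: "phase_const k - phase_const 1 = growth_const k"
  proof -
    have "p / (3 * a * b) = p / 6 * (2 / (a * b))" for p a b :: real by simp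
    from this[of "pi\<^sup>2" "real k" "real k + 1"] show ?thesis
      by (simp only: phase_const_def growth_const_def right_diff_distrib) simp
  qed
  show ?thesis
  proof (rule Lim_transform_eventually[OF lim])
    show "\<forall>\<^sub>F s in at_right 0. ?g k s / ?g 1 s = no_seq_gf k (exp (- s)) * exp (- growth_const k / s)"
      using ev eventually_at_right_less[of 0]
    proof eventually_elim
      case (elim s)
      have q: "0 < exp (- s)" "exp (- s) < 1" using elim by auto
      have "gap_series k (exp (- s)) 0 = no_seq_gf k (exp (- s)) * gap_series 1 (exp (- s)) 0"
        using no_seq_gf_eq[OF k q] by simp
      moreover have "exp (- phase_const k / s) = exp (- growth_const k / s) * exp (- phase_const 1 / s)"
        unfolding c[symmetric] exp_add[symmetric] by (simp add: diff_divide_distrib)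
      ultimately have "?g k s = no_seq_gf k (exp (- s)) * exp (- growth_const k / s) * ?g 1 s"
        by (simp only: mult_ac)
      moreover have "a / b = x" if "a = x * b" "b > 0" for a b x :: real using that by simp
      ultimately show ?case using elim(1) by blast
    qed
  qed
qed

text \<open>If convergence fails at z, some subsequence stays away from g z. By Montel a further
  subsequence converges on S to a holomorphic function, which agrees with g on a real interval and
  hence everywhere: a contradiction.\<close>

lemma vitali_real_convergence:
  fixes F :: "nat \<Rightarrow> complex \<Rightarrow> complex"
  assumes S: "open S" "connected S" "ball 0 r \<subseteq> S" and r: "r > 0"
    and hol: "\<And>n. F n holomorphic_on S" and g: "g holomorphic_on S"
    and bd: "\<And>n z. z \<in> S \<Longrightarrow> norm (F n z) \<le> M"
    and lim: "\<And>x. \<bar>x\<bar> < r \<Longrightarrow> (\<lambda>n. F n (of_real x)) \<longlonglongrightarrow> g (of_real x)"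
    and z: "z \<in> S"
  shows "(\<lambda>n. F n z) \<longlonglongrightarrow> g z"
proof (rule ccontr)
  assume "\<not> ?thesis"
  then obtain e where e: "e > 0" "\<forall>N. \<exists>n\<ge>N. e \<le> dist (F n z) (g z)"
    unfolding LIMSEQ_def by (meson not_le)
  define B where "B = {n. e \<le> dist (F n z) (g z)}"
  have inf: "infinite B" unfolding infinite_nat_iff_unbounded_le B_def using e by blast
  define r0 where "r0 = enumerate B"
  have r0: "strict_mono r0" "\<And>n. r0 n \<in> B"
    using inf by (auto simp: r0_def strict_mono_enumerate enumerate_in_set)
  obtain G r1 where G: "G holomorphic_on S" "strict_mono (r1 :: nat \<Rightarrow> nat)"
    "\<And>x. x \<in> S \<Longrightarrow> (\<lambda>n. F (r0 (r1 n)) x) \<longlonglongrightarrow> G x"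
  proof (rule Montel[of S "range F" "\<lambda>n. F (r0 n)"])
    show "open S" by (rule S)
    show "h holomorphic_on S" if "h \<in> range F" for h using that hol by auto
    show "\<exists>B. \<forall>h\<in>range F. \<forall>z\<in>K. norm (h z) \<le> B" if "compact K" "K \<subseteq> S" for K
      using that bd by (intro exI[of _ M]) auto
    show "range (\<lambda>n. F (r0 n)) \<subseteq> range F" by auto
  qed (rule that; assumption)
  have sub: "strict_mono (r0 \<circ> r1)" using r0 G by (intro strict_mono_o)
  have eq: "G (of_real x) = g (of_real x)" if "\<bar>x\<bar> < r" for x
  proof -
    have "of_real x \<in> S" using that S(3) by (auto simp: subset_iff)
    then have "(\<lambda>n. F (r0 (r1 n)) (of_real x)) \<longlonglongrightarrow> G (of_real x)" by (rule G)
    moreover have "(\<lambda>n. F (r0 (r1 n)) (of_real x)) \<longlonglongrightarrow> g (of_real x)"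
      using LIMSEQ_subseq_LIMSEQ[OF lim[OF that] sub] by (simp add: o_def)
    ultimately show ?thesis by (rule LIMSEQ_unique)
  qed
  have "G z - g z = 0"
  proof (rule analytic_continuation[of "\<lambda>z. G z - g z" S "of_real ` {-r<..<r}" 0])
    show "(\<lambda>z. G z - g z) holomorphic_on S" by (intro holomorphic_intros G g)
    show "complex_of_real ` {-r<..<r} \<subseteq> S" using S(3) by (auto simp: subset_iff abs_less_iff)
    show "0 \<in> S" using S(3) r by (auto simp: subset_iff)
    show "0 islimpt complex_of_real ` {-r<..<r}"
      unfolding islimpt_approachable
    proof (intro allI impI)
      fix e :: real assume "e > 0"
      then show "\<exists>x'\<in>complex_of_real ` {-r<..<r}. x' \<noteq> 0 \<and> dist x' 0 < e"
        using r by (intro bexI[of _ "of_real (min (e/2) (r/2))"]) auto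
    qed
    show "G z - g z = 0" if "z \<in> complex_of_real ` {-r<..<r}" for z using that eq by (auto simp: abs_less_iff)
  qed (use S z in auto)
  then have "(\<lambda>n. F (r0 (r1 n)) z) \<longlonglongrightarrow> g z" using G(3)[OF z] by simp
  then obtain n where "dist (F (r0 (r1 n)) z) (g z) < e"
    using e(1) unfolding LIMSEQ_def by blast
  then show False using r0(2)[of "r1 n"] by (simp add: B_def)
qed

section \<open>Coefficients as Cauchy integrals\<close>

lemma integral_cis_int:
  fixes j :: int
  shows "(\<integral>\<theta>. indicator {-pi..pi} \<theta> *\<^sub>R cis (of_int j * \<theta>) \<partial>lborel) = (if j = 0 then of_real (2 * pi) else 0)"
proof (cases "j = 0")
  case True
  have "(\<integral>\<theta>. indicator {-pi..pi} \<theta> *\<^sub>R (1::complex) \<partial>lborel) = of_real pi - of_real (- pi)"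
    by (rule integral_FTC_atLeastAtMost) (auto intro!: derivative_eq_intros)
  then show ?thesis using True by simp
next
  case False
  have "(\<integral>\<theta>. indicator {-pi..pi} \<theta> *\<^sub>R cis (of_int j * \<theta>) \<partial>lborel) =
     cis (of_int j * pi) / (\<i> * of_int j) - cis (of_int j * (- pi)) / (\<i> * of_int j)"
  proof (rule integral_FTC_atLeastAtMost)
    show "continuous_on {- pi..pi} (\<lambda>\<theta>. cis (of_int j * \<theta>))" by (intro continuous_intros)
    fix x :: real
    have "((\<lambda>\<theta>. exp (\<i> * of_int j * of_real \<theta>) / (\<i> * of_int j)) has_vector_derivative exp (\<i> * of_int j * of_real x)) (at x)"
    proof (rule has_vector_derivative_real_field)
      show "((\<lambda>\<theta>. exp (\<i> * of_int j * \<theta>) / (\<i> * of_int j)) has_field_derivative exp (\<i> * of_int j * of_real x)) (at (of_real x))"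
        using False by (auto intro!: derivative_eq_intros)
    qed
    then show "((\<lambda>\<theta>. cis (of_int j * \<theta>) / (\<i> * of_int j)) has_vector_derivative cis (of_int j * x)) (at x within {- pi..pi})"
      by (simp add: cis_conv_exp mult.assoc has_vector_derivative_at_within)
  qed simp
  moreover have "cis (of_int j * pi) = cis (of_int j * (- pi))"
  proof -
    have "cis (of_int j * pi) = cis (of_int j * (- pi)) * cis (2 * pi * of_int j)" by (simp add: cis_mult algebra_simps)
    then show ?thesis by (simp add: cis_multiple_2pi)
  qed
  ultimately show ?thesis using False by simp
qed

lemma coefficient_integral:
  fixes r :: real
  assumes k: "k \<ge> 1" and r: "0 < r" "r < 1"
  shows "of_real (real (p_no_seq k n) * r ^ n * (2 * pi)) =
    (\<integral>\<theta>. indicator {-pi..pi} \<theta> *\<^sub>R (no_seq_gf k (of_real r * cis \<theta>) * cis (- (real n * \<theta>))) \<partial>lborel)"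
proof -
  let ?p = "\<lambda>m. real (p_no_seq k m)"
  let ?c = "\<lambda>m. complex_of_real (?p m * r ^ m)"
  let ?t = "\<lambda>m \<theta>. indicator {-pi..pi} \<theta> *\<^sub>R (?c m * cis (of_int (int m - int n) * \<theta>))"
  have sm: "summable (\<lambda>m. ?p m * r ^ m)" using k r by (intro p_no_seq_summable) auto
  have nt: "norm (?t m \<theta>) = indicator {-pi..pi} \<theta> * (?p m * r ^ m)" for m \<theta>
    using r by (simp add: norm_mult norm_power indicator_def)
  have int: "integrable lborel (?t m)" for m
    by (rule borel_integrable_atLeastAtMost'[unfolded set_integrable_def]) (intro continuous_intros)
  have I: "(\<integral>\<theta>. ?t m \<theta> \<partial>lborel) = (if m = n then ?c n * of_real (2 * pi) else 0)" for m
  proof -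
    have "(\<integral>\<theta>. ?t m \<theta> \<partial>lborel) = (\<integral>\<theta>. ?c m * (indicator {-pi..pi} \<theta> *\<^sub>R cis (of_int (int m - int n) * \<theta>)) \<partial>lborel)"
      by (simp add: mult_scaleR_right)
    also have "\<dots> = ?c m * (\<integral>\<theta>. indicator {-pi..pi} \<theta> *\<^sub>R cis (of_int (int m - int n) * \<theta>) \<partial>lborel)"
      by (rule integral_mult_right_zero)
    finally show ?thesis unfolding integral_cis_int by simp
  qed
  have ser: "indicator {-pi..pi} \<theta> *\<^sub>R (no_seq_gf k (of_real r * cis \<theta>) * cis (- (real n * \<theta>))) = (\<Sum>m. ?t m \<theta>)" for \<theta>
  proof -
    have "(\<lambda>m. indicator {-pi..pi} \<theta> *\<^sub>R ((of_nat (p_no_seq k m) * (of_real r * cis \<theta>) ^ m) * cis (- (real n * \<theta>)))) sums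
       (indicator {-pi..pi} \<theta> *\<^sub>R (no_seq_gf k (of_real r * cis \<theta>) * cis (- (real n * \<theta>))))"
      using k r by (intro sums_scaleR_right sums_mult2 no_seq_gf_sums) (auto simp: norm_mult)
    also have "(\<lambda>m. indicator {-pi..pi} \<theta> *\<^sub>R ((of_nat (p_no_seq k m) * (of_real r * cis \<theta>) ^ m) * cis (- (real n * \<theta>)))) = (\<lambda>m. ?t m \<theta>)"
      by (auto simp: power_mult_distrib Complex.DeMoivre cis_mult left_diff_distrib mult.assoc)
    finally show ?thesis by (simp add: sums_iff)
  qed
  have "(\<integral>\<theta>. (\<Sum>m. ?t m \<theta>) \<partial>lborel) = (\<Sum>m. \<integral>\<theta>. ?t m \<theta> \<partial>lborel)"
  proof (rule integral_suminf[OF int])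
    show "AE \<theta> in lborel. summable (\<lambda>m. norm (?t m \<theta>))"
      unfolding nt using sm by (intro AE_I2 summable_mult)
    show "summable (\<lambda>m. \<integral>\<theta>. norm (?t m \<theta>) \<partial>lborel)"
    proof -
      have "(\<integral>\<theta>. norm (?t m \<theta>) \<partial>lborel) = 2 * pi * (?p m * r ^ m)" for m
        unfolding nt by simp
      then show ?thesis using sm by (simp only: summable_mult)
    qed
  qed
  also have "\<dots> = ?c n * of_real (2 * pi)"
    unfolding I by (rule sums_unique[symmetric]) (rule sums_single[of n "\<lambda>_. ?c n * of_real (2 * pi)"])
  finally show ?thesis unfolding ser by simp
qed

lemma no_seq_gf_of_real:
  assumes "k \<ge> 1" "\<bar>x\<bar> < 1"
  shows "no_seq_gf k (complex_of_real x) = of_real (no_seq_gf k x)"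
proof -
  have "(\<lambda>n. complex_of_real (real (p_no_seq k n) * x ^ n)) sums of_real (no_seq_gf k x)"
    using no_seq_gf_sums[of k x] assms by (intro sums_of_real) auto
  moreover have "(\<lambda>n. complex_of_real (real (p_no_seq k n) * x ^ n)) sums no_seq_gf k (complex_of_real x)"
    using no_seq_gf_sums[of k "complex_of_real x"] assms by simp
  ultimately show ?thesis by (rule sums_unique2[symmetric])
qed

lemma no_seq_gf_ge_1:
  assumes "k \<ge> 1" "0 \<le> x" "x < 1"
  shows "no_seq_gf k x \<ge> (1::real)"
proof -
  have "{P \<in> partitions 0. \<not> has_k_sequence k P} = {{#}}"
  proof -
    have "\<not> has_k_sequence k {#}" using assms by (auto simp: has_k_sequence_def)
    moreover have "P = {#}" if "P \<in> partitions 0" for P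
      using that by (cases P) (auto simp: partitions_def)
    moreover have "{#} \<in> partitions 0" by (simp add: partitions_def)
    ultimately show ?thesis by blast
  qed
  then have "p_no_seq k 0 = 1" by (simp add: p_no_seq_def)
  moreover have "(\<Sum>n\<in>{0}. real (p_no_seq k n) * x ^ n) \<le> (\<Sum>n. real (p_no_seq k n) * x ^ n)"
    using p_no_seq_summable[OF assms] assms by (intro sum_le_suminf) auto
  ultimately show ?thesis by (simp add: no_seq_gf_def)
qed

text \<open>The moment generating function of (X - n) s powr (3/2), where X takes the value m with
  probability proportional to p_no_seq k m exp (- s m).\<close>

definition tilted_gf :: "nat \<Rightarrow> nat \<Rightarrow> real \<Rightarrow> complex \<Rightarrow> complex" where
  "tilted_gf k n s \<zeta> = no_seq_gf k (exp (- of_real s + of_real (s * sqrt s) * \<zeta>))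
      * exp (- of_real (real n * (s * sqrt s)) * \<zeta>) / of_real (no_seq_gf k (exp (- s)))"

lemma tilted_gf_sums:
  assumes k: "k \<ge> 1" and s: "s > 0" and \<zeta>: "sqrt s * Re \<zeta> < 1"
  shows "(\<lambda>m. of_real (real (p_no_seq k m) * exp (- s) ^ m / no_seq_gf k (exp (- s)))
      * exp (of_real ((real m - real n) * (s * sqrt s)) * \<zeta>)) sums tilted_gf k n s \<zeta>"
proof -
  have "s * (sqrt s * Re \<zeta>) < s * 1" using \<zeta> s by (intro mult_strict_left_mono) auto
  then have z: "norm (exp (- of_real s + of_real (s * sqrt s) * \<zeta>)) < 1" by (simp add: mult_ac)
  have "(\<lambda>m. of_nat (p_no_seq k m) * exp (- of_real s + of_real (s * sqrt s) * \<zeta>) ^ m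
       * exp (- of_real (real n * (s * sqrt s)) * \<zeta>) / of_real (no_seq_gf k (exp (- s)))) sums tilted_gf k n s \<zeta>"
    unfolding tilted_gf_def by (intro sums_divide sums_mult2 no_seq_gf_sums k z)
  moreover have "exp (- of_real s + of_real (s * sqrt s) * \<zeta>) ^ m * exp (- of_real (real n * (s * sqrt s)) * \<zeta>)
      = of_real (exp (- s) ^ m) * exp (of_real ((real m - real n) * (s * sqrt s)) * \<zeta>)" for m
    by (simp add: exp_of_nat_mult[symmetric] exp_add[symmetric] algebra_simps flip: exp_of_real)
  ultimately show ?thesis by (simp add: mult.assoc)
qed

lemma tilted_gf_holomorphic:
  assumes k: "k \<ge> 1" and s: "s > 0"
  shows "tilted_gf k n s holomorphic_on {\<zeta>. Re \<zeta> < 1 / sqrt s}"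
proof -
  have hol: "no_seq_gf k holomorphic_on ball (0::complex) 1"
  proof (rule power_series_holomorphic)
    fix w :: complex assume "w \<in> ball 0 1"
    then show "(\<lambda>n. of_nat (p_no_seq k n) * (w - 0) ^ n) sums no_seq_gf k w"
      using no_seq_gf_sums[OF k, of w] by simp
  qed
  have "(no_seq_gf k \<circ> (\<lambda>\<zeta>. exp (- of_real s + of_real (s * sqrt s) * \<zeta>))) holomorphic_on {\<zeta>. Re \<zeta> < 1 / sqrt s}"
  proof (rule holomorphic_on_compose_gen[OF _ hol])
    show "(\<lambda>\<zeta>. exp (- of_real s + of_real (s * sqrt s) * \<zeta>)) ` {\<zeta>. Re \<zeta> < 1 / sqrt s} \<subseteq> ball 0 1"
    proof clarify
      fix \<zeta> :: complex assume "Re \<zeta> < 1 / sqrt s"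
      then have "sqrt s * Re \<zeta> < 1" using s by (simp add: field_simps)
      then have "s * (sqrt s * Re \<zeta>) < s * 1" using s by (intro mult_strict_left_mono) auto
      then show "exp (- of_real s + of_real (s * sqrt s) * \<zeta>) \<in> ball 0 1" by (simp add: mult_ac)
    qed
  qed (intro holomorphic_intros)
  then have c: "(\<lambda>\<zeta>. no_seq_gf k (exp (- of_real s + of_real (s * sqrt s) * \<zeta>))) holomorphic_on {\<zeta>. Re \<zeta> < 1 / sqrt s}"
    by (simp add: o_def)
  have "no_seq_gf k (exp (- s)) \<noteq> 0" using no_seq_gf_ge_1[OF k, of "exp (- s)"] s by simp
  then show ?thesis unfolding tilted_gf_def[abs_def] by (intro holomorphic_intros c) auto
qed

text \<open>All weights are nonnegative and exp (b Re \<zeta>) <= exp (b R) + exp (- b R). Thus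
  convergence at real points alone yields the local bounds required by Vitali's theorem.\<close>

lemma norm_tilted_gf_le:
  assumes k: "k \<ge> 1" and s: "s > 0" and \<zeta>: "sqrt s * R < 1" "\<bar>Re \<zeta>\<bar> \<le> R"
  shows "norm (tilted_gf k n s \<zeta>) \<le> norm (tilted_gf k n s (of_real R)) + norm (tilted_gf k n s (of_real (- R)))"
proof -
  define a where "a m = real (p_no_seq k m) * exp (- s) ^ m / no_seq_gf k (exp (- s))" for m
  define b where "b m = (real m - real n) * (s * sqrt s)" for m
  have a0: "a m \<ge> 0" for m unfolding a_def using no_seq_gf_ge_1[OF k, of "exp (- s)"] s by simp
  have R0: "R \<ge> 0" using \<zeta> by linarith
  have ss: "sqrt s > 0" using s by simp
  have "sqrt s * Re \<zeta> \<le> sqrt s * R" using \<zeta> ss by (intro mult_left_mono) auto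
  then have z1: "sqrt s * Re \<zeta> < 1" using \<zeta> by linarith
  have z2: "sqrt s * Re (of_real R) < 1" using \<zeta> by simp
  have "sqrt s * (- R) \<le> 0" using ss R0 by (simp add: mult_nonneg_nonpos)
  then have z3: "sqrt s * Re (of_real (- R)) < 1" by simp
  note S = tilted_gf_sums[OF k s, of _ n, folded a_def b_def]
  have re: "(\<lambda>m. a m * exp (b m * x)) sums Re (tilted_gf k n s (of_real x))" if "sqrt s * Re (of_real x) < 1" for x
  proof -
    have "of_real (a m) * exp (of_real (b m) * complex_of_real x) = of_real (a m * exp (b m * x))" for m
      by (simp add: exp_of_real[symmetric])
    with S[OF that] have "(\<lambda>m. complex_of_real (a m * exp (b m * x))) sums tilted_gf k n s (of_real x)" by (simp only:)
    from sums_Re[OF this] show ?thesis by (simp only: Re_complex_of_real)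
  qed
  have bd: "norm (of_real (a m) * exp (of_real (b m) * \<zeta>)) \<le> a m * exp (b m * R) + a m * exp (b m * (- R))" for m
  proof -
    have "\<bar>b m * Re \<zeta>\<bar> \<le> \<bar>b m\<bar> * R" unfolding abs_mult using \<zeta> by (intro mult_left_mono) auto
    then have "b m * Re \<zeta> \<le> \<bar>b m\<bar> * R" by linarith
    then have "exp (b m * Re \<zeta>) \<le> exp (\<bar>b m\<bar> * R)" by simp
    also have "\<dots> \<le> exp (b m * R) + exp (b m * (- R))" by (cases "b m \<ge> 0") auto
    finally have "a m * exp (b m * Re \<zeta>) \<le> a m * (exp (b m * R) + exp (b m * (- R)))"
      using a0 by (intro mult_left_mono) auto
    then show ?thesis using a0[of m] by (simp add: norm_mult distrib_left)
  qed
  have s2: "(\<lambda>m. a m * exp (b m * R) + a m * exp (b m * (- R))) sums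
      (Re (tilted_gf k n s (of_real R)) + Re (tilted_gf k n s (of_real (- R))))"
    by (intro sums_add re z2 z3)
  have "norm (tilted_gf k n s \<zeta>) \<le> Re (tilted_gf k n s (of_real R)) + Re (tilted_gf k n s (of_real (- R)))"
    using norm_suminf_le[OF bd sums_summable[OF s2]] S[OF z1] s2 by (simp add: sums_iff)
  also have "\<dots> \<le> norm (tilted_gf k n s (of_real R)) + norm (tilted_gf k n s (of_real (- R)))"
    by (intro add_mono complex_Re_le_cmod)
  finally show ?thesis .
qed

section \<open>Gaussian limit at the saddle point\<close>

text \<open>The saddle point \<open>s = sqrt (\<lambda> / n)\<close> of \<open>n * s + \<lambda> / s\<close>.\<close>
definition saddle :: "nat \<Rightarrow> nat \<Rightarrow> real" where
  "saddle k n = sqrt (growth_const k / real n)"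

lemma saddle_tendsto:
  assumes k: "k \<ge> 2"
  shows "saddle k \<longlonglongrightarrow> 0" "filterlim (saddle k) (at_right 0) sequentially"
    "n > 0 \<Longrightarrow> saddle k n > 0" "n > 0 \<Longrightarrow> real n = growth_const k / (saddle k n)\<^sup>2"
proof -
  have l: "growth_const k > 0" by (rule growth_const_pos[OF k])
  show p: "n > 0 \<Longrightarrow> saddle k n > 0" for n using l by (simp add: saddle_def)
  show "n > 0 \<Longrightarrow> real n = growth_const k / (saddle k n)\<^sup>2" using l by (simp add: saddle_def)
  have "(\<lambda>n. growth_const k / real n) \<longlonglongrightarrow> 0" by (rule lim_const_over_n)
  from tendsto_real_sqrt[OF this] show t: "saddle k \<longlonglongrightarrow> 0" unfolding saddle_def[abs_def] by simp
  show "filterlim (saddle k) (at_right 0) sequentially"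
  proof -
    have "\<forall>\<^sub>F n in sequentially. saddle k n > 0"
      using eventually_gt_at_top[of 0] by eventually_elim (rule p)
    then have "\<forall>\<^sub>F n in sequentially. saddle k n \<in> {0<..} \<and> saddle k n \<noteq> 0" by eventually_elim simp
    then show ?thesis using t by (simp add: filterlim_at)
  qed
qed

text \<open>A real argument x only replaces s by s' = s (1 - x sqrt s), where the real asymptotics
  apply. In \<lambda> / s' - \<lambda> / s the term linear in x is cancelled by n = \<lambda> / s^2,
  and \<lambda> x^2 / (1 - x sqrt s) remains.\<close>

lemma tilted_gf_real_tendsto:
  assumes k: "k \<ge> 2"
  shows "(\<lambda>n. tilted_gf k n (saddle k n) (of_real x)) \<longlonglongrightarrow> exp (of_real (growth_const k) * (of_real x)\<^sup>2)"
proof -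
  have k1: "k \<ge> 1" using k by simp
  let ?l = "growth_const k" and ?G = "\<lambda>s. no_seq_gf k (exp (- s))" and ?s = "saddle k"
  let ?A = "\<lambda>s. ?G s * exp (- ?l / s)"
  let ?s' = "\<lambda>n. ?s n * (1 - sqrt (?s n) * x)"
  have A: "(?A \<longlongrightarrow> 1 / real k) (at_right 0)" by (rule no_seq_gf_asymp[OF k1])
  have s0: "filterlim ?s (at_right 0) sequentially" "?s \<longlonglongrightarrow> 0" using saddle_tendsto[OF k] by auto
  have pos: "\<forall>\<^sub>F n in sequentially. ?s n > 0"
    using eventually_gt_at_top[of 0] by eventually_elim (rule saddle_tendsto(3)[OF k])
  have u: "(\<lambda>n. 1 - sqrt (?s n) * x) \<longlonglongrightarrow> 1 - sqrt 0 * x" by (intro tendsto_intros s0)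
  then have u1: "(\<lambda>n. 1 - sqrt (?s n) * x) \<longlonglongrightarrow> 1" by simp
  have upos: "\<forall>\<^sub>F n in sequentially. 1 - sqrt (?s n) * x > 0" using order_tendstoD(1)[OF u1, of 0] by simp
  have "?s' \<longlonglongrightarrow> 0 * 1" by (intro tendsto_mult s0 u1)
  moreover have "\<forall>\<^sub>F n in sequentially. ?s' n > 0" using pos upos by eventually_elim simp
  ultimately have s'0: "filterlim ?s' (at_right 0) sequentially"
    by (auto simp: filterlim_at elim!: eventually_mono)
  have A1: "(\<lambda>n. ?A (?s n)) \<longlonglongrightarrow> 1 / real k" by (rule filterlim_compose[OF A s0(1)])
  have A2: "(\<lambda>n. ?A (?s' n)) \<longlonglongrightarrow> 1 / real k" by (rule filterlim_compose[OF A s'0])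
  have "(\<lambda>n. ?A (?s' n) / ?A (?s n) * exp (?l * x\<^sup>2 / (1 - sqrt (?s n) * x))) \<longlonglongrightarrow> (1 / real k) / (1 / real k) * exp (?l * x\<^sup>2 / 1)"
    using k by (intro tendsto_intros A1 A2 u1) auto
  then have L: "(\<lambda>n. ?A (?s' n) / ?A (?s n) * exp (?l * x\<^sup>2 / (1 - sqrt (?s n) * x))) \<longlonglongrightarrow> exp (?l * x\<^sup>2)"
    using k by simp
  have "\<forall>\<^sub>F n in sequentially. of_real (?A (?s' n) / ?A (?s n) * exp (?l * x\<^sup>2 / (1 - sqrt (?s n) * x))) = tilted_gf k n (?s n) (of_real x)"
    using pos upos eventually_gt_at_top[of 0]
  proof eventually_elim
    case (elim n)
    define s where "s = ?s n"
    define t where "t = sqrt s"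
    have s: "s > 0" "s = t\<^sup>2" "t > 0" using elim(1) by (auto simp: s_def t_def)
    have ut: "1 - t * x > 0" using elim(2) by (simp add: s_def t_def)
    have n: "real n = ?l / s\<^sup>2" using saddle_tendsto(4)[OF k elim(3)] by (simp add: s_def)
    define s' where "s' = s * (1 - t * x)"
    have s': "s' > 0" using s ut by (simp add: s'_def)
    have e1: "exp (- complex_of_real s + of_real (s * t) * of_real x) = of_real (exp (- s'))"
      by (simp add: s'_def algebra_simps flip: exp_of_real)
    have e2: "exp (- complex_of_real (real n * (s * t)) * of_real x) = of_real (exp (- (real n * s * t * x)))"
      by (simp add: mult_ac flip: exp_of_real)
    have T: "tilted_gf k n s (of_real x) = of_real (?G s' * exp (- (real n * s * t * x)) / ?G s)"
      unfolding tilted_gf_def t_def[symmetric] e1 e2 using no_seq_gf_of_real[OF k1, of "exp (- s')"] s' by simp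
    have G: "?G s > 0" using no_seq_gf_ge_1[OF k1, of "exp (- s)"] s by simp
    have ex: "- ?l / s' - (- ?l / s) + ?l * x\<^sup>2 / (1 - t * x) = - (real n * s * t * x)"
    proof -
      define w where "w = 1 - t * x"
      have w: "w > 0" "t * x = 1 - w" using ut by (auto simp: w_def)
      have "- ?l / (t\<^sup>2 * w) + ?l / t\<^sup>2 + ?l * x\<^sup>2 / w = ?l / (t\<^sup>2 * w) * (w - 1 + (t * x)\<^sup>2)"
        using s(3) w(1) by (simp add: field_simps)
      also have "w - 1 + (t * x)\<^sup>2 = - (t * x) * w" unfolding w(2) by (simp add: power2_eq_square algebra_simps)
      also have "?l / (t\<^sup>2 * w) * (- (t * x) * w) = - (?l / t\<^sup>2) * (t * x)" using w(1) by simp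
      also have "\<dots> = - (real n * s * t * x)" unfolding n s(2) using s(3) by (simp add: power2_eq_square)
      finally show ?thesis unfolding s'_def w_def[symmetric] s(2) by simp
    qed
    have "?A s' / ?A s * exp (?l * x\<^sup>2 / (1 - t * x)) = ?G s' / ?G s * (exp (- ?l / s') / exp (- ?l / s) * exp (?l * x\<^sup>2 / (1 - t * x)))"
      by simp
    also have "exp (- ?l / s') / exp (- ?l / s) * exp (?l * x\<^sup>2 / (1 - t * x)) = exp (- (real n * s * t * x))"
      unfolding ex[symmetric] exp_add exp_diff ..
    finally have "?A s' / ?A s * exp (?l * x\<^sup>2 / (1 - t * x)) = ?G s' * exp (- (real n * s * t * x)) / ?G s" by simp
    then have "of_real (?A s' / ?A s * exp (?l * x\<^sup>2 / (1 - t * x))) = tilted_gf k n s (of_real x)" unfolding T by (simp only:)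
    then show ?case unfolding s'_def t_def s_def .
  qed
  then have "(\<lambda>n. tilted_gf k n (?s n) (of_real x)) \<longlonglongrightarrow> of_real (exp (?l * x\<^sup>2))"
    using tendsto_of_real[OF L] by (rule Lim_transform_eventually[rotated])
  then show ?thesis by (simp flip: exp_of_real)
qed

text \<open>Vitali on a disc around 0 containing z. The index shift by \<open>N\<close> discards the
  terms for which the disc is not yet inside the domain of holomorphy.\<close>

lemma tilted_gf_tendsto:
  assumes k: "k \<ge> 2"
  shows "(\<lambda>n. tilted_gf k n (saddle k n) z) \<longlonglongrightarrow> exp (of_real (growth_const k) * z\<^sup>2)"
proof -
  have k1: "k \<ge> 1" using k by simp
  define R where "R = norm z + 1"
  have R: "R > 0" "norm z < R" by (auto simp: R_def add_nonneg_pos)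
  let ?s = "saddle k"
  have "(\<lambda>n. sqrt (?s n) * R) \<longlonglongrightarrow> sqrt 0 * R" by (intro tendsto_intros saddle_tendsto k)
  then have "\<forall>\<^sub>F n in sequentially. sqrt (?s n) * R < 1" using order_tendstoD(2)[of _ "sqrt 0 * R" _ 1] by simp
  moreover have "\<forall>\<^sub>F n in sequentially. ?s n > 0"
    using eventually_gt_at_top[of 0] by eventually_elim (rule saddle_tendsto(3)[OF k])
  ultimately have "\<forall>\<^sub>F n in sequentially. sqrt (?s n) * R < 1 \<and> ?s n > 0" by (rule eventually_conj)
  then obtain N where N: "\<And>n. n \<ge> N \<Longrightarrow> sqrt (?s n) * R < 1" "\<And>n. n \<ge> N \<Longrightarrow> ?s n > 0"
    unfolding eventually_sequentially by blast
  define F where "F = (\<lambda>n. tilted_gf k (n + N) (?s (n + N)))"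
  define h where "h = (\<lambda>n. norm (F n (of_real R)) + norm (F n (of_real (- R))))"
  have lim: "(\<lambda>n. F n (of_real x)) \<longlonglongrightarrow> exp (of_real (growth_const k) * (of_real x)\<^sup>2)" for x
    unfolding F_def using LIMSEQ_ignore_initial_segment[OF tilted_gf_real_tendsto[OF k, of x], of N] .
  have "convergent h" unfolding h_def by (rule convergentI[OF tendsto_add[OF tendsto_norm[OF lim] tendsto_norm[OF lim]]])
  then obtain M where M: "\<And>n. norm (h n) \<le> M" using convergent_imp_Bseq BseqE by blast
  have sub: "Re w < 1 / sqrt (?s (n + N))" if "w \<in> ball 0 R" for w n
  proof -
    have "Re w < R" using complex_Re_le_cmod[of w] that by simp
    also have "R < 1 / sqrt (?s (n + N))" using N[of "n + N"] by (simp add: field_simps)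
    finally show ?thesis .
  qed
  have "(\<lambda>n. F n z) \<longlonglongrightarrow> exp (of_real (growth_const k) * z\<^sup>2)"
  proof (rule vitali_real_convergence[of "ball 0 R" R F "\<lambda>z. exp (of_real (growth_const k) * z\<^sup>2)" M])
    show "F n holomorphic_on ball 0 R" for n
      unfolding F_def by (rule holomorphic_on_subset[OF tilted_gf_holomorphic[OF k1 N(2)]]) (use sub in auto)
    show "norm (F n w) \<le> M" if "w \<in> ball 0 R" for n w
    proof -
      have "\<bar>Re w\<bar> \<le> R" using abs_Re_le_cmod[of w] that by simp
      then have "norm (F n w) \<le> h n" unfolding F_def h_def by (intro norm_tilted_gf_le k1 N) auto
      then show ?thesis using M[of n] by simp
    qed
  qed (use R lim in \<open>auto intro!: holomorphic_intros\<close>)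
  then show ?thesis unfolding F_def by (rule LIMSEQ_offset)
qed

text \<open>The Cauchy integral on the circle of radius exp (- s), rescaled by \<theta> = s sqrt s
  t.\<close>

lemma coefficient_tilted_integral:
  assumes k: "k \<ge> 1" and s: "s > 0"
  shows "of_real (2 * pi * real (p_no_seq k n)) =
    of_real (exp (real n * s) * no_seq_gf k (exp (- s)) * (s * sqrt s)) *
     (\<integral>t. indicator {-pi..pi} (s * sqrt s * t) *\<^sub>R tilted_gf k n s (\<i> * of_real t) \<partial>lborel)"
proof -
  define \<sigma> where "\<sigma> = s * sqrt s"
  have \<sigma>: "\<sigma> > 0" using s by (simp add: \<sigma>_def)
  define r where "r = exp (- s)"
  have r: "0 < r" "r < 1" using s by (auto simp: r_def)
  have G: "no_seq_gf k r \<noteq> 0" using no_seq_gf_ge_1[OF k, of r] r by simp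
  let ?f = "\<lambda>\<theta>. indicator {-pi..pi} \<theta> *\<^sub>R (no_seq_gf k (of_real r * cis \<theta>) * cis (- (real n * \<theta>)))"
  have f: "?f (0 + \<sigma> * t) = of_real (no_seq_gf k r) * (indicator {-pi..pi} (\<sigma> * t) *\<^sub>R tilted_gf k n s (\<i> * of_real t))" for t
  proof -
    have "exp (- complex_of_real s + of_real \<sigma> * (\<i> * of_real t)) = of_real r * cis (\<sigma> * t)"
      unfolding exp_add r_def by (simp add: cis_conv_exp mult_ac flip: exp_of_real)
    moreover have "exp (- of_real (real n * \<sigma>) * (\<i> * of_real t)) = cis (- (real n * (\<sigma> * t)))"
      by (simp add: cis_conv_exp mult_ac)
    ultimately have "tilted_gf k n s (\<i> * of_real t) =
        no_seq_gf k (of_real r * cis (\<sigma> * t)) * cis (- (real n * (\<sigma> * t))) / of_real (no_seq_gf k r)"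
      unfolding tilted_gf_def \<sigma>_def[symmetric] r_def[symmetric] by (simp only:)
    then show ?thesis using G by (simp add: scaleR_conv_of_real)
  qed
  have "of_real (real (p_no_seq k n) * r ^ n * (2 * pi)) = (\<integral>\<theta>. ?f \<theta> \<partial>lborel)"
    by (rule coefficient_integral[OF k r])
  also have "\<dots> = \<bar>\<sigma>\<bar> *\<^sub>R (\<integral>t. ?f (0 + \<sigma> * t) \<partial>lborel)"
    using \<sigma> by (intro lborel_integral_real_affine) simp
  also have "\<dots> = of_real (\<sigma> * no_seq_gf k r) * (\<integral>t. indicator {-pi..pi} (\<sigma> * t) *\<^sub>R tilted_gf k n s (\<i> * of_real t) \<partial>lborel)"
    unfolding f integral_mult_right_zero using \<sigma> by (simp add: scaleR_conv_of_real mult_ac)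
  finally have "of_real (exp (real n * s)) * of_real (real (p_no_seq k n) * r ^ n * (2 * pi)) =
     of_real (exp (real n * s)) * (of_real (\<sigma> * no_seq_gf k r) * (\<integral>t. indicator {-pi..pi} (\<sigma> * t) *\<^sub>R tilted_gf k n s (\<i> * of_real t) \<partial>lborel))"
    by (rule arg_cong)
  moreover have "of_real (exp (real n * s)) * of_real (real (p_no_seq k n) * r ^ n * (2 * pi)) = complex_of_real (2 * pi * real (p_no_seq k n))"
  proof -
    have "exp (real n * s) * r ^ n = 1" unfolding r_def exp_of_nat_mult[symmetric] exp_add[symmetric] by simp
    moreover have "e * q = 1 \<Longrightarrow> e * (P * q * c) = c * P" for e q P c :: real by algebra
    ultimately have "exp (real n * s) * (real (p_no_seq k n) * r ^ n * (2 * pi)) = 2 * pi * real (p_no_seq k n)" by blast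
    then show ?thesis unfolding of_real_mult[symmetric] by (simp only:)
  qed
  ultimately show ?thesis unfolding \<sigma>_def r_def by (simp only: of_real_mult mult_ac)
qed

section \<open>Domination and the limit of the integral\<close>

lemma integrable_inverse_1_plus_square_UNIV: "integrable lborel (\<lambda>t::real. inverse (1 + t\<^sup>2))"
  using integrable_inverse_1_plus_square by (simp add: set_integrable_def einterval_def)

text \<open>One majorant of order 1 / (1 + t^2) serves both the Gaussian range and the flat range of
  the decay estimate.\<close>

lemma exp_neg_square_le:
  fixes c t :: real
  assumes "c > 0"
  shows "exp (- c * t\<^sup>2) \<le> max 1 (1 / c) * inverse (1 + t\<^sup>2)"
proof -
  let ?K = "max 1 (1 / c)"
  have "1 \<le> ?K * c"
  proof -
    have "1 / c * c \<le> ?K * c" using assms by (intro mult_right_mono) auto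
    then show ?thesis using assms by simp
  qed
  then have "1 * t\<^sup>2 \<le> ?K * c * t\<^sup>2" by (rule mult_right_mono) simp
  then have "1 + t\<^sup>2 \<le> ?K * (1 + c * t\<^sup>2)" by (simp add: distrib_left mult.assoc)
  also have "\<dots> \<le> ?K * exp (c * t\<^sup>2)" by (intro mult_left_mono exp_ge_add_one_self) auto
  finally have "(1 + t\<^sup>2) * exp (- c * t\<^sup>2) \<le> ?K * exp (c * t\<^sup>2) * exp (- c * t\<^sup>2)" by (rule mult_right_mono) simp
  also have "\<dots> = ?K" by (simp add: mult.assoc flip: exp_add)
  finally have "exp (- c * t\<^sup>2) * (1 + t\<^sup>2) \<le> ?K" by (simp add: mult.commute)
  moreover have "1 + t\<^sup>2 > 0" by (simp add: add_pos_nonneg)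
  ultimately show ?thesis by (simp add: divide_inverse[symmetric] pos_le_divide_eq)
qed

lemma integral_gaussian:
  fixes l :: real
  assumes "l > 0"
  shows "(\<integral>t. exp (- l * t\<^sup>2) \<partial>lborel) = sqrt (pi / l)"
proof -
  let ?s = "1 / sqrt (2 * l)"
  have s2: "?s\<^sup>2 = 1 / (2 * l)" using assms by (simp add: power_divide)
  have "exp (- l * t\<^sup>2) = sqrt (pi / l) * normal_density 0 ?s t" for t
    unfolding normal_density_def s2 using assms by (simp add: mult.commute)
  then have "(\<integral>t. exp (- l * t\<^sup>2) \<partial>lborel) = sqrt (pi / l) * (\<integral>t. normal_density 0 ?s t \<partial>lborel)" by simp
  then show ?thesis using assms by simp
qed

lemma norm_tilted_gf_imaginary:
  assumes k: "k \<ge> 1" and s: "s > 0"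
  shows "norm (tilted_gf k n s (\<i> * of_real t)) = norm (no_seq_gf k (of_real (exp (- s)) * cis (s * sqrt s * t))) / no_seq_gf k (exp (- s))"
proof -
  have "exp (- complex_of_real s + of_real (s * sqrt s) * (\<i> * of_real t)) = of_real (exp (- s)) * cis (s * sqrt s * t)"
    unfolding exp_add by (simp add: cis_conv_exp mult_ac flip: exp_of_real)
  moreover have "norm (exp (- of_real (real n * (s * sqrt s)) * (\<i> * complex_of_real t))) = 1" by simp
  moreover have "no_seq_gf k (exp (- s)) \<ge> 1" using no_seq_gf_ge_1[OF k, of "exp (- s)"] s by simp
  ultimately show ?thesis unfolding tilted_gf_def norm_divide norm_mult[of "no_seq_gf k _"] by simp
qed

text \<open>Dominated convergence. In the variable t the decay estimate reads exp (- c min (t^2, 1 /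
  s)), so its Gaussian part is free of s.\<close>

lemma tilted_gf_integral_tendsto:
  assumes k: "k \<ge> 2"
  shows "(\<lambda>n. \<integral>t. indicator {-pi..pi} (saddle k n * sqrt (saddle k n) * t) *\<^sub>R tilted_gf k n (saddle k n) (\<i> * of_real t) \<partial>lborel)
    \<longlonglongrightarrow> of_real (sqrt (pi / growth_const k))"
proof -
  have k1: "k \<ge> 1" using k by simp
  let ?s = "saddle k"
  define \<sigma> where "\<sigma> n = ?s n * sqrt (?s n)" for n
  define f where "f n t = indicator {-pi..pi} (\<sigma> n * t) *\<^sub>R tilted_gf k n (?s n) (\<i> * of_real t)" for n t
  obtain c where c: "c > 0" "\<And>s \<theta>. 0 < s \<Longrightarrow> s \<le> 1 / 9 \<Longrightarrow> \<bar>\<theta>\<bar> \<le> pi \<Longrightarrow>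
      norm (no_seq_gf k (complex_of_real (exp (- s)) * cis \<theta>)) \<le> no_seq_gf k (exp (- s)) * exp (- c * min (\<theta>\<^sup>2 / s ^ 3) (1 / s))"
    by (rule no_seq_gf_cis_le[OF k]) (rule that)
  \<comment> \<open>In the flat range the condition that \<theta> has modulus at most pi gives t^2
    <= pi^2 / s^3, and exp (- c / s) beats this polynomial growth; hence the same majorant works
    there for small s.\<close>
  have "((\<lambda>s. exp (- c / s) * (1 + pi\<^sup>2 / s ^ 3)) \<longlongrightarrow> 0) (at_right 0)" using c(1) by real_asymp
  then have "(\<lambda>n. exp (- c / ?s n) * (1 + pi\<^sup>2 / ?s n ^ 3)) \<longlonglongrightarrow> 0"
    by (rule filterlim_compose[OF _ saddle_tendsto(2)[OF k]])
  then have "\<forall>\<^sub>F n in sequentially. exp (- c / ?s n) * (1 + pi\<^sup>2 / ?s n ^ 3) < 1" by (rule order_tendstoD) simp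
  moreover have "\<forall>\<^sub>F n in sequentially. ?s n < 1 / 9"
    by (rule order_tendstoD(2)[OF saddle_tendsto(1)[OF k]]) simp
  ultimately have "\<forall>\<^sub>F n in sequentially. exp (- c / ?s n) * (1 + pi\<^sup>2 / ?s n ^ 3) < 1 \<and> ?s n < 1 / 9 \<and> n > 0"
    using eventually_gt_at_top[of 0] by eventually_elim simp
  then obtain N where N: "\<And>n. n \<ge> N \<Longrightarrow> exp (- c / ?s n) * (1 + pi\<^sup>2 / ?s n ^ 3) < 1 \<and> ?s n < 1 / 9 \<and> n > 0"
    unfolding eventually_sequentially by blast
  define K where "K = max 1 (1 / c)"
  have K: "K \<ge> 1" by (simp add: K_def)
  have pos: "?s n > 0" if "n \<ge> N" for n using N[OF that] by (intro saddle_tendsto(3)[OF k]) simp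
  have bd: "norm (f n t) \<le> K * inverse (1 + t\<^sup>2)" if n: "n \<ge> N" for n t
  proof (cases "\<bar>\<sigma> n * t\<bar> \<le> pi")
    case False
    then have "f n t = 0" by (auto simp: f_def indicator_def)
    then show ?thesis using K by (simp add: add_nonneg_nonneg)
  next
    case True
    define s where "s = ?s n"
    have s: "s > 0" "s \<le> 1 / 9" "exp (- c / s) * (1 + pi\<^sup>2 / s ^ 3) \<le> 1" using pos[OF n] N[OF n] by (auto simp: s_def)
    have \<sigma>2: "(\<sigma> n * t)\<^sup>2 = s ^ 3 * t\<^sup>2"
      using s by (simp add: \<sigma>_def s_def[symmetric] power_mult_distrib) (simp add: power2_eq_square power3_eq_cube)
    have G: "no_seq_gf k (exp (- s)) \<ge> 1" using no_seq_gf_ge_1[OF k1, of "exp (- s)"] s by simp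
    have "norm (f n t) \<le> norm (tilted_gf k n s (\<i> * of_real t))"
      by (auto simp: f_def indicator_def s_def)
    also have "\<dots> = norm (no_seq_gf k (of_real (exp (- s)) * cis (\<sigma> n * t))) / no_seq_gf k (exp (- s))"
      unfolding norm_tilted_gf_imaginary[OF k1 s(1)] by (simp add: \<sigma>_def s_def)
    also have "\<dots> \<le> exp (- c * min ((\<sigma> n * t)\<^sup>2 / s ^ 3) (1 / s))"
      using c(2)[OF s(1,2) True] G by (simp add: divide_le_eq mult.commute)
    also have "(\<sigma> n * t)\<^sup>2 / s ^ 3 = t\<^sup>2" unfolding \<sigma>2 using s by simp
    also have "exp (- c * min (t\<^sup>2) (1 / s)) \<le> K * inverse (1 + t\<^sup>2)"
    proof (cases "t\<^sup>2 \<le> 1 / s")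
      case True
      then show ?thesis using exp_neg_square_le[OF c(1), of t] by (simp add: min_def K_def)
    next
      case False
      have "(\<sigma> n * t)\<^sup>2 \<le> pi\<^sup>2" using True by (metis abs_le_square_iff abs_of_pos pi_gt_zero)
      then have "t\<^sup>2 \<le> pi\<^sup>2 / s ^ 3" unfolding \<sigma>2 using s by (simp add: pos_le_divide_eq mult.commute)
      then have "exp (- c / s) * (1 + t\<^sup>2) \<le> exp (- c / s) * (1 + pi\<^sup>2 / s ^ 3)" by (intro mult_left_mono) auto
      also have "\<dots> \<le> K" using s(3) K by linarith
      finally have "exp (- c / s) * (1 + t\<^sup>2) \<le> K" .
      moreover have "1 + t\<^sup>2 > 0" by (simp add: add_pos_nonneg)
      ultimately have "exp (- c / s) \<le> K * inverse (1 + t\<^sup>2)" by (simp add: divide_inverse[symmetric] pos_le_divide_eq)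
      then show ?thesis using False by (simp add: min_def)
    qed
    finally show ?thesis .
  qed
  have "(\<lambda>n. \<integral>t. f (n + N) t \<partial>lborel) \<longlonglongrightarrow> (\<integral>t. of_real (exp (- growth_const k * t\<^sup>2)) \<partial>lborel)"
  proof (rule integral_dominated_convergence[where w = "\<lambda>t. K * inverse (1 + t\<^sup>2)"])
    show "integrable lborel (\<lambda>t. K * inverse (1 + t\<^sup>2))"
      by (intro integrable_mult_right integrable_inverse_1_plus_square_UNIV)
    show "f (n + N) \<in> borel_measurable lborel" for n
    proof -
      have s: "?s (n + N) > 0" by (rule pos) simp
      have "continuous_on UNIV (\<lambda>t. tilted_gf k (n + N) (?s (n + N)) (\<i> * of_real t))"
        by (rule continuous_on_compose2[OF holomorphic_on_imp_continuous_on[OF tilted_gf_holomorphic[OF k1 s]]])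
           (use s in \<open>auto intro!: continuous_intros\<close>)
      then have [measurable]: "(\<lambda>t. tilted_gf k (n + N) (?s (n + N)) (\<i> * of_real t)) \<in> borel_measurable borel"
        by (rule borel_measurable_continuous_onI)
      show ?thesis unfolding f_def by measurable
    qed
    show "AE t in lborel. norm (f (n + N) t) \<le> K * inverse (1 + t\<^sup>2)" for n by (intro AE_I2 bd) simp
    show "AE t in lborel. (\<lambda>n. f (n + N) t) \<longlonglongrightarrow> of_real (exp (- growth_const k * t\<^sup>2))"
    proof (intro AE_I2 LIMSEQ_ignore_initial_segment)
      fix t :: real
      have "(\<lambda>n. \<sigma> n * t) \<longlonglongrightarrow> (0 * sqrt 0) * t" unfolding \<sigma>_def by (intro tendsto_intros saddle_tendsto k)
      then have "(\<lambda>n. \<bar>\<sigma> n * t\<bar>) \<longlonglongrightarrow> 0" using tendsto_rabs by fastforce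
      then have "\<forall>\<^sub>F n in sequentially. \<bar>\<sigma> n * t\<bar> < pi" by (rule order_tendstoD) simp
      then have ev: "\<forall>\<^sub>F n in sequentially. tilted_gf k n (?s n) (\<i> * of_real t) = f n t"
        by eventually_elim (auto simp: f_def indicator_def)
      have "(\<lambda>n. tilted_gf k n (?s n) (\<i> * of_real t)) \<longlonglongrightarrow> exp (of_real (growth_const k) * (\<i> * of_real t)\<^sup>2)"
        by (rule tilted_gf_tendsto[OF k])
      also have "exp (of_real (growth_const k) * (\<i> * of_real t)\<^sup>2) = complex_of_real (exp (- growth_const k * t\<^sup>2))"
        by (simp add: power_mult_distrib flip: exp_of_real)
      finally show "(\<lambda>n. f n t) \<longlonglongrightarrow> of_real (exp (- growth_const k * t\<^sup>2))"
        by (rule Lim_transform_eventually[OF _ ev])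
    qed
  qed simp
  then have "(\<lambda>n. \<integral>t. f n t \<partial>lborel) \<longlonglongrightarrow> (\<integral>t. of_real (exp (- growth_const k * t\<^sup>2)) \<partial>lborel)" by (rule LIMSEQ_offset)
  then show ?thesis
    unfolding f_def \<sigma>_def integral_complex_of_real integral_gaussian[OF growth_const_pos[OF k]] .
qed

text \<open>At the saddle point n s = \<lambda> / s, so exp (n s) times the generating function is
  exp (2 \<lambda> / s) / k asymptotically, with 2 \<lambda> / s = 2 sqrt (\<lambda> n). The
  Gaussian integral and the scale s powr (3/2) supply the power of n and the constant.\<close>

theorem theorem1p3:
  fixes k :: nat
  assumes "k \<ge> 2"
  shows "asymp_equiv (\<lambda>n. real (p_no_seq k n)) at_top
    (\<lambda>n. 1 / (2 * real k)
          * (1 / 6 * (1 - 2 / (real k * (real k + 1)))) powr (1 / 4)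
          * (1 / real n powr (3 / 4))
          * exp (pi * sqrt (2 / 3 * (1 - 2 / (real k * (real k + 1))) * real n)))"
proof (rule asymp_equivI')
  let ?l = "growth_const k" and ?s = "saddle k"
  let ?G = "\<lambda>s. no_seq_gf k (exp (- s))"
  let ?b = "1 - 2 / (real k * (real k + 1))"
  let ?T = "\<lambda>n. 1 / (2 * real k) * (1 / 6 * ?b) powr (1 / 4) * (1 / real n powr (3 / 4)) * exp (pi * sqrt (2 / 3 * ?b * real n))"
  let ?J = "\<lambda>n. 2 * pi * real (p_no_seq k n) / (exp (real n * ?s n) * ?G (?s n) * (?s n * sqrt (?s n)))"
  have k1: "k \<ge> 1" using assms by simp
  have l: "?l > 0" by (rule growth_const_pos[OF assms])
  have b: "?b > 0" using l by (simp add: growth_const_def zero_less_mult_iff)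
  have "(\<lambda>n. complex_of_real (?J n)) \<longlonglongrightarrow> of_real (sqrt (pi / ?l))"
  proof (rule Lim_transform_eventually[OF tilted_gf_integral_tendsto[OF assms]])
    show "\<forall>\<^sub>F n in sequentially. (\<integral>t. indicator {-pi..pi} (?s n * sqrt (?s n) * t) *\<^sub>R tilted_gf k n (?s n) (\<i> * of_real t) \<partial>lborel) = of_real (?J n)"
      using eventually_gt_at_top[of 0]
    proof eventually_elim
      case (elim n)
      have s: "?s n > 0" by (rule saddle_tendsto(3)[OF assms elim])
      have "?G (?s n) > 0" using no_seq_gf_ge_1[OF k1, of "exp (- ?s n)"] s by simp
      then have "exp (real n * ?s n) * ?G (?s n) * (?s n * sqrt (?s n)) \<noteq> 0" using s by simp
      moreover have "J = of_real (a / b)" if "of_real a = of_real b * J" "b \<noteq> 0" for J :: complex and a b :: real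
        using that by (simp add: field_simps)
      ultimately show ?case using coefficient_tilted_integral[OF k1 s, of n] by blast
    qed
  qed
  then have J: "?J \<longlonglongrightarrow> sqrt (pi / ?l)" by (simp only: tendsto_of_real_iff)
  have A: "(\<lambda>n. ?G (?s n) * exp (- ?l / ?s n)) \<longlonglongrightarrow> 1 / real k"
    by (rule filterlim_compose[OF no_seq_gf_asymp[OF k1] saddle_tendsto(2)[OF assms]])
  have lim: "(\<lambda>n. ?J n * (?G (?s n) * exp (- ?l / ?s n)) * (real k * sqrt (?l / pi))) \<longlonglongrightarrow>
      sqrt (pi / ?l) * (1 / real k) * (real k * sqrt (?l / pi))"
    by (intro tendsto_intros J A)
  have "sqrt (pi / ?l) * sqrt (?l / pi) = 1" using l by (simp flip: real_sqrt_mult)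
  then have one: "sqrt (pi / ?l) * (1 / real k) * (real k * sqrt (?l / pi)) = 1" using k1 by simp
  show "(\<lambda>n. real (p_no_seq k n) / ?T n) \<longlonglongrightarrow> 1"
  proof (rule Lim_transform_eventually[OF lim[unfolded one]])
    show "\<forall>\<^sub>F n in sequentially. ?J n * (?G (?s n) * exp (- ?l / ?s n)) * (real k * sqrt (?l / pi)) = real (p_no_seq k n) / ?T n"
      using eventually_gt_at_top[of 0]
    proof eventually_elim
      case (elim n)
      define s where "s = ?s n"
      define E where "E = exp (?l / s)"
      \<comment> \<open>With L^4 = \<lambda> and Q = n powr (3/4) all fractional powers become
        monomials: s powr (3/2) = L^3 / Q, sqrt \<lambda> = L^2, and the quartic root in the
        statement is L / sqrt pi. What remains is field arithmetic.\<close>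
      define L where "L = ?l powr (1 / 4)"
      define Q where "Q = real n powr (3 / 4)"
      have s: "s > 0" unfolding s_def by (rule saddle_tendsto(3)[OF assms elim])
      have G: "?G s > 0" using no_seq_gf_ge_1[OF k1, of "exp (- s)"] s by simp
      have L: "L > 0" and Q: "Q > 0" and E: "E > 0" using l elim by (auto simp: L_def Q_def E_def)
      have n: "real n = ?l / s\<^sup>2" using saddle_tendsto(4)[OF assms elim] by (simp add: s_def)
      have e1: "exp (real n * s) = E" unfolding E_def n using s by (simp add: power2_eq_square)
      have e2: "exp (- ?l / s) = 1 / E" unfolding E_def by (simp add: exp_minus inverse_eq_divide)
      have e3: "exp (pi * sqrt (2 / 3 * ?b * real n)) = E * E"
      proof -
        have "2 / 3 * ?b * real n = (2 * ?l / (s * pi))\<^sup>2"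
        proof -
          have "2 / 3 * x * (p\<^sup>2 / 6 * x / s\<^sup>2) = (2 * (p\<^sup>2 / 6 * x) / (s * p))\<^sup>2" if "p > 0" for x p
            using s that by (simp add: field_simps power2_eq_square)
          from this[OF pi_gt_zero] show ?thesis unfolding n growth_const_def .
        qed
        then have "sqrt (2 / 3 * ?b * real n) = 2 * ?l / (s * pi)" using l s by simp
        then have "pi * sqrt (2 / 3 * ?b * real n) = ?l / s + ?l / s" by simp
        then show ?thesis unfolding E_def by (simp only: exp_add)
      qed
      have L2: "sqrt ?l = L\<^sup>2" and L3: "?l powr (3 / 4) = L ^ 3" using l
        by (simp_all add: L_def powr_power powr_half_sqrt)
      have \<sigma>: "s * sqrt s = L ^ 3 / Q"
      proof -
        have "s = (?l / real n) powr (1 / 2)" using l by (simp add: s_def saddle_def powr_half_sqrt)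
        then have "s * sqrt s = (?l / real n) powr (1 / 2) * ((?l / real n) powr (1 / 2)) powr (1 / 2)"
          using s by (simp add: powr_half_sqrt)
        also have "\<dots> = (?l / real n) powr (3 / 4)" by (simp add: powr_powr flip: powr_add)
        also have "\<dots> = L ^ 3 / Q" using l by (simp add: powr_divide L3 Q_def)
        finally show ?thesis .
      qed
      have b4: "(1 / 6 * ?b) powr (1 / 4) = L / sqrt pi"
      proof -
        have "(pi\<^sup>2) powr (1 / 4) = pi powr (1 / 2)" using powr_powr[of pi 2 "1 / 4"] by simp
        then have "(pi\<^sup>2) powr (1 / 4) = sqrt pi" by (simp add: powr_half_sqrt)
        moreover have "1 / 6 * ?b = ?l / pi\<^sup>2" by (simp add: growth_const_def)
        ultimately show ?thesis unfolding L_def using l by (simp add: powr_divide)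
      qed
      have "pi = sqrt pi * sqrt pi" by simp
      then have "2 * pi * P / (E * g * (L ^ 3 / Q)) * (g * (1 / E)) * (real k * (L\<^sup>2 / sqrt pi)) =
         P / (1 / (2 * real k) * (L / sqrt pi) * (1 / Q) * (E * E))" if "g > 0" for P g :: real
        using L Q E that k1 by (simp add: field_simps power2_eq_square power3_eq_cube)
      from this[OF G] show ?case
        unfolding s_def[symmetric] e1 e2 e3 \<sigma> b4 real_sqrt_divide L2 Q_def[symmetric] .
    qed
  qed
qed

end
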